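(* Fix $A>0$ and $c>1$. Let $\alpha$ be chosen from the uniform distribution on $[0,1]$. For an integer $N\ge 1$ let $\operatorname{EST}(A,c,N)$ be the number of rationals $p/q$ (with $p\in\mathbb Z$, $q\in\mathbb Z_{\ge1}$, $\gcd(p,q)=1$) such that $N\le q\le cN$ and $\left|\alpha-\frac pq\right|\le \frac{A}{q^2}$, and let $K(A,N)$ be the number of pairs $(p,q)\in\mathbb Z^2$ with $\gcd(p,q)=1$ such that $1\le q\le N$ and $|\alpha q-p|\le \frac AN$. Then for every integer $k\ge 0$ the limits $\lim_{N\to\infty}P(\operatorname{EST}(A,c,N)=k)$ and $\lim_{N\to\infty}P(K(A,N)=k)$ exist, and $$\lim_{N\to\infty}P(\operatorname{EST}(A,c,N)=k)=\mu_2\big(\{\Lambda\in X_2:\#(\Lambda_{\mathrm{prim}}\cap H_{A,c})=k\}\big),$$ $$\lim_{N\to\infty}P(K(A,N)=k)=\mu_2\big(\{\Lambda\in X_2:\#(\Lambda_{\mathrm{prim}}\cap R_{A})=k\}\big),$$ where $H_{A,c}=\{(x,y)\in\mathbb R^2: |x|y\le A,\ 1\le y\le c\}$ and $R_A=\{(x,y)\in\mathbb R^2:|x|\le A,\ 0\le y\le 1\}$.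
   Context: $X_2=\mathrm{SL}(2,\mathbb R)/\mathrm{SL}(2,\mathbb Z)$ is identified with the space of unimodular lattices in $\mathbb R^2$ via $g\,\mathrm{SL}(2,\mathbb Z)\mapsto g\mathbb Z^2$, and $\mu_2$ is the Haar probability measure on $X_2$. For $\Lambda=g\mathbb Z^2$, $\Lambda_{\mathrm{prim}}=\{gw: w\in\mathbb Z^2\setminus\{0\},\ \gcd(w)=1\}$ is the set of primitive vectors of $\Lambda$. *)

theory Defs
  imports "HOL-Analysis.Analysis"
begin

definition int_vec :: "int \<Rightarrow> int \<Rightarrow> real^2" where
  "int_vec a b = (\<chi> i. if i = 1 then of_int a else of_int b)"

definition SL2R :: "(real^2^2) set" where
  "SL2R = {g. det g = 1}"

definition lattice_of :: "real^2^2 \<Rightarrow> (real^2) set" where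
  "lattice_of g = {g *v int_vec a b | a b. True}"

definition X2 :: "(real^2) set set" where
  "X2 = lattice_of ` SL2R"

text \<open>Primitive vectors of Lambda = g Z^2 (independent of the choice of g).\<close>
definition prim_of :: "real^2^2 \<Rightarrow> (real^2) set" where
  "prim_of g = {g *v int_vec a b | a b. gcd a b = 1}"

definition lattice_prim :: "(real^2) set \<Rightarrow> (real^2) set" where
  "lattice_prim L = prim_of (SOME g. g \<in> SL2R \<and> lattice_of g = L)"

text \<open>Haar measure on SL(2,R) via the cone construction:
  Haar(E) = Lebesgue measure (in R^4 = real^2^2) of {t g | 0 < t <= 1, g in E}.
  This is left and right SL(2,R)-invariant since multiplication by a
  determinant-one matrix is a volume preserving linear map of real^2^2.\<close>
definition cone :: "(real^2^2) set \<Rightarrow> (real^2^2) set" where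
  "cone E = {t *\<^sub>R g | t g. 0 < t \<and> t \<le> 1 \<and> g \<in> E}"

definition haar_SL2 :: "(real^2^2) set \<Rightarrow> real" where
  "haar_SL2 E = measure lebesgue (cone E)"

text \<open>Fundamental set for the right action of SL(2,Z): matrices whose columns
  (v1,v2) form a Lagrange-Gauss reduced basis.  Up to a null set every coset
  g SL(2,Z) meets it in exactly two points (g' and -g'), so normalising gives
  the Haar probability measure on X_2.\<close>
definition FD :: "(real^2^2) set" where
  "FD = {g \<in> SL2R. norm (column 1 g) \<le> norm (column 2 g) \<and>
                 2 * \<bar>column 1 g \<bullet> column 2 g\<bar> \<le> (norm (column 1 g))\<^sup>2}"

definition mu2 :: "(real^2) set set \<Rightarrow> real" where
  "mu2 S = haar_SL2 {g \<in> FD. lattice_of g \<in> S} / haar_SL2 FD"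

definition H_set :: "real \<Rightarrow> real \<Rightarrow> (real^2) set" where
  "H_set A c = {v. \<bar>v$1\<bar> * v$2 \<le> A \<and> 1 \<le> v$2 \<and> v$2 \<le> c}"

definition R_set :: "real \<Rightarrow> (real^2) set" where
  "R_set A = {v. \<bar>v$1\<bar> \<le> A \<and> 0 \<le> v$2 \<and> v$2 \<le> 1}"

definition EST :: "real \<Rightarrow> real \<Rightarrow> nat \<Rightarrow> real \<Rightarrow> nat" where
  "EST A c N \<alpha> = card {(p :: int, q :: int). q \<ge> 1 \<and> gcd p q = 1 \<and>
      real N \<le> of_int q \<and> of_int q \<le> c * real N \<and>
      \<bar>\<alpha> - of_int p / of_int q\<bar> \<le> A / (of_int q)\<^sup>2}"

definition Kcount :: "real \<Rightarrow> nat \<Rightarrow> real \<Rightarrow> nat" where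
  "Kcount A N \<alpha> = card {(p :: int, q :: int). gcd p q = 1 \<and>
      1 \<le> q \<and> of_int q \<le> real N \<and>
      \<bar>\<alpha> * of_int q - of_int p\<bar> \<le> A / real N}"

definition unif_prob :: "(real \<Rightarrow> bool) \<Rightarrow> real" where
  "unif_prob E = measure lborel {\<alpha> \<in> {0..1}. E \<alpha>}"

end

theory Submission
  imports Defs
begin

text \<open>
  For each alpha the two counts are numbers of primitive vectors, in a fixed compact region, of the
  lattice spanned by the columns of [[N, N alpha], [0, 1/N]]. So the claim is the equidistribution
  of long closed horocycles, tested on sets whose boundary is null.

  Use coordinates (y, t) on SL(2,R): y is the bottom row of the matrix and the top row is
  (y2, -y1)/|y|^2 + t y. Haar measure is then dy dt up to a factor. The bases of the horocycle
  lattice have the bottom rows (c, d)/N with (c, d) coprime, and for a fixed (c, d) the remaining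
  choices, together with alpha in [0,1), sweep out the t-axis once, at speed N^2. Hence the average
  over alpha of the number of bases lying in a set S equals the sum over coprime (c, d) of N^(-2)
  times the length of the slice of S over (c, d)/N, and a sieve shows that this converges to a
  constant times the measure of S for all boxes S.

  Almost every lattice has exactly two reduced bases. Taking for S the reduced bases of lattices
  with k primitive vectors in the region, respectively with a different number, gives lower bounds
  for the probability and for its complement. They add up to 1 because little mass escapes into the
  cusp: the probability of a lattice vector shorter than epsilon is at most 4 epsilon^2. This
  normalisation also makes the value of the density constant irrelevant.
\<close>

section \<open>Density of coprime pairs\<close>

text \<open>The coordinates are adapted to the horocycle flow: left multiplication by the unipotent
  matrix with upper right entry s fixes y and moves t to t + s. Since [[N, N alpha], [0, 1/N]] is
  the unipotent with entry N^2 alpha times diag(N, 1/N), alpha moves only t, and with speed N^2.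
  This reduces equidistribution to counting the points (c, d)/N. The obstacle is that such counts
  control bounded sets only, from above if compact and from below if open, while the reduced bases
  reach into the cusp. Two notions of reduction are therefore played against each other. Strict
  reduction is open and unique up to sign for every alpha, which bounds a mass of bases by twice a
  probability. Weak reduction exists for every alpha and becomes compact once first columns shorter
  than epsilon are cut off, which shows that hardly any of the total mass 2 is missing. The two
  differ by a null set, so density times volume is exactly 2.\<close>

lemma card_int_atLeastLessThan_real:
  fixes u v :: real
  shows "card {k::int. u \<le> of_int k \<and> of_int k < v} = nat (\<lceil>v\<rceil> - \<lceil>u\<rceil>)"
proof -
  have "{k::int. u \<le> of_int k \<and> of_int k < v} = {\<lceil>u\<rceil>..<\<lceil>v\<rceil>}"
    by (auto simp: ceiling_le_iff less_ceiling_iff)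
  then show ?thesis by simp
qed

text \<open>The class is the progression r + M k with k in a half-open interval of length (y - x)/M,
  and a difference of ceilings is within 1 of the difference itself.\<close>

lemma card_residue_class_bound:
  fixes x y :: real and M r :: int
  assumes "x \<le> y" "M > 0" "0 \<le> r" "r < M"
  shows "\<bar>real (card {n::int. x \<le> of_int n \<and> of_int n < y \<and> n mod M = r}) - (y - x) / M\<bar> \<le> 1"
proof -
  define u where "u = (x - r) / M"
  define v where "v = (y - r) / M"
  have M: "real_of_int M > 0" using assms by simp
  have eq: "{n::int. x \<le> of_int n \<and> of_int n < y \<and> n mod M = r}
        = (\<lambda>k. r + M * k) ` {k. u \<le> of_int k \<and> of_int k < v}" (is "?A = ?f ` ?B")
  proof (intro set_eqI iffI)
    fix n assume n: "n \<in> ?A"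
    then have "n = r + M * (n div M)" by (metis (mono_tags, lifting) mem_Collect_eq mod_mult_div_eq)
    moreover from this have "real_of_int n = r + M * real_of_int (n div M)"
      by (metis of_int_add of_int_mult)
    then have "n div M \<in> ?B" using n M by (auto simp: u_def v_def field_simps)
    ultimately show "n \<in> ?f ` ?B" by blast
  next
    fix n assume "n \<in> ?f ` ?B"
    then show "n \<in> ?A" using M assms by (auto simp: u_def v_def field_simps)
  qed
  have "inj_on ?f ?B" using assms by (auto simp: inj_on_def)
  then have c: "card ?A = nat (\<lceil>v\<rceil> - \<lceil>u\<rceil>)"
    unfolding eq by (simp add: card_image card_int_atLeastLessThan_real)
  have uv: "v - u = (y - x) / M" by (simp add: u_def v_def diff_divide_distrib)
  have "u \<le> v" using uv M assms(1) by (simp add: field_simps u_def v_def)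
  then have "\<lceil>u\<rceil> \<le> \<lceil>v\<rceil>" by (rule ceiling_mono)
  then have "real (card ?A) = of_int \<lceil>v\<rceil> - of_int \<lceil>u\<rceil>" unfolding c by simp
  then show ?thesis unfolding uv[symmetric] by linarith
qed

lemma finite_int_between_reals:
  fixes x y :: real
  shows "finite {n::int. x \<le> of_int n \<and> of_int n < y \<and> P n}"
proof (rule finite_subset)
  show "{n::int. x \<le> of_int n \<and> of_int n < y \<and> P n} \<subseteq> {\<lceil>x\<rceil>..<\<lceil>y\<rceil>}"
    by (auto simp: ceiling_le_iff less_ceiling_iff)
qed simp

lemma residue_class_density:
  fixes a b :: real and M r :: int
  assumes "a \<le> b" "M > 0" "0 \<le> r" "r < M"
  shows "(\<lambda>N::nat. real (card {n::int. N * a \<le> of_int n \<and> of_int n < N * b \<and> n mod M = r}) / N)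
           \<longlonglongrightarrow> (b - a) / M"
proof -
  let ?f = "\<lambda>N::nat. real (card {n::int. N * a \<le> of_int n \<and> of_int n < N * b \<and> n mod M = r})"
  have "(\<lambda>N. ?f N / N - (b - a) / M) \<longlonglongrightarrow> 0"
  proof (rule Lim_null_comparison)
    show "\<forall>\<^sub>F N in sequentially. norm (?f N / N - (b - a) / M) \<le> 1 / real N"
    proof (rule eventually_sequentiallyI[of 1])
      fix N :: nat assume N: "1 \<le> N"
      have "\<bar>?f N - (N * b - N * a) / M\<bar> \<le> 1"
        using assms by (intro card_residue_class_bound) (auto intro: mult_left_mono)
      then have "\<bar>?f N - (N * b - N * a) / M\<bar> / N \<le> 1 / N" by (intro divide_right_mono) auto
      moreover have "?f N / N - (b - a) / M = (?f N - (N * b - N * a) / M) / N"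
        using N assms(2) by (simp add: field_simps)
      ultimately show "norm (?f N / N - (b - a) / M) \<le> 1 / real N"
        using N by (simp add: abs_divide)
    qed
    show "(\<lambda>N. 1 / real N) \<longlonglongrightarrow> 0" by (rule lim_1_over_n)
  qed
  then show ?thesis by (simp add: LIM_zero_iff)
qed

section \<open>Sieving integer pairs by the primes up to z\<close>

definition scaled_box :: "nat \<Rightarrow> real \<Rightarrow> real \<Rightarrow> real \<Rightarrow> real \<Rightarrow> (int \<times> int) set" where
  "scaled_box N a1 b1 a2 b2 = {(m, n). N * a1 \<le> of_int m \<and> of_int m < N * b1 \<and>
                                       N * a2 \<le> of_int n \<and> of_int n < N * b2}"

text \<open>For M = z! this says that no prime up to z divides both entries: coprimality is replaced
  by a condition on residues mod M. Factorials form a divisibility chain that eventually contains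
  every prime.\<close>

definition sieved :: "int \<Rightarrow> (int \<times> int) set" where
  "sieved M = {(m, n). coprime (gcd m n) M}"

definition sieve_density :: "int \<Rightarrow> real" where
  "sieve_density M = real (card (sieved M \<inter> {0..<M} \<times> {0..<M})) / M\<^sup>2"

definition coprime_pairs :: "(int \<times> int) set" where
  "coprime_pairs = {w. coprime (fst w) (snd w)}"

lemma finite_scaled_box: "finite (scaled_box N a1 b1 a2 b2)"
proof (rule finite_subset)
  show "scaled_box N a1 b1 a2 b2 \<subseteq> {\<lceil>N * a1\<rceil>..<\<lceil>N * b1\<rceil>} \<times> {\<lceil>N * a2\<rceil>..<\<lceil>N * b2\<rceil>}"
    by (auto simp: scaled_box_def ceiling_le_iff less_ceiling_iff)
qed simp

text \<open>Periodicity of the sieve: gcd (gcd m n) M is the gcd of gcd m M and gcd n M, and each of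
  these sees only a residue.\<close>

lemma coprime_gcd_mod:
  fixes M :: int
  shows "coprime (gcd (m mod M) (n mod M)) M \<longleftrightarrow> coprime (gcd m n) M"
proof -
  have "gcd (gcd (m mod M) (n mod M)) M = gcd (gcd (m mod M) M) (gcd (n mod M) M)"
    by (metis gcd.assoc gcd.commute gcd.left_idem)
  also have "\<dots> = gcd (gcd m M) (gcd n M)"
    by (metis gcd.commute gcd_red_int)
  also have "\<dots> = gcd (gcd m n) M"
    by (metis gcd.assoc gcd.commute gcd.left_idem)
  finally show ?thesis by (simp add: coprime_iff_gcd_eq_1)
qed

text \<open>By periodicity the set splits into products of residue classes, one for each admissible
  pair of residues, and each factor has density 1/M on its own axis.\<close>

lemma sieved_density:
  fixes M :: int
  assumes "M > 0" "a1 \<le> b1" "a2 \<le> b2"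
  shows "(\<lambda>N. real (card (sieved M \<inter> scaled_box N a1 b1 a2 b2)) / (real N)\<^sup>2)
           \<longlonglongrightarrow> sieve_density M * ((b1 - a1) * (b2 - a2))"
proof -
  define I where "I = sieved M \<inter> {0..<M} \<times> {0..<M}"
  define X where "X N r = {n::int. real N * a1 \<le> of_int n \<and> of_int n < real N * b1 \<and> n mod M = r}" for N r
  define Y where "Y N r = {n::int. real N * a2 \<le> of_int n \<and> of_int n < real N * b2 \<and> n mod M = r}" for N r
  have fin: "finite I" by (simp add: I_def)
  have card: "card (sieved M \<inter> scaled_box N a1 b1 a2 b2)
      = (\<Sum>i\<in>I. card (X N (fst i)) * card (Y N (snd i)))" for N
  proof -
    have "sieved M \<inter> scaled_box N a1 b1 a2 b2 = (\<Union>i\<in>I. X N (fst i) \<times> Y N (snd i))"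
    proof (intro set_eqI iffI)
      fix w assume w: "w \<in> sieved M \<inter> scaled_box N a1 b1 a2 b2"
      obtain m n where mn: "w = (m, n)" by fastforce
      have "(m mod M, n mod M) \<in> I" "w \<in> X N (m mod M) \<times> Y N (n mod M)"
        using w assms(1) by (auto simp: mn sieved_def scaled_box_def I_def X_def Y_def coprime_gcd_mod)
      then show "w \<in> (\<Union>i\<in>I. X N (fst i) \<times> Y N (snd i))" by force
    next
      fix w assume "w \<in> (\<Union>i\<in>I. X N (fst i) \<times> Y N (snd i))"
      then show "w \<in> sieved M \<inter> scaled_box N a1 b1 a2 b2"
        by (auto simp: sieved_def scaled_box_def I_def X_def Y_def coprime_gcd_mod)
    qed
    also have "card \<dots> = (\<Sum>i\<in>I. card (X N (fst i) \<times> Y N (snd i)))"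
    proof (rule card_UN_disjoint[OF fin])
      show "\<forall>i\<in>I. finite (X N (fst i) \<times> Y N (snd i))"
        by (auto simp: X_def Y_def intro!: finite_int_between_reals)
      show "\<forall>i\<in>I. \<forall>j\<in>I. i \<noteq> j \<longrightarrow> (X N (fst i) \<times> Y N (snd i)) \<inter> (X N (fst j) \<times> Y N (snd j)) = {}"
        by (auto simp: X_def Y_def prod_eq_iff)
    qed
    finally show ?thesis by (simp add: card_cartesian_product)
  qed
  have "(\<lambda>N. \<Sum>i\<in>I. (real (card (X N (fst i))) / N) * (real (card (Y N (snd i))) / N))
      \<longlonglongrightarrow> (\<Sum>i\<in>I. ((b1 - a1) / M) * ((b2 - a2) / M))"
    unfolding X_def Y_def using assms
    by (intro tendsto_sum tendsto_mult residue_class_density) (auto simp: I_def)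
  moreover have "(\<Sum>i\<in>I. ((b1 - a1) / M) * ((b2 - a2) / M)) = sieve_density M * ((b1 - a1) * (b2 - a2))"
    by (simp add: sieve_density_def I_def power2_eq_square)
  moreover have "(\<Sum>i\<in>I. (real (card (X N (fst i))) / N) * (real (card (Y N (snd i))) / N))
     = real (card (sieved M \<inter> scaled_box N a1 b1 a2 b2)) / (real N)\<^sup>2" for N
    unfolding card by (simp add: power2_eq_square sum_divide_distrib)
  ultimately show ?thesis by simp
qed

text \<open>Telescoping with 1/g^2 <= 1/(g-1) - 1/g. The induction carries the subtracted end term
  1/(z+k), which is dropped at the end.\<close>

lemma sum_inverse_squares_tail:
  fixes z L :: nat
  assumes "z \<ge> 1"
  shows "(\<Sum>g\<in>{z<..L}. 1 / (real g)\<^sup>2) \<le> 1 / z"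
proof -
  have "(\<Sum>g\<in>{z<..z+k}. 1 / (real g)\<^sup>2) \<le> 1 / z - 1 / (z + k)" for k
  proof (induction k)
    case 0 show ?case by simp
  next
    case (Suc k)
    have "{z<..z + Suc k} = insert (z + Suc k) {z<..z+k}" by auto
    then have "(\<Sum>g\<in>{z<..z + Suc k}. 1 / (real g)\<^sup>2)
       = 1 / (real (z + Suc k))\<^sup>2 + (\<Sum>g\<in>{z<..z+k}. 1 / (real g)\<^sup>2)" by simp
    also have "\<dots> \<le> 1 / (real (z + Suc k))\<^sup>2 + (1 / z - 1 / (z + k))" using Suc by simp
    also have "1 / (real (z + Suc k))\<^sup>2 \<le> 1 / (real (z + k) * real (z + Suc k))"
      using assms by (intro divide_left_mono) (auto simp: power2_eq_square intro!: mult_right_mono)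
    also have "\<dots> = 1 / real (z + k) - 1 / real (z + Suc k)"
      using assms by (simp add: field_simps)
    finally show ?case by simp
  qed
  from this[of "L - z"] show ?thesis
  proof (cases "z \<le> L")
    case True
    then show ?thesis using \<open>(\<Sum>g\<in>{z<..z+(L-z)}. 1 / (real g)\<^sup>2) \<le> 1 / z - 1 / (z + (L-z))\<close>
      by (smt (verit) le_add_diff_inverse of_nat_0_le_iff zero_le_divide_1_iff)
  qed (auto)
qed

text \<open>At most 2 X/g + 1 multiples fit, and g <= X absorbs the 1 into a third X/g. For g far
  above X the bound would fail, because 0 is always counted.\<close>

lemma card_multiples_le:
  fixes g :: nat and X :: real
  assumes "g \<ge> 1" "real g \<le> X"
  shows "real (card {n::int. \<bar>of_int n\<bar> \<le> X \<and> int g dvd n}) \<le> 3 * X / g"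
    and "finite {n::int. \<bar>of_int n\<bar> \<le> X \<and> int g dvd n}"
proof -
  let ?B = "{- \<lfloor>X / g\<rfloor>..\<lfloor>X / g\<rfloor>}"
  have sub: "{n::int. \<bar>of_int n\<bar> \<le> X \<and> int g dvd n} \<subseteq> (\<lambda>k. int g * k) ` ?B"
  proof
    fix n :: int assume n: "n \<in> {n::int. \<bar>of_int n\<bar> \<le> X \<and> int g dvd n}"
    then obtain k where k: "n = int g * k" by auto
    have "\<bar>of_int k\<bar> \<le> X / g" using n assms by (simp add: k abs_mult field_simps)
    then have "k \<in> ?B" by (simp add: le_floor_iff) linarith
    then show "n \<in> (\<lambda>k. int g * k) ` ?B" using k by blast
  qed
  show "finite {n::int. \<bar>of_int n\<bar> \<le> X \<and> int g dvd n}"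
    by (rule finite_subset[OF sub]) simp
  have "card {n::int. \<bar>of_int n\<bar> \<le> X \<and> int g dvd n} \<le> card ((\<lambda>k. int g * k) ` ?B)"
    by (rule card_mono[OF _ sub]) simp
  also have "\<dots> \<le> card ?B" by (rule card_image_le) simp
  also have "\<dots> = nat (2 * \<lfloor>X / g\<rfloor> + 1)" by simp
  finally have "real (card {n::int. \<bar>of_int n\<bar> \<le> X \<and> int g dvd n}) \<le> real (nat (2 * \<lfloor>X / g\<rfloor> + 1))"
    by (rule of_nat_mono)
  also have "\<dots> \<le> 2 * (X / g) + 1"
  proof -
    have "0 \<le> \<lfloor>X / g\<rfloor>" using assms by simp
    then show ?thesis by linarith
  qed
  also have "\<dots> \<le> 3 * X / g" using assms by (simp add: field_simps)
  finally show "real (card {n::int. \<bar>of_int n\<bar> \<le> X \<and> int g dvd n}) \<le> 3 * X / g" .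
qed

text \<open>If a pair survives the sieve without being coprime, its gcd g is not 1 and is coprime to
  z!, so g > z. Both entries are then multiples of g, which leaves at most (3 X/g)^2 pairs for each
  g; summing over g > z gives the tail 9 X^2 / z, uniformly in X.\<close>

lemma card_sieved_not_coprime_le:
  fixes z :: nat and X :: real
  assumes "z \<ge> 2" "X \<ge> 0"
  shows "real (card {w \<in> sieved (fact z) - coprime_pairs. \<bar>of_int (fst w)\<bar> \<le> X \<and> \<bar>of_int (snd w)\<bar> \<le> X})
           \<le> 9 * X\<^sup>2 / z"
proof -
  define L where "L = nat \<lfloor>X\<rfloor>"
  define D where "D g = {n::int. \<bar>of_int n\<bar> \<le> X \<and> int g dvd n}" for g
  let ?S = "{w \<in> sieved (fact z) - coprime_pairs. \<bar>of_int (fst w)\<bar> \<le> X \<and> \<bar>of_int (snd w)\<bar> \<le> X}"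
  have LX: "real g \<le> X" if "g \<in> {z<..L}" for g
  proof -
    have "real g \<le> real L" using that by simp
    also have "\<dots> \<le> X" using assms(2) by (simp add: L_def)
    finally show ?thesis .
  qed
  have sub: "?S \<subseteq> (\<Union>g\<in>{z<..L}. D g \<times> D g)"
  proof
    fix w assume w: "w \<in> ?S"
    obtain m n where mn: "w = (m, n)" by fastforce
    define g where "g = nat (gcd m n)"
    have g: "int g = gcd m n" by (simp add: g_def)
    have cop: "coprime (gcd m n) (fact z)" using w by (simp add: mn sieved_def)
    have ncop: "gcd m n \<noteq> 1" using w by (simp add: mn coprime_pairs_def coprime_iff_gcd_eq_1)
    \<comment> \<open>The origin has gcd 0, which is coprime to z! only if z! = 1; this is where z
      >= 2 enters.\<close>
    have nz: "gcd m n \<noteq> 0"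
    proof
      assume "gcd m n = 0"
      then have "is_unit (fact z :: int)" using cop by simp
      then have "(fact z :: int) = 1" by simp
      moreover have "(fact z :: int) \<ge> fact 2" using assms by (intro fact_mono) auto
      ultimately show False by (simp add: fact_2)
    qed
    have "g > z"
    proof (rule ccontr)
      assume "\<not> g > z"
      have "int g > 0" using nz unfolding g by (metis gcd_ge_0_int less_le)
      then have "g dvd fact z" using \<open>\<not> g > z\<close> by (intro dvd_fact) auto
      then have "int g dvd int (fact z)" by (simp only: int_dvd_int_iff)
      then have "gcd m n dvd fact z" using g by (simp add: of_nat_fact)
      with cop have "is_unit (gcd m n)" by (metis coprime_common_divisor dvd_refl)
      then show False using ncop by simp
    qed
    moreover have "g \<le> L"
    proof -
      have "gcd m n \<le> max \<bar>m\<bar> \<bar>n\<bar>"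
      proof (cases "m = 0")
        case True then show ?thesis by simp
      next
        case False
        then have "gcd m n \<le> \<bar>m\<bar>" by (intro zdvd_imp_le) auto
        then show ?thesis by simp
      qed
      moreover have "real_of_int (max \<bar>m\<bar> \<bar>n\<bar>) \<le> X" using w by (simp add: mn max_def)
      ultimately have "real_of_int (gcd m n) \<le> X" by linarith
      then have "gcd m n \<le> \<lfloor>X\<rfloor>" by (simp add: le_floor_iff)
      then show ?thesis by (simp add: g_def L_def)
    qed
    moreover have "w \<in> D g \<times> D g" using w by (simp add: mn D_def g)
    ultimately show "w \<in> (\<Union>g\<in>{z<..L}. D g \<times> D g)" by auto
  qed
  have finD: "finite (D g)" if "g \<in> {z<..L}" for g
    unfolding D_def using that LX[OF that] by (intro card_multiples_le(2)) auto
  have "card ?S \<le> card (\<Union>g\<in>{z<..L}. D g \<times> D g)"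
    using finD by (intro card_mono[OF _ sub]) auto
  also have "\<dots> \<le> (\<Sum>g\<in>{z<..L}. card (D g \<times> D g))" by (rule card_UN_le) simp
  finally have "real (card ?S) \<le> (\<Sum>g\<in>{z<..L}. real (card (D g)) * real (card (D g)))"
    by (simp add: card_cartesian_product flip: of_nat_mult of_nat_sum)
  also have "\<dots> \<le> (\<Sum>g\<in>{z<..L}. (3 * X / g) * (3 * X / g))"
  proof (rule sum_mono)
    fix g assume g: "g \<in> {z<..L}"
    have "real (card (D g)) \<le> 3 * X / g"
      unfolding D_def using g LX[OF g] by (intro card_multiples_le(1)) auto
    then show "real (card (D g)) * real (card (D g)) \<le> (3 * X / g) * (3 * X / g)"
      by (intro mult_mono) auto
  qed
  also have "\<dots> = 9 * X\<^sup>2 * (\<Sum>g\<in>{z<..L}. 1 / (real g)\<^sup>2)"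
    by (simp add: sum_distrib_left power2_eq_square)
  also have "\<dots> \<le> 9 * X\<^sup>2 * (1 / z)"
    using assms by (intro mult_left_mono sum_inverse_squares_tail) auto
  finally show ?thesis by simp
qed

lemma sieved_fact_antimono: "z \<le> z' \<Longrightarrow> sieved (fact z') \<subseteq> sieved (fact z)"
  by (auto simp: sieved_def intro: coprime_imp_coprime dvd_trans[OF _ fact_dvd])

lemma coprime_pairs_subset_sieved: "coprime_pairs \<subseteq> sieved M"
  by (auto simp: sieved_def coprime_pairs_def)

text \<open>The product of 1 - 1/p^2 over all primes p, that is 1/zeta(2).\<close>

definition coprime_density :: real where
  "coprime_density = lim (\<lambda>z. sieve_density (fact z))"

text \<open>Sieving by more primes keeps fewer pairs, so the densities decrease. The comparison is
  made on the counts in the squares [0, N)^2, whose limits they are.\<close>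

lemma sieve_density_tendsto: "(\<lambda>z. sieve_density (fact z)) \<longlonglongrightarrow> coprime_density"
  and coprime_density_nonneg: "coprime_density \<ge> 0"
proof -
  define \<delta> where "\<delta> z = sieve_density (fact z)" for z :: nat
  have "decseq \<delta>"
    unfolding decseq_def
  proof (intro allI impI)
    fix z z' :: nat assume "z \<le> z'"
    have "\<delta> z' * ((1 - 0) * (1 - 0)) \<le> \<delta> z * ((1 - 0) * (1 - 0))" unfolding \<delta>_def
    proof (rule LIMSEQ_le[OF sieved_density sieved_density])
      show "\<exists>N. \<forall>n\<ge>N. real (card (sieved (fact z') \<inter> scaled_box n 0 1 0 1)) / (real n)\<^sup>2
            \<le> real (card (sieved (fact z) \<inter> scaled_box n 0 1 0 1)) / (real n)\<^sup>2"
        using sieved_fact_antimono[OF \<open>z \<le> z'\<close>]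
        by (intro exI[of _ 0] allI impI divide_right_mono of_nat_mono card_mono)
           (auto simp: finite_scaled_box)
    qed (auto simp: fact_gt_zero)
    then show "\<delta> z' \<le> \<delta> z" by simp
  qed
  have \<delta>0: "\<delta> z \<ge> 0" for z by (simp add: \<delta>_def sieve_density_def)
  obtain C where C: "\<delta> \<longlonglongrightarrow> C" using decseq_convergent[OF \<open>decseq \<delta>\<close>, of 0] \<delta>0 by blast
  then have C': "\<delta> \<longlonglongrightarrow> coprime_density"
    unfolding coprime_density_def \<delta>_def by (metis convergentI convergent_LIMSEQ_iff)
  then show "(\<lambda>z. sieve_density (fact z)) \<longlonglongrightarrow> coprime_density" by (simp add: \<delta>_def[abs_def])
  show "coprime_density \<ge> 0" using \<delta>0 by (intro LIMSEQ_le_const[OF C']) auto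
qed

text \<open>A sandwich: the coprime pairs lie in every sieved set, and the excess is at most 9 R^2 /
  z after division by N^2, where the square of half-side N R contains the box. This error is uniform
  in N, so z is fixed first and N goes to infinity afterwards.\<close>

lemma coprime_pairs_density:
  assumes ab: "a1 \<le> b1" "a2 \<le> b2"
  shows "(\<lambda>N. real (card (coprime_pairs \<inter> scaled_box N a1 b1 a2 b2)) / (real N)\<^sup>2)
           \<longlonglongrightarrow> coprime_density * ((b1 - a1) * (b2 - a2))"
proof -
  define C where "C = coprime_density"
  define \<delta> where "\<delta> z = sieve_density (fact z)" for z :: nat
  have C: "\<delta> \<longlonglongrightarrow> C" unfolding C_def \<delta>_def by (rule sieve_density_tendsto)
  define R where "R = \<bar>a1\<bar> + \<bar>b1\<bar> + \<bar>a2\<bar> + \<bar>b2\<bar>"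
  define V where "V = (b1 - a1) * (b2 - a2)"
  let ?f = "\<lambda>N. real (card (coprime_pairs \<inter> scaled_box N a1 b1 a2 b2)) / (real N)\<^sup>2"
  let ?s = "\<lambda>z N. real (card (sieved (fact z) \<inter> scaled_box N a1 b1 a2 b2)) / (real N)\<^sup>2"
  have R0: "R \<ge> 0" by (simp add: R_def)
  have up: "?f N \<le> ?s z N" for N z
    using coprime_pairs_subset_sieved[of "fact z"]
    by (intro divide_right_mono of_nat_mono card_mono) (auto simp: finite_scaled_box)
  have low: "?s z N \<le> ?f N + 9 * R\<^sup>2 / z" if "z \<ge> 2" "N \<ge> 1" for z N :: nat
  proof -
    let ?T = "{w \<in> sieved (fact z) - coprime_pairs. \<bar>of_int (fst w)\<bar> \<le> N * R \<and> \<bar>of_int (snd w)\<bar> \<le> N * R}"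
    have bnd: "\<bar>x\<bar> \<le> N * R" if "N * l \<le> x" "x < N * u" "\<bar>l\<bar> \<le> R" "\<bar>u\<bar> \<le> R" for x l u :: real
    proof -
      have "N * u \<le> N * R" using that by (intro mult_left_mono) auto
      moreover have "N * (- R) \<le> N * l" by (rule mult_left_mono) (use that in auto)
      ultimately show ?thesis using that by simp
    qed
    have box: "scaled_box N a1 b1 a2 b2 \<subseteq> {w. \<bar>of_int (fst w)\<bar> \<le> N * R \<and> \<bar>of_int (snd w)\<bar> \<le> N * R}"
      by (auto simp: scaled_box_def R_def intro!: bnd[unfolded R_def])
    have "{n::int. \<bar>of_int n\<bar> \<le> N * R} \<subseteq> {- \<lfloor>N * R\<rfloor>..\<lfloor>N * R\<rfloor>}"
      by (auto simp: le_floor_iff; linarith)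
    then have "finite {n::int. \<bar>of_int n\<bar> \<le> N * R}" by (rule finite_subset) simp
    then have "finite ({n::int. \<bar>of_int n\<bar> \<le> N * R} \<times> {n::int. \<bar>of_int n\<bar> \<le> N * R})" by simp
    then have finT: "finite ?T" by (rule finite_subset[rotated]) auto
    have "card (sieved (fact z) \<inter> scaled_box N a1 b1 a2 b2) \<le>
        card ((coprime_pairs \<inter> scaled_box N a1 b1 a2 b2) \<union> ?T)"
      using box finT by (intro card_mono) (auto simp: finite_scaled_box)
    also have "\<dots> \<le> card (coprime_pairs \<inter> scaled_box N a1 b1 a2 b2) + card ?T"
      by (rule card_Un_le)
    finally have "real (card (sieved (fact z) \<inter> scaled_box N a1 b1 a2 b2))
       \<le> real (card (coprime_pairs \<inter> scaled_box N a1 b1 a2 b2)) + real (card ?T)"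
      by (simp flip: of_nat_add)
    also have "real (card ?T) \<le> 9 * (N * R)\<^sup>2 / z"
      using that R0 by (intro card_sieved_not_coprime_le) auto
    finally show ?thesis using that by (simp add: field_simps power_mult_distrib)
  qed
  have "?f \<longlonglongrightarrow> C * V"
  proof (rule LIMSEQ_I)
    fix e :: real assume e: "e > 0"
    have l1: "(\<lambda>z. \<delta> z * V) \<longlonglongrightarrow> C * V" by (intro tendsto_intros C)
    have l2: "(\<lambda>z::nat. 9 * R\<^sup>2 / z) \<longlonglongrightarrow> 0" by (rule lim_const_over_n)
    have "\<forall>\<^sub>F z in sequentially. dist (\<delta> z * V) (C * V) < e / 3 \<and> dist (9 * R\<^sup>2 / z) 0 < e / 3 \<and> z \<ge> 2"
      using e by (intro eventually_conj tendstoD[OF l1] tendstoD[OF l2] eventually_ge_at_top) auto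
    then obtain z :: nat where z: "dist (\<delta> z * V) (C * V) < e / 3" "dist (9 * R\<^sup>2 / z) 0 < e / 3" "z \<ge> 2"
      by (auto dest: eventually_happens'[rotated])
    have "?s z \<longlonglongrightarrow> \<delta> z * V" unfolding \<delta>_def V_def
      by (rule sieved_density) (auto simp: ab)
    then have "\<forall>\<^sub>F N in sequentially. dist (?s z N) (\<delta> z * V) < e / 3 \<and> N \<ge> 1"
      using e by (intro eventually_conj tendstoD eventually_ge_at_top) auto
    then obtain N0 where N0: "\<And>N. N \<ge> N0 \<Longrightarrow> dist (?s z N) (\<delta> z * V) < e / 3 \<and> N \<ge> 1"
      by (auto simp: eventually_sequentially)
    show "\<exists>no. \<forall>n\<ge>no. norm (?f n - C * V) < e"
    proof (intro exI allI impI)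
      fix N assume "N \<ge> N0"
      then have "dist (?s z N) (\<delta> z * V) < e / 3" "?s z N \<le> ?f N + 9 * R\<^sup>2 / z"
          using N0 low z(3) by blast+
        then show "norm (?f N - C * V) < e"
          using up[of N z] z unfolding dist_real_def real_norm_def by linarith
      qed
  qed
  then show ?thesis by (simp add: C_def V_def)
qed

section \<open>Equidistribution on boxes, compact sets and open sets\<close>

text \<open>By \<open>horo_mass_unfold\<close> this is the average over alpha of the number of bases
  of the horocycle lattice in S. As an integral over a counting measure it allows infinite sums and
  slices of infinite length. A slice that is not measurable has \<open>emeasure\<close> 0, so the
  upper bounds below need measurability of the covering sets only.\<close>

definition horo_mass :: "nat \<Rightarrow> ((real \<times> real) \<times> real) set \<Rightarrow> ennreal" where
  "horo_mass N S = (\<integral>\<^sup>+ w. ennreal (1 / (real N)\<^sup>2) *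
      emeasure lborel {t. ((of_int (fst w) / N, of_int (snd w) / N), t) \<in> S} \<partial>count_space coprime_pairs)"

lemma sets_slice:
  fixes S :: "('a::euclidean_space \<times> 'b::euclidean_space) set"
  assumes "S \<in> sets borel"
  shows "{t. (y, t) \<in> S} \<in> sets borel"
proof -
  have "Pair y -` S \<inter> space borel \<in> sets borel"
    using assms by (intro measurable_sets[of "Pair y" borel borel] borel_measurable_continuous_onI)
      (auto intro!: continuous_intros)
  then show ?thesis by (simp add: vimage_def)
qed

lemma horo_mass_subadditive:
  assumes "finite I" "S \<subseteq> (\<Union>i\<in>I. T i)" "\<And>i. i \<in> I \<Longrightarrow> T i \<in> sets borel"
  shows "horo_mass N S \<le> (\<Sum>i\<in>I. horo_mass N (T i))"
proof -
  let ?sl = "\<lambda>S w. {t. ((of_int (fst w) / real N, of_int (snd w) / real N), t) \<in> S}"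
  have "horo_mass N S \<le> (\<integral>\<^sup>+ w. (\<Sum>i\<in>I. ennreal (1 / (real N)\<^sup>2) * emeasure lborel (?sl (T i) w)) \<partial>count_space coprime_pairs)"
    unfolding horo_mass_def
  proof (intro nn_integral_mono)
    fix w :: "int \<times> int"
    have m: "?sl (T i) w \<in> sets lborel" if "i \<in> I" for i using assms(3)[OF that] by (simp add: sets_slice)
    have "emeasure lborel (?sl S w) \<le> emeasure lborel (\<Union>i\<in>I. ?sl (T i) w)"
      using assms(1,2) m by (intro emeasure_mono sets.finite_UN) auto
    also have "\<dots> \<le> (\<Sum>i\<in>I. emeasure lborel (?sl (T i) w))"
      using assms(1) m by (intro emeasure_subadditive_finite) auto
    finally show "ennreal (1 / (real N)\<^sup>2) * emeasure lborel (?sl S w) \<le>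
         (\<Sum>i\<in>I. ennreal (1 / (real N)\<^sup>2) * emeasure lborel (?sl (T i) w))"
      by (simp add: sum_distrib_left[symmetric] mult_left_mono)
  qed
  also have "\<dots> = (\<Sum>i\<in>I. horo_mass N (T i))"
    unfolding horo_mass_def by (rule nn_integral_sum) simp
  finally show ?thesis .
qed

lemma horo_mass_Un_le:
  assumes "S \<subseteq> T \<union> T'" "T \<in> sets borel" "T' \<in> sets borel"
  shows "horo_mass N S \<le> horo_mass N T + horo_mass N T'"
proof -
  have "horo_mass N S \<le> (\<Sum>b\<in>{True, False}. horo_mass N (if b then T else T'))"
    by (rule horo_mass_subadditive) (use assms in auto)
  then show ?thesis by simp
qed

text \<open>Half-open in every direction, so that the grid cubes below partition space and the slice
  over a point (c, d)/N is either the full interval or empty.\<close>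

definition half_open_box :: "real \<Rightarrow> real \<Rightarrow> real \<Rightarrow> real \<Rightarrow> real \<Rightarrow> real \<Rightarrow> ((real \<times> real) \<times> real) set" where
  "half_open_box a1 b1 a2 b2 s u = ({a1..<b1} \<times> {a2..<b2}) \<times> {s..<u}"

lemma half_open_box_borel [measurable]: "half_open_box a1 b1 a2 b2 s u \<in> sets borel"
  unfolding half_open_box_def by (intro borel_Times) auto

lemma emeasure_lborel_Times:
  fixes A :: "'a::euclidean_space set" and B :: "'b::euclidean_space set"
  assumes "A \<in> sets borel" "B \<in> sets borel"
  shows "emeasure lborel (A \<times> B) = emeasure lborel A * emeasure lborel B"
  unfolding lborel_prod[symmetric] using assms by (intro lborel.emeasure_pair_measure_Times) auto

lemma emeasure_half_open_box:
  assumes "a1 \<le> b1" "a2 \<le> b2" "s \<le> u"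
  shows "emeasure lborel (half_open_box a1 b1 a2 b2 s u) = ennreal ((b1 - a1) * (b2 - a2) * (u - s))"
  unfolding half_open_box_def using assms
  by (simp add: emeasure_lborel_Times borel_Times ennreal_mult)

lemma horo_mass_half_open_box:
  assumes "s \<le> u" "N \<ge> 1"
  shows "horo_mass N (half_open_box a1 b1 a2 b2 s u) =
    ennreal (real (card (coprime_pairs \<inter> scaled_box N a1 b1 a2 b2)) / (real N)\<^sup>2 * (u - s))"
proof -
  let ?J = "coprime_pairs \<inter> scaled_box N a1 b1 a2 b2"
  let ?sl = "\<lambda>w. {t. ((of_int (fst w) / real N, of_int (snd w) / real N), t) \<in> half_open_box a1 b1 a2 b2 s u}"
  have sl: "?sl w = (if w \<in> scaled_box N a1 b1 a2 b2 then {s..<u} else {})" for w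
    using assms(2) by (cases w) (auto simp: half_open_box_def scaled_box_def field_simps)
  have "horo_mass N (half_open_box a1 b1 a2 b2 s u)
      = (\<Sum>w\<in>?J. ennreal (1 / (real N)\<^sup>2) * emeasure lborel (?sl w))"
    unfolding horo_mass_def
    by (rule nn_integral_count_space') (auto simp: finite_scaled_box sl)
  also have "\<dots> = (\<Sum>w\<in>?J. ennreal (1 / (real N)\<^sup>2 * (u - s)))"
    using assms(1) by (intro sum.cong) (auto simp: sl simp flip: ennreal_mult)
  also have "\<dots> = ennreal (real (card ?J) * (1 / (real N)\<^sup>2 * (u - s)))"
    using assms(1) by (subst sum_ennreal) auto
  finally show ?thesis by simp
qed

lemma half_open_box_density:
  assumes "a1 \<le> b1" "a2 \<le> b2"
  shows "(\<lambda>N. real (card (coprime_pairs \<inter> scaled_box N a1 b1 a2 b2)) / (real N)\<^sup>2 * (u - s))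
    \<longlonglongrightarrow> coprime_density * ((b1 - a1) * (b2 - a2) * (u - s))"
  using tendsto_mult_right[OF coprime_pairs_density[OF assms], of "u - s"] by (simp add: mult.assoc)

text \<open>Outer regularity gives an open U around K of barely larger volume. The grid cubes of
  side 1/n that meet K are finitely many, and for 3/n below the distance \<open>\<delta>\<close>
  they stay inside U. So their total volume is at most that of U, and the mass of each one converges
  to the density times its volume.\<close>

lemma horo_mass_compact_le:
  assumes "compact K" "e > 0"
  shows "\<forall>\<^sub>F N in sequentially. horo_mass N K \<le> ennreal (coprime_density * measure lborel K + e)"
proof -
  let ?C = coprime_density
  have C0: "?C \<ge> 0" by (rule coprime_density_nonneg)
  \<comment> \<open>The 1 in the denominator covers a density of 0, whose positivity is proved only
    later; the 2 leaves the strict slack needed for an eventual inequality.\<close>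
  define e' where "e' = e / (2 * (?C + 1))"
  have e': "e' > 0" "?C * e' < e"
  proof -
    show "e' > 0" using assms C0 by (simp add: e'_def)
    have "?C * e' = e * (?C / (2 * (?C + 1)))" by (simp add: e'_def)
    also have "\<dots> < e * 1" using assms C0 by (intro mult_strict_left_mono) (auto simp: field_simps)
    finally show "?C * e' < e" by simp
  qed
  have Kb: "K \<in> sets borel" using assms(1) by (simp add: borel_compact)
  have Kfin: "emeasure lborel K < \<infinity>"
    by (rule emeasure_bounded_finite[OF compact_imp_bounded[OF assms(1)]])
  obtain U where U: "open U" "K \<subseteq> U" "emeasure lborel (U - K) < ennreal e'"
    using outer_regular_lborel[OF Kb e'(1)] by metis
  have Ub: "U \<in> sets borel" using U by simp
  have UK: "emeasure lborel U \<le> ennreal (measure lborel K + e')"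
  proof -
    have "emeasure lborel U \<le> emeasure lborel (K \<union> (U - K))"
      using U Kb Ub by (intro emeasure_mono) auto
    also have "\<dots> \<le> emeasure lborel K + emeasure lborel (U - K)"
      using Kb Ub by (intro emeasure_subadditive) auto
    also have "\<dots> \<le> ennreal (measure lborel K) + ennreal e'"
      using U(3) Kfin by (intro add_mono) (auto simp: emeasure_eq_ennreal_measure less_top)
    finally show ?thesis using e' by (simp add: ennreal_plus)
  qed
  obtain \<delta> where \<delta>: "\<delta> > 0" "(\<Union>x\<in>K. ball x \<delta>) \<subseteq> U"
    using compact_subset_open_imp_ball_epsilon_subset[OF assms(1) U(1,2)] by metis
  obtain n :: nat where n: "3 / \<delta> < real n" using reals_Archimedean2 by blast
  then have n0: "real n > 0" using \<delta> by (meson divide_pos_pos less_trans zero_less_numeral)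
  have n3: "3 / real n < \<delta>" using n n0 \<delta> by (simp add: field_simps)
  define \<phi> where "\<phi> p = (\<lfloor>n * fst (fst p)\<rfloor>, \<lfloor>n * snd (fst p)\<rfloor>, \<lfloor>n * snd p\<rfloor>)" for p :: "(real \<times> real) \<times> real"
  define cube where "cube i = (case i of (i, j, l) \<Rightarrow>
     half_open_box (of_int i / n) ((of_int i + 1) / n) (of_int j / n) ((of_int j + 1) / n) (of_int l / n) ((of_int l + 1) / n))" for i
  have cube_iff: "p \<in> cube i \<longleftrightarrow> \<phi> p = i" for p i
    using n0 by (cases i; cases p) (auto simp: cube_def \<phi>_def half_open_box_def field_simps floor_eq_iff)
  define I where "I = \<phi> ` K"
  have finI: "finite I"
  proof -
    obtain R where R: "\<And>p. p \<in> K \<Longrightarrow> norm p \<le> R"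
      using compact_imp_bounded[OF assms(1)] by (auto simp: bounded_iff)
    let ?J = "{\<lfloor>n * (-R)\<rfloor>..\<lfloor>n * R\<rfloor>}"
    have fl: "\<lfloor>n * x\<rfloor> \<in> ?J" if "\<bar>x\<bar> \<le> R" for x :: real
    proof -
      have "n * x \<le> n * R" using that by (intro mult_left_mono) auto
      moreover have "n * (- R) \<le> n * x" by (rule mult_left_mono) (use that in auto)
      ultimately show ?thesis by (auto intro: floor_mono)
    qed
    have "\<phi> p \<in> ?J \<times> ?J \<times> ?J" if "p \<in> K" for p
    proof -
      have "norm (fst (fst p)) \<le> R" "norm (snd (fst p)) \<le> R" "norm (snd p) \<le> R"
        using R[OF that] norm_fst_le[of "fst p" "snd p"] norm_snd_le[of "snd p" "fst p"]
          norm_fst_le[of "fst (fst p)" "snd (fst p)"] norm_snd_le[of "snd (fst p)" "fst (fst p)"] by auto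
      then show ?thesis unfolding \<phi>_def using fl by (auto simp del: atLeastAtMost_iff)
    qed
    then have "I \<subseteq> ?J \<times> ?J \<times> ?J" unfolding I_def by (rule image_subsetI)
    then show ?thesis by (rule finite_subset) simp
  qed
  have cubeb: "cube i \<in> sets borel" for i by (cases i) (simp add: cube_def)
  have cubeU: "cube i \<subseteq> U" if i: "i \<in> I" for i
  proof
    fix q assume q: "q \<in> cube i"
    obtain p where p: "p \<in> K" "\<phi> p = i" using i by (auto simp: I_def)
    have eq: "\<phi> p = \<phi> q" using p q by (simp add: cube_iff)
    have cl: "\<bar>x - y\<bar> < 1 / n" if "\<lfloor>n * x\<rfloor> = \<lfloor>n * y\<rfloor>" for x y :: real
    proof -
      have "\<bar>n * x - n * y\<bar> < 1" using that by linarith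
      then have "n * \<bar>x - y\<bar> < 1" using n0 by (simp add: abs_mult flip: right_diff_distrib)
      then show ?thesis using n0 by (simp add: field_simps)
    qed
    obtain p1 p2 p3 where pp: "p = ((p1, p2), p3)" by (metis prod.exhaust)
    obtain q1 q2 q3 where qq: "q = ((q1, q2), q3)" by (metis prod.exhaust)
    have "dist p q \<le> \<bar>dist (p1, p2) (q1, q2)\<bar> + \<bar>dist p3 q3\<bar>"
      unfolding pp qq dist_Pair_Pair[of _ p3] by (rule sqrt_sum_squares_le_sum_abs)
    moreover have "dist (p1, p2) (q1, q2) \<le> \<bar>dist p1 q1\<bar> + \<bar>dist p2 q2\<bar>"
      unfolding dist_Pair_Pair by (rule sqrt_sum_squares_le_sum_abs)
    ultimately have "dist p q \<le> \<bar>p1 - q1\<bar> + \<bar>p2 - q2\<bar> + \<bar>p3 - q3\<bar>" by (simp add: dist_real_def)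
    also have "\<dots> < 1 / n + 1 / n + 1 / n"
      using eq by (intro add_strict_mono cl) (auto simp: pp qq \<phi>_def)
    also have "\<dots> < \<delta>" using n3 by simp
    finally have "q \<in> ball p \<delta>" by simp
    then show "q \<in> U" using \<delta>(2) p(1) by blast
  qed
  have cubem: "emeasure lborel (cube i) = ennreal (1 / real n ^ 3)" for i
    using n0 by (cases i) (simp add: cube_def emeasure_half_open_box field_simps power3_eq_cube flip: diff_divide_distrib)
  have vol: "real (card I) / real n ^ 3 \<le> measure lborel K + e'"
  proof -
    have "ennreal (real (card I) / real n ^ 3) = (\<Sum>i\<in>I. emeasure lborel (cube i))"
      by (simp add: cubem ennreal_of_nat_eq_real_of_nat flip: ennreal_mult)
    also have "\<dots> = emeasure lborel (\<Union>i\<in>I. cube i)"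
      using cubeb by (intro sum_emeasure finI) (auto simp: disjoint_family_on_def cube_iff)
    also have "\<dots> \<le> emeasure lborel U" using cubeU Ub by (intro emeasure_mono) auto
    also note UK
    finally show ?thesis using e' by (subst (asm) ennreal_le_iff) auto
  qed
  define h where "h N i = (case i of (i, j, l) \<Rightarrow> real (card (coprime_pairs \<inter>
     scaled_box N (of_int i / n) ((of_int i + 1) / n) (of_int j / n) ((of_int j + 1) / n))) / (real N)\<^sup>2 * ((of_int l + 1) / n - of_int l / n))" for N i
  have hlim: "(\<lambda>N. h N i) \<longlonglongrightarrow> ?C * (1 / real n ^ 3)" for i
  proof -
    obtain a b c where i: "i = (a, b, c)" by (metis prod.exhaust)
    have "(\<lambda>N. h N i) \<longlonglongrightarrow> ?C * (((of_int a + 1) / n - of_int a / n) * ((of_int b + 1) / n - of_int b / n) * ((of_int c + 1) / n - of_int c / n))"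
      unfolding h_def i prod.case using n0 by (intro half_open_box_density) (auto simp: field_simps)
    also have "((of_int a + 1) / n - of_int a / n) * ((of_int b + 1) / n - of_int b / n) * ((of_int c + 1) / n - of_int c / n) = 1 / real n ^ 3"
      by (simp add: power3_eq_cube flip: diff_divide_distrib)
    finally show ?thesis .
  qed
  have hnn: "h N i \<ge> 0" for N i
    using n0 by (cases i) (auto simp: h_def field_simps simp flip: diff_divide_distrib)
  have hm: "horo_mass N (cube i) = ennreal (h N i)" if "N \<ge> 1" for N i
    using that n0 unfolding h_def cube_def
    by (cases i) (simp add: horo_mass_half_open_box divide_right_mono)
  have "(\<lambda>N. \<Sum>i\<in>I. h N i) \<longlonglongrightarrow> (\<Sum>i\<in>I. ?C * (1 / real n ^ 3))" by (intro tendsto_sum hlim)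
  moreover have "(\<Sum>i\<in>I. ?C * (1 / real n ^ 3)) < ?C * measure lborel K + e"
  proof -
    have "(\<Sum>i\<in>I. ?C * (1 / real n ^ 3)) = ?C * (real (card I) / real n ^ 3)" by simp
    also have "\<dots> \<le> ?C * (measure lborel K + e')" using vol C0 by (intro mult_left_mono) auto
    also have "\<dots> < ?C * measure lborel K + e" using e' by (simp add: algebra_simps)
    finally show ?thesis .
  qed
  ultimately have "\<forall>\<^sub>F N in sequentially. (\<Sum>i\<in>I. h N i) < ?C * measure lborel K + e"
    by (rule order_tendstoD)
  with eventually_ge_at_top[of 1] show ?thesis
  proof eventually_elim
    case (elim N)
    have "horo_mass N K \<le> (\<Sum>i\<in>I. horo_mass N (cube i))"
      using cubeb by (intro horo_mass_subadditive finI) (auto simp: I_def cube_iff)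
    also have "\<dots> = ennreal (\<Sum>i\<in>I. h N i)" using elim(1) hnn by (simp add: hm sum_ennreal)
    also have "\<dots> \<le> ennreal (?C * measure lborel K + e)" using elim(2) by (intro ennreal_leI) auto
    finally show ?case .
  qed
qed

text \<open>Complementation inside a large box: the mass of the box has a known limit, and what is
  left outside U is compact, so its mass is bounded above. The box is half-open for the count and
  closed (\<open>B'\<close>) for the compactness.\<close>

lemma horo_mass_open_ge:
  assumes "open U" "bounded U" "e > 0"
  shows "\<forall>\<^sub>F N in sequentially. ennreal (coprime_density * measure lborel U - e) \<le> horo_mass N U"
proof -
  let ?C = coprime_density
  obtain R0 where R0: "\<And>p. p \<in> U \<Longrightarrow> norm p \<le> R0" using assms(2) by (auto simp: bounded_iff)
  define R where "R = \<bar>R0\<bar> + 1"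
  have R: "R > 0" by (simp add: R_def)
  let ?B = "half_open_box (-R) R (-R) R (-R) R"
  define B' where "B' = ({-R..R} \<times> {-R..R}) \<times> {-R..R}"
  have B'b: "B' \<in> sets borel" unfolding B'_def by (intro borel_Times) auto
  have Ub: "U \<in> sets borel" using assms by simp
  have UB: "U \<subseteq> ?B"
  proof
    fix p assume p: "p \<in> U"
    have "norm (fst (fst p)) \<le> R0" "norm (snd (fst p)) \<le> R0" "norm (snd p) \<le> R0"
      using R0[OF p] norm_fst_le[of "fst p" "snd p"] norm_snd_le[of "snd p" "fst p"]
        norm_fst_le[of "fst (fst p)" "snd (fst p)"] norm_snd_le[of "snd (fst p)" "fst (fst p)"] by auto
    then show "p \<in> ?B" by (cases p) (auto simp: half_open_box_def R_def)
  qed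
  have BB: "?B \<subseteq> B'" by (auto simp: half_open_box_def B'_def)
  define K where "K = B' - U"
  have K: "compact K" unfolding K_def B'_def using assms(1)
    by (intro compact_diff compact_Times compact_Icc)
  have mB': "emeasure lborel B' = ennreal ((2 * R) ^ 3)" unfolding B'_def using R
    by (simp add: emeasure_lborel_Times borel_Times ennreal_mult[symmetric] power3_eq_cube)
  have mK: "measure lborel K = (2 * R) ^ 3 - measure lborel U"
  proof -
    have "measure lborel (B' - U) = measure lborel B' - measure lborel U"
      using UB BB B'b Ub by (intro measure_Diff) (auto simp: mB')
    then show ?thesis using R by (simp add: K_def measure_def mB')
  qed
  have "(\<lambda>N. real (card (coprime_pairs \<inter> scaled_box N (-R) R (-R) R)) / (real N)\<^sup>2 * (R - (-R)))
    \<longlonglongrightarrow> ?C * ((R - (-R)) * (R - (-R)) * (R - (-R)))" using R by (intro half_open_box_density) auto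
  then have "\<forall>\<^sub>F N in sequentially. ?C * ((R - (-R)) * (R - (-R)) * (R - (-R))) - e / 2 <
     real (card (coprime_pairs \<inter> scaled_box N (-R) R (-R) R)) / (real N)\<^sup>2 * (R - (-R))"
    using assms(3) by (intro order_tendstoD) auto
  moreover have "\<forall>\<^sub>F N in sequentially. horo_mass N K \<le> ennreal (?C * measure lborel K + e / 2)"
    using assms(3) by (intro horo_mass_compact_le K) auto
  ultimately show ?thesis using eventually_ge_at_top[of 1]
  proof eventually_elim
    case (elim N)
    have nn: "?C * measure lborel K + e / 2 \<ge> 0" using coprime_density_nonneg assms(3) by simp
    have "ennreal (?C * (2 * R) ^ 3 - e / 2) \<le> horo_mass N ?B"
      using elim(1,3) R by (subst horo_mass_half_open_box) (auto intro!: ennreal_leI simp: power3_eq_cube)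
    also have "\<dots> \<le> horo_mass N U + horo_mass N K"
      using UB BB Ub K by (intro horo_mass_Un_le) (auto simp: K_def borel_compact)
    also have "\<dots> \<le> horo_mass N U + ennreal (?C * measure lborel K + e / 2)"
      using elim(2) by (rule add_left_mono)
    finally have *: "ennreal (?C * (2 * R) ^ 3 - e / 2) \<le> horo_mass N U + ennreal (?C * measure lborel K + e / 2)" .
    show ?case
    proof (cases "horo_mass N U")
      case (real x)
      then have "ennreal (?C * (2 * R) ^ 3 - e / 2) \<le> ennreal (x + (?C * measure lborel K + e / 2))"
        using * nn by (simp add: ennreal_plus)
      then have "?C * (2 * R) ^ 3 - e / 2 \<le> x + (?C * measure lborel K + e / 2)"
        using real nn by (subst (asm) ennreal_le_iff) auto
      then show ?thesis using real mK by (simp add: algebra_simps ennreal_leI)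
    qed simp
  qed
qed

section \<open>Reduced bases\<close>

text \<open>A point ((y1, y2), t) stands for the matrix with bottom row (y1, y2) and top row
  (top1, top2). The determinant is 1 except at the junk point y = 0, where both rows vanish.\<close>

definition top1 :: "(real \<times> real) \<times> real \<Rightarrow> real" where
  "top1 p = snd (fst p) / ((fst (fst p))\<^sup>2 + (snd (fst p))\<^sup>2) + snd p * fst (fst p)"

definition top2 :: "(real \<times> real) \<times> real \<Rightarrow> real" where
  "top2 p = snd p * snd (fst p) - fst (fst p) / ((fst (fst p))\<^sup>2 + (snd (fst p))\<^sup>2)"

text \<open>The Gram form of the columns (x1, y1) and (x2, y2): the squared length of the lattice
  vector with coefficients u, v. The next definition is its polar form, the inner product of two
  lattice vectors.\<close>

definition qform :: "real \<Rightarrow> real \<Rightarrow> real \<Rightarrow> real \<Rightarrow> int \<Rightarrow> int \<Rightarrow> real" where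
  "qform x1 x2 y1 y2 u v = (x1 * u + x2 * v)\<^sup>2 + (y1 * u + y2 * v)\<^sup>2"

definition bform :: "real \<Rightarrow> real \<Rightarrow> real \<Rightarrow> real \<Rightarrow> int \<Rightarrow> int \<Rightarrow> int \<Rightarrow> int \<Rightarrow> real" where
  "bform x1 x2 y1 y2 u v u' v' =
     (x1 * u + x2 * v) * (x1 * u' + x2 * v') + (y1 * u + y2 * v) * (y1 * u' + y2 * v')"

text \<open>Coefficient pairs are counted instead of vectors, so that a change of basis is a
  bijection of index sets. For determinant 1 both counts agree, see
  \<open>card_prim_of\<close>.\<close>

definition prim_count :: "(real \<times> real) set \<Rightarrow> real \<Rightarrow> real \<Rightarrow> real \<Rightarrow> real \<Rightarrow> nat" where
  "prim_count H x1 x2 y1 y2 =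
     card {w \<in> coprime_pairs. (x1 * of_int (fst w) + x2 * of_int (snd w), y1 * of_int (fst w) + y2 * of_int (snd w)) \<in> H}"

section \<open>Change of basis by SL(2,Z)\<close>

lemma coprime_int_linear:
  fixes a b c d u v :: int
  assumes "a * d - b * c = 1" "coprime u v"
  shows "coprime (a * u + b * v) (c * u + d * v)"
proof (rule coprimeI)
  fix g assume g: "g dvd a * u + b * v" "g dvd c * u + d * v"
  have "d * (a * u + b * v) - b * (c * u + d * v) = (a * d - b * c) * u" by (simp add: algebra_simps)
  then have "g dvd u" using g assms by (metis dvd_diff dvd_mult mult_1)
  moreover have "a * (c * u + d * v) - c * (a * u + b * v) = (a * d - b * c) * v" by (simp add: algebra_simps)
  then have "g dvd v" using g assms by (metis dvd_diff dvd_mult mult_1)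
  ultimately show "is_unit g" using assms(2) coprime_common_divisor by blast
qed

text \<open>The integer matrix \<open>f\<close> permutes the coprime coefficient pairs; its inverse
  \<open>f'\<close> is the adjugate. Hence the count depends on the lattice and not on the
  basis.\<close>

lemma prim_count_SL2Z:
  fixes a b c d :: int and x1 x2 y1 y2 :: real
  assumes det: "a * d - b * c = 1"
  shows "prim_count H (x1 * a + x2 * c) (x1 * b + x2 * d) (y1 * a + y2 * c) (y1 * b + y2 * d)
       = prim_count H x1 x2 y1 y2"
proof -
  define f where "f = (\<lambda>(u, v). (a * u + b * v, c * u + d * v))"
  define f' where "f' = (\<lambda>(u, v). (d * u - b * v, a * v - c * u))"
  have inv: "d * (a * u + b * v) - b * (c * u + d * v) = u" "a * (c * u + d * v) - c * (a * u + b * v) = v"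
            "a * (d * u - b * v) + b * (a * v - c * u) = u" "c * (d * u - b * v) + d * (a * v - c * u) = v" for u v
  proof -
    have "d * (a * u + b * v) - b * (c * u + d * v) = (a * d - b * c) * u"
      "a * (c * u + d * v) - c * (a * u + b * v) = (a * d - b * c) * v"
      "a * (d * u - b * v) + b * (a * v - c * u) = (a * d - b * c) * u"
      "c * (d * u - b * v) + d * (a * v - c * u) = (a * d - b * c) * v" by (simp_all add: algebra_simps)
    then show "d * (a * u + b * v) - b * (c * u + d * v) = u" "a * (c * u + d * v) - c * (a * u + b * v) = v"
            "a * (d * u - b * v) + b * (a * v - c * u) = u" "c * (d * u - b * v) + d * (a * v - c * u) = v"
      using det by simp_all
  qed
  let ?A = "{w \<in> coprime_pairs. ((x1 * a + x2 * c) * of_int (fst w) + (x1 * b + x2 * d) * of_int (snd w),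
      (y1 * a + y2 * c) * of_int (fst w) + (y1 * b + y2 * d) * of_int (snd w)) \<in> H}"
  let ?B = "{w \<in> coprime_pairs. (x1 * of_int (fst w) + x2 * of_int (snd w), y1 * of_int (fst w) + y2 * of_int (snd w)) \<in> H}"
  have "\<forall>w\<in>?A. f' (f w) = w" by (auto simp: inv f_def f'_def)
  moreover have "\<forall>w\<in>?B. f (f' w) = w" by (auto simp: inv f_def f'_def)
  moreover have "f ` ?A \<subseteq> ?B"
    using coprime_int_linear[OF det] by (auto simp: f_def coprime_pairs_def algebra_simps)
  moreover have "f' ` ?B \<subseteq> ?A"
    unfolding f'_def
  proof (clarify)
    fix u v assume w: "(u, v) \<in> coprime_pairs" "(x1 * of_int (fst (u, v)) + x2 * of_int (snd (u, v)), y1 * of_int (fst (u, v)) + y2 * of_int (snd (u, v))) \<in> H"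
    have 1: "coprime (d * u - b * v) (a * v - c * u)"
      using coprime_int_linear[of d a "-b" "-c" u v] w(1) det by (simp add: coprime_pairs_def algebra_simps)
    have lin: "(z1 * a + z2 * c) * of_int (d * u - b * v) + (z1 * b + z2 * d) * of_int (a * v - c * u) = z1 * u + z2 * v" for z1 z2 :: real
    proof -
      have "(z1 * a + z2 * c) * of_int (d * u - b * v) + (z1 * b + z2 * d) * of_int (a * v - c * u)
         = z1 * of_int (a * (d * u - b * v) + b * (a * v - c * u)) + z2 * of_int (c * (d * u - b * v) + d * (a * v - c * u))"
        by (simp add: algebra_simps)
      then show ?thesis by (simp only: inv)
    qed
    show "(d * u - b * v, a * v - c * u) \<in> coprime_pairs \<and> ((x1 * a + x2 * c) * of_int (fst (d * u - b * v, a * v - c * u)) + (x1 * b + x2 * d) * of_int (snd (d * u - b * v, a * v - c * u)),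
       (y1 * a + y2 * c) * of_int (fst (d * u - b * v, a * v - c * u)) + (y1 * b + y2 * d) * of_int (snd (d * u - b * v, a * v - c * u))) \<in> H"
      using 1 w(2) unfolding fst_conv snd_conv lin by (simp add: coprime_pairs_def)
  qed
  ultimately have "bij_betw f ?A ?B" by (rule bij_betw_byWitness)
  then show ?thesis unfolding prim_count_def by (rule bij_betw_same_card)
qed

text \<open>The Lagrange-Gauss inequalities in two versions. The strict ones define an open set and
  give uniqueness up to sign; the weak ones hold for some basis of every lattice and define a
  compact set once short first columns are excluded.\<close>

definition strictly_reduced :: "((real \<times> real) \<times> real) set" where
  "strictly_reduced = {p. fst p \<noteq> 0 \<and>
     (top1 p)\<^sup>2 + (fst (fst p))\<^sup>2 < (top2 p)\<^sup>2 + (snd (fst p))\<^sup>2 \<and>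
     2 * \<bar>top1 p * top2 p + fst (fst p) * snd (fst p)\<bar> < (top1 p)\<^sup>2 + (fst (fst p))\<^sup>2}"

definition weakly_reduced :: "((real \<times> real) \<times> real) set" where
  "weakly_reduced = {p. fst p \<noteq> 0 \<and>
     (top1 p)\<^sup>2 + (fst (fst p))\<^sup>2 \<le> (top2 p)\<^sup>2 + (snd (fst p))\<^sup>2 \<and>
     2 * \<bar>top1 p * top2 p + fst (fst p) * snd (fst p)\<bar> \<le> (top1 p)\<^sup>2 + (fst (fst p))\<^sup>2}"

lemma qform_linear:
  "qform x1 x2 y1 y2 (m * a + n * b) (m * c + n * d) =
   (of_int m)\<^sup>2 * qform x1 x2 y1 y2 a c + 2 * of_int m * of_int n * bform x1 x2 y1 y2 a c b d
     + (of_int n)\<^sup>2 * qform x1 x2 y1 y2 b d"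
  by (simp add: qform_def bform_def power2_eq_square algebra_simps)

text \<open>The form A m^2 + 2 E m n + B n^2 takes its least nonzero value only at plus or minus the
  first basis vector. If n is not 0, its value exceeds A (m^2 - |m n| + n^2), and the bracket is a
  positive integer; if n = 0, then m^2 <= 1.\<close>

lemma strictly_reduced_min:
  fixes A B E :: real and m n :: int
  assumes "A < B" "2 * \<bar>E\<bar> < A" and nz: "m \<noteq> 0 \<or> n \<noteq> 0"
    and le: "(of_int m)\<^sup>2 * A + 2 * of_int m * of_int n * E + (of_int n)\<^sup>2 * B \<le> A"
  shows "n = 0 \<and> (m = 1 \<or> m = -1)"
proof -
  have A: "A > 0" using assms(2) by linarith
  have "n = 0"
  proof (rule ccontr)
    assume n: "n \<noteq> 0"
    have "\<bar>2 * of_int m * of_int n * E\<bar> = \<bar>of_int (m * n)\<bar> * (2 * \<bar>E\<bar>)" by (simp add: abs_mult)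
    also have "\<dots> \<le> \<bar>of_int (m * n)\<bar> * A" using assms(2) by (intro mult_left_mono) auto
    finally have 1: "2 * of_int m * of_int n * E \<ge> - (\<bar>of_int (m * n)\<bar> * A)" by linarith
    have 2: "(of_int n)\<^sup>2 * B > (of_int n)\<^sup>2 * A" using n assms(1) by simp
    have "m\<^sup>2 - \<bar>m * n\<bar> + n\<^sup>2 \<ge> 1"
    proof -
      have "2 * \<bar>m * n\<bar> \<le> m\<^sup>2 + n\<^sup>2"
        using zero_le_power2[of "\<bar>m\<bar> - \<bar>n\<bar>"] unfolding power2_diff by (simp add: abs_mult)
      moreover have "m\<^sup>2 \<ge> 0" "n\<^sup>2 > 0" using n by auto
      ultimately show ?thesis by linarith
    qed
    then have "real_of_int (m\<^sup>2 - \<bar>m * n\<bar> + n\<^sup>2) \<ge> 1" by linarith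
    then have "(real_of_int (m\<^sup>2 - \<bar>m * n\<bar> + n\<^sup>2)) * A \<ge> 1 * A" using A by (intro mult_right_mono) auto
    then have "A \<le> (of_int m)\<^sup>2 * A - \<bar>of_int (m * n)\<bar> * A + (of_int n)\<^sup>2 * A"
      by (simp add: algebra_simps)
    with 1 2 le show False by linarith
  qed
  moreover from this le A have "(real_of_int m)\<^sup>2 \<le> 1" by simp
  then have "\<bar>m\<bar> \<le> 1" by (simp add: abs_square_le_1 flip: of_int_abs)
  ultimately show ?thesis using nz by auto
qed

text \<open>Both first columns realise the minimum of the form, so they agree up to a sign m. The
  determinant then forces the second column to be m times the old one plus k times the first, and
  the two bounds on the inner product leave |k| < 1.\<close>

lemma strictly_reduced_unique:
  fixes a b c d a' b' c' d' :: int and x1 x2 y1 y2 :: real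
  defines "q \<equiv> qform x1 x2 y1 y2" and "\<beta> \<equiv> bform x1 x2 y1 y2"
  assumes det: "a * d - b * c = 1" "a' * d' - b' * c' = 1"
    and red: "q a c < q b d" "2 * \<bar>\<beta> a c b d\<bar> < q a c"
    and red': "q a' c' < q b' d'" "2 * \<bar>\<beta> a' c' b' d'\<bar> < q a' c'"
  shows "(a', b', c', d') = (a, b, c, d) \<or> (a', b', c', d') = (-a, -b, -c, -d)"
proof -
  have repr: "\<exists>m n. u = m * a + n * b \<and> v = m * c + n * d" if "a * d - b * c = 1" for u v a b c d :: int
  proof (intro exI conjI)
    have "(d * u - b * v) * a + (a * v - c * u) * b = (a * d - b * c) * u" by (simp add: algebra_simps)
    then show "u = (d * u - b * v) * a + (a * v - c * u) * b" using that by simp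
    have "(d * u - b * v) * c + (a * v - c * u) * d = (a * d - b * c) * v" by (simp add: algebra_simps)
    then show "v = (d * u - b * v) * c + (a * v - c * u) * d" using that by simp
  qed
  have min: "q a c \<le> q u v" if uv: "u \<noteq> 0 \<or> v \<noteq> 0" and det: "a * d - b * c = 1"
    and red: "q a c < q b d" "2 * \<bar>\<beta> a c b d\<bar> < q a c"
    for u v a b c d
  proof (rule ccontr)
    assume less: "\<not> q a c \<le> q u v"
    obtain m n where mn: "u = m * a + n * b" "v = m * c + n * d" using repr[OF det] by blast
    have "n = 0 \<and> (m = 1 \<or> m = -1)"
      by (rule strictly_reduced_min[OF red])
         (use less uv in \<open>auto simp: mn q_def \<beta>_def qform_linear\<close>)
    then have "q u v = q a c" by (auto simp: mn q_def qform_def power2_eq_square algebra_simps)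
    then show False using less by simp
  qed
  have nz: "a \<noteq> 0 \<or> c \<noteq> 0" "a' \<noteq> 0 \<or> c' \<noteq> 0" using det by auto
  have eq: "q a' c' = q a c"
    using min[OF nz(1) det(2) red'] min[OF nz(2) det(1) red] by simp
  obtain m n where mn: "a' = m * a + n * b" "c' = m * c + n * d" using repr[OF det(1)] by blast
  have 1: "n = 0 \<and> (m = 1 \<or> m = -1)"
    by (rule strictly_reduced_min[OF red])
       (use eq nz in \<open>auto simp: mn q_def \<beta>_def qform_linear\<close>)
  then have ac: "a' = m * a" "c' = m * c" by (auto simp: mn)
  obtain k l where kl: "b' = k * a + l * b" "d' = k * c + l * d" using repr[OF det(1)] by blast
  have "a' * d' - b' * c' = m * l * (a * d - b * c)" by (simp add: ac kl algebra_simps)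
  then have ml: "m * l = 1" using det by simp
  then have lm: "l = m" using 1 by auto
  have be: "\<beta> a' c' b' d' = of_int (m * k) * q a c + of_int (m * l) * \<beta> a c b d"
    by (simp add: ac kl q_def \<beta>_def qform_def bform_def power2_eq_square algebra_simps)
  have A: "q a c > 0" using red(2) by linarith
  have "\<bar>of_int (m * k)\<bar> * q a c = \<bar>of_int (m * k) * q a c\<bar>" using A by (simp add: abs_mult)
  also have "\<dots> = \<bar>\<beta> a' c' b' d' - \<beta> a c b d\<bar>" using be ml by simp
  also have "\<dots> < q a c" using red(2) red'(2) eq by linarith
  finally have "\<bar>real_of_int (m * k)\<bar> < 1" using A by simp
  then have "\<bar>m * k\<bar> < 1" unfolding of_int_abs[symmetric] by (simp only: of_int_less_1_iff)
  then have "m * k = 0" by (simp only: zabs_less_one_iff)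
  then have "k = 0" using 1 by auto
  then show ?thesis using 1 lm by (auto simp: ac kl)
qed

text \<open>By Cramer's rule with determinant 1, the coefficients are bounded in terms of the
  coordinates of the vector.\<close>

lemma qform_bounded_finite:
  fixes x1 x2 y1 y2 M :: real
  assumes det: "x1 * y2 - x2 * y1 = 1"
  shows "finite {w :: int \<times> int. qform x1 x2 y1 y2 (fst w) (snd w) \<le> M}"
proof -
  \<comment> \<open>|M| + 1 bounds |z| whenever z^2 <= M; the 1 takes care of M < 1.\<close>
  define R where "R = (\<bar>M\<bar> + 1) * (\<bar>x1\<bar> + \<bar>x2\<bar> + \<bar>y1\<bar> + \<bar>y2\<bar>)"
  have "\<bar>of_int u\<bar> \<le> R \<and> \<bar>of_int v\<bar> \<le> R" if q: "qform x1 x2 y1 y2 u v \<le> M" for u v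
  proof -
    define X where "X = x1 * u + x2 * v"
    define Y where "Y = y1 * u + y2 * v"
    have XY: "X\<^sup>2 + Y\<^sup>2 \<le> M" using q by (simp add: qform_def X_def Y_def)
    have b: "\<bar>z\<bar> \<le> \<bar>M\<bar> + 1" if "z\<^sup>2 \<le> M" for z
    proof (rule ccontr)
      assume "\<not> ?thesis"
      then have "\<bar>z\<bar> > \<bar>M\<bar> + 1" by simp
      then have "\<bar>z\<bar> * \<bar>z\<bar> > (\<bar>M\<bar> + 1) * 1" by (intro mult_strict_mono) auto
      then show False using that by (simp add: power2_eq_square flip: abs_mult)
    qed
    have X: "\<bar>X\<bar> \<le> \<bar>M\<bar> + 1" and Y: "\<bar>Y\<bar> \<le> \<bar>M\<bar> + 1"
      by (rule b; use XY zero_le_power2[of X] zero_le_power2[of Y] in linarith)+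
    have "y2 * X - x2 * Y = (x1 * y2 - x2 * y1) * u" "x1 * Y - y1 * X = (x1 * y2 - x2 * y1) * v"
      by (auto simp: X_def Y_def algebra_simps)
    then have u: "of_int u = y2 * X - x2 * Y" "of_int v = x1 * Y - y1 * X" using det by auto
    have e: "\<bar>s * X - t * Y\<bar> \<le> (\<bar>M\<bar> + 1) * (\<bar>s\<bar> + \<bar>t\<bar>)" for s t
    proof -
      have "\<bar>s * X - t * Y\<bar> \<le> \<bar>s\<bar> * \<bar>X\<bar> + \<bar>t\<bar> * \<bar>Y\<bar>"
        using abs_triangle_ineq4[of "s * X" "t * Y"] by (simp add: abs_mult)
      also have "\<dots> \<le> \<bar>s\<bar> * (\<bar>M\<bar> + 1) + \<bar>t\<bar> * (\<bar>M\<bar> + 1)" using X Y by (intro add_mono mult_left_mono) auto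
      finally show ?thesis by (simp add: algebra_simps)
    qed
    have "(\<bar>M\<bar> + 1) * (\<bar>y2\<bar> + \<bar>x2\<bar>) \<le> R" "(\<bar>M\<bar> + 1) * (\<bar>y1\<bar> + \<bar>x1\<bar>) \<le> R"
      unfolding R_def by (intro mult_left_mono; simp)+
    moreover have "\<bar>real_of_int v\<bar> = \<bar>y1 * X - x1 * Y\<bar>" using u(2) by simp
    ultimately show ?thesis using e[of y2 x2] e[of y1 x1] u(1) by linarith
  qed
  then have "{w. qform x1 x2 y1 y2 (fst w) (snd w) \<le> M} \<subseteq> {-\<lfloor>R\<rfloor>..\<lfloor>R\<rfloor>} \<times> {-\<lfloor>R\<rfloor>..\<lfloor>R\<rfloor>}"
    by (auto simp: le_floor_iff abs_le_iff minus_le_iff)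
  then show ?thesis by (rule finite_subset) simp
qed

lemma qform_pos:
  assumes det: "x1 * y2 - x2 * y1 = 1" and "u \<noteq> 0 \<or> v \<noteq> 0"
  shows "qform x1 x2 y1 y2 u v > 0"
proof (rule ccontr)
  assume "\<not> ?thesis"
  then have "(x1 * u + x2 * v)\<^sup>2 + (y1 * u + y2 * v)\<^sup>2 \<le> 0" by (simp add: qform_def)
  then have z: "x1 * u + x2 * v = 0" "y1 * u + y2 * v = 0" by (simp_all add: sum_power2_le_zero_iff)
  have "y2 * (x1 * u + x2 * v) - x2 * (y1 * u + y2 * v) = (x1 * y2 - x2 * y1) * u"
    "x1 * (y1 * u + y2 * v) - y1 * (x1 * u + x2 * v) = (x1 * y2 - x2 * y1) * v"
    by (auto simp: algebra_simps)
  then show False using z det assms(2) by simp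
qed

text \<open>Take a shortest nonzero vector. Its coefficients are coprime, since dividing by their
  gcd would shorten it, so it extends to a basis by Bezout. Subtracting the nearest multiple of it
  from the second vector makes the inner product small; the order of the lengths comes for free by
  minimality.\<close>

lemma reduced_basis_exists:
  fixes x1 x2 y1 y2 :: real
  defines "q \<equiv> qform x1 x2 y1 y2" and "\<beta> \<equiv> bform x1 x2 y1 y2"
  assumes det: "x1 * y2 - x2 * y1 = 1"
  obtains a b c d :: int where "a * d - b * c = 1" "q a c \<le> q b d" "2 * \<bar>\<beta> a c b d\<bar> \<le> q a c"
proof -
  \<comment> \<open>Comparison with the vector (1, 0) leaves a finite nonempty set on which a
    minimum exists; every other nonzero vector is longer anyway.\<close>
  define T where "T = {w :: int \<times> int. q (fst w) (snd w) \<le> q 1 0} - {(0, 0)}"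
  have fT: "finite T" unfolding T_def q_def using qform_bounded_finite[OF det] by simp
  have "(1, 0) \<in> T" by (simp add: T_def)
  then have nT: "T \<noteq> {}" by blast
  obtain w where w: "w \<in> T" "\<And>w'. w' \<in> T \<Longrightarrow> q (fst w) (snd w) \<le> q (fst w') (snd w')"
    using ex_min_if_finite[OF finite_imageI[OF fT, of "\<lambda>w. q (fst w) (snd w)"]] nT
    by (force simp: not_less)
  obtain a c where ac: "w = (a, c)" by fastforce
  have nz: "a \<noteq> 0 \<or> c \<noteq> 0" using w(1) by (auto simp: ac T_def)
  have min: "q a c \<le> q u v" if "u \<noteq> 0 \<or> v \<noteq> 0" for u v
  proof (cases "q u v \<le> q 1 0")
    case True
    then show ?thesis using w(2)[of "(u, v)"] that by (auto simp: ac T_def)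
  next
    case False
    then show ?thesis using w(1) by (auto simp: ac T_def)
  qed
  have pos: "q a c > 0" unfolding q_def using det nz by (rule qform_pos)
  have cop: "coprime a c"
  proof -
    define g where "g = gcd a c"
    have g: "g > 0" using nz by (auto simp: g_def)
    obtain a' c' where a': "a = g * a'" "c = g * c'" unfolding g_def by (meson dvdE gcd_dvd1 gcd_dvd2)
    have "q a c = (of_int g)\<^sup>2 * q a' c'" by (simp add: a' q_def qform_def power2_eq_square algebra_simps)
    moreover have "q a c \<le> q a' c'" using nz by (intro min) (auto simp: a')
    ultimately have "(of_int g)\<^sup>2 * q a' c' \<le> 1 * q a' c'" by simp
    moreover have "q a' c' > 0" unfolding q_def using nz by (intro qform_pos[OF det]) (auto simp: a')
    ultimately have "(real_of_int g)\<^sup>2 \<le> 1" by simp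
    then have "g \<le> 1" using g by (simp add: abs_square_le_1 flip: of_int_abs)
    then have "g = 1" using g by linarith
    then show ?thesis by (simp add: g_def coprime_iff_gcd_eq_1)
  qed
  obtain r s where rs: "r * a + s * c = 1" using bezout_int[of a c] cop by (auto simp: coprime_iff_gcd_eq_1)
  define k where "k = - round (\<beta> a c (-s) r / q a c)"
  define b where "b = -s + k * a"
  define d where "d = r + k * c"
  have det1: "a * d - b * c = 1" using rs by (simp add: b_def d_def algebra_simps)
  have "\<beta> a c b d = \<beta> a c (-s) r + of_int k * q a c"
    by (simp add: \<beta>_def q_def bform_def qform_def b_def d_def power2_eq_square algebra_simps)
  also have "\<dots> = q a c * (\<beta> a c (-s) r / q a c - of_int (round (\<beta> a c (-s) r / q a c)))"
    using pos by (simp add: k_def algebra_simps)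
  finally have "\<bar>\<beta> a c b d\<bar> = q a c * \<bar>\<beta> a c (-s) r / q a c - of_int (round (\<beta> a c (-s) r / q a c))\<bar>"
    using pos by (simp add: abs_mult)
  also have "\<dots> \<le> q a c * (1 / 2)"
    using pos of_int_round_abs_le[of "\<beta> a c (-s) r / q a c"] by (intro mult_left_mono) (auto simp: abs_minus_commute)
  finally have "2 * \<bar>\<beta> a c b d\<bar> \<le> q a c" by simp
  moreover have "q a c \<le> q b d" using det1 by (intro min) auto
  ultimately show ?thesis using det1 that by blast
qed

section \<open>Unfolding the horocycle average\<close>

text \<open>One fixed completion of the bottom row w = (c, d) to a matrix in SL(2,Z). All other
  completions differ from it by an integer multiple of w.\<close>

definition bezout_row :: "int \<times> int \<Rightarrow> int \<times> int" where
  "bezout_row w = (SOME z. fst z * snd w - snd z * fst w = 1)"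

lemma bezout_row:
  assumes "w \<in> coprime_pairs"
  shows "fst (bezout_row w) * snd w - snd (bezout_row w) * fst w = 1"
  unfolding bezout_row_def
proof (rule someI_ex)
  obtain r s where "r * fst w + s * snd w = gcd (fst w) (snd w)" using bezout_int by blast
  then have "fst (s, -r) * snd w - snd (s, -r) * fst w = 1"
    using assms by (simp add: coprime_pairs_def coprime_iff_gcd_eq_1 algebra_simps)
  then show "\<exists>z. fst z * snd w - snd z * fst w = 1" by blast
qed

text \<open>The coordinate t of the integer matrix with rows \<open>bezout_row w\<close> and w: the
  inner product of the rows divided by the squared length of w.\<close>

definition bezout_shift :: "int \<times> int \<Rightarrow> real" where
  "bezout_shift w = of_int (fst (bezout_row w) * fst w + snd (bezout_row w) * snd w) / of_int ((fst w)\<^sup>2 + (snd w)\<^sup>2)"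

definition horo_index :: "((int \<times> int) \<times> int) set" where
  "horo_index = coprime_pairs \<times> UNIV"

text \<open>The coordinates of [[N, N alpha], [0, 1/N]] times the element of SL(2,Z) encoded by i,
  as \<open>horo_point_top\<close> verifies. The diagonal part divides y by N and multiplies t by
  N^2; adding n copies of w to the top row adds n to the shift, exactly as increasing alpha by n
  does.\<close>

definition horo_point :: "nat \<Rightarrow> real \<Rightarrow> (int \<times> int) \<times> int \<Rightarrow> (real \<times> real) \<times> real" where
  "horo_point N \<alpha> i = ((of_int (fst (fst i)) / N, of_int (snd (fst i)) / N),
                       (real N)\<^sup>2 * (\<alpha> + of_int (snd i) + bezout_shift (fst i)))"

text \<open>The index (w, n) encodes the element of SL(2,Z) with bottom row w and top row
  bezout_row w + n w.\<close>

definition top_row :: "(int \<times> int) \<times> int \<Rightarrow> int \<times> int" where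
  "top_row i = (fst (bezout_row (fst i)) + snd i * fst (fst i), snd (bezout_row (fst i)) + snd i * snd (fst i))"

lemma top_row_det:
  assumes "i \<in> horo_index"
  shows "fst (top_row i) * snd (fst i) - snd (top_row i) * fst (fst i) = 1"
  using bezout_row[of "fst i"] assms by (auto simp: horo_index_def top_row_def algebra_simps)

text \<open>\<open>e1\<close> and \<open>e2\<close> are the orthogonal decomposition of the top row
  (a, b) along (d, -c) and (c, d): the first coefficient is the determinant, the second the inner
  product with (c, d), both over \<open>r\<close>.\<close>

lemma horo_point_top:
  fixes \<alpha> :: real
  assumes "i \<in> horo_index" "N \<ge> 1"
  shows "top1 (horo_point N \<alpha> i) = real N * of_int (fst (top_row i)) + real N * \<alpha> * of_int (fst (fst i))"
    and "top2 (horo_point N \<alpha> i) = real N * of_int (snd (top_row i)) + real N * \<alpha> * of_int (snd (fst i))"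
proof -
  define c d n a b where defs: "c = real_of_int (fst (fst i))" "d = real_of_int (snd (fst i))" "n = real_of_int (snd i)"
     "a = real_of_int (fst (bezout_row (fst i)))" "b = real_of_int (snd (bezout_row (fst i)))"
  have w: "fst i \<in> coprime_pairs" using assms(1) by (auto simp: horo_index_def)
  have det: "a * d - b * c = 1"
    using arg_cong[OF bezout_row[OF w], of real_of_int] by (simp add: defs)
  define r where "r = c\<^sup>2 + d\<^sup>2"
  have r: "r > 0" using det unfolding r_def by (auto simp: sum_power2_gt_zero_iff)
  have N: "real N > 0" using assms by simp
  have t: "snd (horo_point N \<alpha> i) = (real N)\<^sup>2 * (\<alpha> + n + (a * c + b * d) / r)"
    and y: "fst (horo_point N \<alpha> i) = (c / N, d / N)"
    by (simp_all add: horo_point_def bezout_shift_def defs r_def)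
  have rr: "(c / N)\<^sup>2 + (d / N)\<^sup>2 = r / (real N)\<^sup>2" by (simp add: r_def power_divide add_divide_distrib)
  have e1: "d + (a * c + b * d) * c = a * r"
  proof -
    have "d + (a * c + b * d) * c = d * (a * d - b * c) + (a * c + b * d) * c" using det by simp
    also have "\<dots> = a * r" by (simp add: r_def power2_eq_square algebra_simps)
    finally show ?thesis .
  qed
  have e2: "(a * c + b * d) * d - c = b * r"
  proof -
    have "(a * c + b * d) * d - c = (a * c + b * d) * d - c * (a * d - b * c)" using det by simp
    also have "\<dots> = b * r" by (simp add: r_def power2_eq_square algebra_simps)
    finally show ?thesis .
  qed
  have "top1 (horo_point N \<alpha> i) = N * ((d + (a * c + b * d) * c) / r + (\<alpha> + n) * c)"
    unfolding top1_def t y fst_conv snd_conv rr using r N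
    by (simp add: field_simps power2_eq_square)
  also have "\<dots> = N * (a + (\<alpha> + n) * c)" using r by (simp add: e1)
  finally show "top1 (horo_point N \<alpha> i) = real N * of_int (fst (top_row i)) + real N * \<alpha> * of_int (fst (fst i))"
    by (simp add: top_row_def defs algebra_simps)
  have "top2 (horo_point N \<alpha> i) = N * (((a * c + b * d) * d - c) / r + (\<alpha> + n) * d)"
    unfolding top2_def t y fst_conv snd_conv rr using r N
    by (simp add: field_simps power2_eq_square)
  also have "\<dots> = N * (b + (\<alpha> + n) * d)" using r by (simp add: e2)
  finally show "top2 (horo_point N \<alpha> i) = real N * of_int (snd (top_row i)) + real N * \<alpha> * of_int (snd (fst i))"
    by (simp add: top_row_def defs algebra_simps)
qed

text \<open>This turns an event about alpha into membership of any one of its points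
  \<open>horo_point N \<alpha> i\<close> in a set independent of N.\<close>

lemma horo_point_prim_count:
  fixes \<alpha> :: real
  assumes "i \<in> horo_index" "N \<ge> 1"
  defines "p \<equiv> horo_point N \<alpha> i"
  shows "prim_count H (top1 p) (top2 p) (fst (fst p)) (snd (fst p)) = prim_count H N (N * \<alpha>) 0 (1 / N)"
proof -
  have "fst (fst p) = 0 * of_int (fst (top_row i)) + 1 / N * of_int (fst (fst i))"
       "snd (fst p) = 0 * of_int (snd (top_row i)) + 1 / N * of_int (snd (fst i))"
    by (simp_all add: p_def horo_point_def)
  then show ?thesis
    unfolding p_def horo_point_top[OF assms(1,2)]
    using prim_count_SL2Z[OF top_row_det[OF assms(1)], of H N "N * \<alpha>" 0 "1 / N"] by simp
qed

lemma horo_point_forms: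
  fixes \<alpha> :: real
  assumes "i \<in> horo_index" "N \<ge> 1"
  defines "p \<equiv> horo_point N \<alpha> i"
  shows "(top1 p)\<^sup>2 + (fst (fst p))\<^sup>2 = qform N (N * \<alpha>) 0 (1 / N) (fst (top_row i)) (fst (fst i))"
    and "(top2 p)\<^sup>2 + (snd (fst p))\<^sup>2 = qform N (N * \<alpha>) 0 (1 / N) (snd (top_row i)) (snd (fst i))"
    and "top1 p * top2 p + fst (fst p) * snd (fst p) =
      bform N (N * \<alpha>) 0 (1 / N) (fst (top_row i)) (fst (fst i)) (snd (top_row i)) (snd (fst i))"
  unfolding p_def qform_def bform_def horo_point_top[OF assms(1,2)]
  by (simp_all add: horo_point_def)

lemma horo_index_eqI:
  assumes "i \<in> horo_index" "j \<in> horo_index" "fst i = fst j" "top_row i = top_row j"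
  shows "i = j"
proof -
  have "fst (fst j) \<noteq> 0 \<or> snd (fst j) \<noteq> 0"
    using assms(2) by (auto simp: horo_index_def coprime_pairs_def)
  then have "snd i = snd j" using assms(3,4) by (auto simp: top_row_def)
  then show ?thesis using assms(3) by (simp add: prod_eq_iff)
qed

lemma strictly_reduced_forms:
  fixes \<alpha> :: real
  assumes "i \<in> horo_index" "N \<ge> 1" "horo_point N \<alpha> i \<in> strictly_reduced"
  shows "qform N (N * \<alpha>) 0 (1 / N) (fst (top_row i)) (fst (fst i))
         < qform N (N * \<alpha>) 0 (1 / N) (snd (top_row i)) (snd (fst i))"
    and "2 * \<bar>bform N (N * \<alpha>) 0 (1 / N) (fst (top_row i)) (fst (fst i)) (snd (top_row i)) (snd (fst i))\<bar>
         < qform N (N * \<alpha>) 0 (1 / N) (fst (top_row i)) (fst (fst i))"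
  using assms(3) unfolding strictly_reduced_def mem_Collect_eq horo_point_forms[OF assms(1,2)] by blast+

text \<open>An index is determined by its matrix in SL(2,Z), and strict reduction leaves only one
  matrix and its negative.\<close>

lemma card_strictly_reduced_horo_points:
  fixes \<alpha> :: real
  assumes "N \<ge> 1"
  defines "J \<equiv> {i \<in> horo_index. horo_point N \<alpha> i \<in> strictly_reduced}"
  shows "finite J \<and> card J \<le> 2"
proof (cases "J = {}")
  case False
  then obtain i0 where i0: "i0 \<in> J" by blast
  define m where "m i = (fst (top_row i), snd (top_row i), fst (fst i), snd (fst i))" for i :: "(int \<times> int) \<times> int"
  obtain a b c d where m0: "m i0 = (a, b, c, d)" by (metis prod.exhaust)
  have inj: "inj_on m J"
    by (rule inj_onI, rule horo_index_eqI) (auto simp: J_def m_def prod_eq_iff)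
  have "m i \<in> {(a, b, c, d), (-a, -b, -c, -d)}" if i: "i \<in> J" for i
  proof -
    have 0: "i0 \<in> horo_index" "i \<in> horo_index" using i i0 by (auto simp: J_def)
    have m0': "fst (top_row i0) = a" "snd (top_row i0) = b" "fst (fst i0) = c" "snd (fst i0) = d"
      using m0 by (auto simp: m_def)
    have red: "horo_point N \<alpha> i0 \<in> strictly_reduced" "horo_point N \<alpha> i \<in> strictly_reduced"
      using i i0 by (auto simp: J_def)
    have "(fst (top_row i), snd (top_row i), fst (fst i), snd (fst i)) = (a, b, c, d) \<or>
          (fst (top_row i), snd (top_row i), fst (fst i), snd (fst i)) = (-a, -b, -c, -d)"
      using strictly_reduced_unique[OF top_row_det[OF 0(1)] top_row_det[OF 0(2)]
          strictly_reduced_forms[OF 0(1) assms(1) red(1)] strictly_reduced_forms[OF 0(2) assms(1) red(2)]]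
      unfolding m0' .
    then show ?thesis by (simp add: m_def)
  qed
  then have sub: "m ` J \<subseteq> {(a, b, c, d), (-a, -b, -c, -d)}" by blast
  then have "finite (m ` J)" by (rule finite_subset) simp
  then have fin: "finite J" using inj by (rule finite_imageD)
  have "card J = card (m ` J)" by (rule card_image[OF inj, symmetric])
  also have "\<dots> \<le> card {(a, b, c, d), (-a, -b, -c, -d)}" by (rule card_mono[OF _ sub]) simp
  also have "\<dots> \<le> 2" by (simp add: card_insert_if)
  finally show ?thesis using fin by simp
qed simp

lemma horo_index_surj:
  fixes a b c d :: int
  assumes "a * d - b * c = 1"
  obtains n where "((c, d), n) \<in> horo_index" "top_row ((c, d), n) = (a, b)"
proof -
  have "coprime c d"
  proof (rule coprimeI)
    fix g assume "g dvd c" "g dvd d"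
    then have "g dvd a * d - b * c" by (intro dvd_diff dvd_mult)
    then show "is_unit g" using assms by simp
  qed
  then have cd: "(c, d) \<in> coprime_pairs" by (simp add: coprime_pairs_def)
  obtain a0 b0 where ab0: "bezout_row (c, d) = (a0, b0)" by fastforce
  have det0: "a0 * d - b0 * c = 1" using bezout_row[OF cd] by (simp add: ab0)
  \<comment> \<open>From (a - a0, b - b0) = n (c, d) and a0 d - b0 c = 1 one reads off this value of
    n.\<close>
  define n where "n = a0 * (b - b0) - b0 * (a - a0)"
  have eq: "(a - a0) * d = (b - b0) * c" using assms det0 by (simp add: algebra_simps)
  have "a - a0 = (a - a0) * (a0 * d - b0 * c)" using det0 by simp
  also have "\<dots> = a0 * ((a - a0) * d) - (a - a0) * b0 * c" by (simp add: algebra_simps)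
  also have "\<dots> = n * c" unfolding eq by (simp add: n_def algebra_simps)
  finally have 1: "a0 + n * c = a" by simp
  have "b - b0 = (b - b0) * (a0 * d - b0 * c)" using det0 by simp
  also have "\<dots> = (b - b0) * a0 * d - b0 * ((b - b0) * c)" by (simp add: algebra_simps)
  also have "\<dots> = n * d" unfolding eq[symmetric] by (simp add: n_def algebra_simps)
  finally have 2: "b0 + n * d = b" by simp
  show ?thesis
    by (rule that[of n]) (use cd 1 2 in \<open>auto simp: horo_index_def top_row_def ab0\<close>)
qed

text \<open>The negative of a reduced basis is again one, and is different because its bottom row is
  not 0. This matches the upper bound 2 for strictly reduced bases.\<close>

lemma weakly_reduced_horo_points:
  assumes "N \<ge> 1"
  obtains i j where "i \<in> horo_index" "j \<in> horo_index" "i \<noteq> j"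
    "horo_point N \<alpha> i \<in> weakly_reduced" "horo_point N \<alpha> j \<in> weakly_reduced"
proof -
  have det: "real N * (1 / real N) - (N * \<alpha>) * 0 = 1" using assms by simp
  obtain a b c d :: int where abcd: "a * d - b * c = 1"
    "qform N (N * \<alpha>) 0 (1 / N) a c \<le> qform N (N * \<alpha>) 0 (1 / N) b d"
    "2 * \<bar>bform N (N * \<alpha>) 0 (1 / N) a c b d\<bar> \<le> qform N (N * \<alpha>) 0 (1 / N) a c"
    using reduced_basis_exists[OF det] by blast
  have red: "horo_point N \<alpha> i \<in> weakly_reduced" if "i \<in> horo_index"
     "qform N (N * \<alpha>) 0 (1 / N) (fst (top_row i)) (fst (fst i)) \<le> qform N (N * \<alpha>) 0 (1 / N) (snd (top_row i)) (snd (fst i))"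
    "2 * \<bar>bform N (N * \<alpha>) 0 (1 / N) (fst (top_row i)) (fst (fst i)) (snd (top_row i)) (snd (fst i))\<bar> \<le> qform N (N * \<alpha>) 0 (1 / N) (fst (top_row i)) (fst (fst i))"
    for i
  proof -
    have "fst (horo_point N \<alpha> i) \<noteq> 0"
      using that(1) assms by (auto simp: horo_point_def horo_index_def coprime_pairs_def zero_prod_def)
    then show ?thesis using that unfolding weakly_reduced_def
      by (simp add: horo_point_forms[OF that(1) assms])
  qed
  obtain n where n: "((c, d), n) \<in> horo_index" "top_row ((c, d), n) = (a, b)" using horo_index_surj[OF abcd(1)] .
  have "(-a) * (-d) - (-b) * (-c) = 1" using abcd(1) by simp
  then obtain n' where n': "((-c, -d), n') \<in> horo_index" "top_row ((-c, -d), n') = (-a, -b)" by (rule horo_index_surj)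
  have neg: "qform x1 x2 y1 y2 (-u) (-v) = qform x1 x2 y1 y2 u v"
    "bform x1 x2 y1 y2 (-u) (-v) (-u') (-v') = bform x1 x2 y1 y2 u v u' v'" for x1 x2 y1 y2 u v u' v'
    by (simp_all add: qform_def bform_def power2_eq_square algebra_simps)
  show ?thesis
  proof (rule that[OF n(1) n'(1)])
    have "c \<noteq> 0 \<or> d \<noteq> 0" using abcd(1) by auto
    then show "((c, d), n) \<noteq> ((-c, -d), n')" by auto
    show "horo_point N \<alpha> ((c, d), n) \<in> weakly_reduced" "horo_point N \<alpha> ((-c, -d), n') \<in> weakly_reduced"
      using abcd by (auto intro!: red n n' simp: n(2) n'(2) neg)
  qed
qed

text \<open>The translates of [0, 1) tile the line, each point lying in exactly one of them.\<close>

lemma nn_integral_int_translates: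
  fixes f :: "real \<Rightarrow> ennreal"
  assumes [measurable]: "f \<in> borel_measurable borel"
  shows "(\<integral>\<^sup>+n. (\<integral>\<^sup>+\<alpha>. f (\<alpha> + of_int n) * indicator {0..<1} \<alpha> \<partial>lborel) \<partial>count_space (UNIV :: int set)) = (\<integral>\<^sup>+\<alpha>. f \<alpha> \<partial>lborel)"
proof -
  have "(\<integral>\<^sup>+\<alpha>. f (\<alpha> + of_int n) * indicator {0..<1} \<alpha> \<partial>lborel) = (\<integral>\<^sup>+\<alpha>. f \<alpha> * indicator {of_int n..<of_int n + 1} \<alpha> \<partial>lborel)" for n :: int
    by (subst nn_integral_real_affine[where c = 1 and t = "of_int n" and f = "\<lambda>\<alpha>. f \<alpha> * indicator {of_int n..<of_int n + 1} \<alpha>"])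
       (auto simp: add.commute indicator_def intro!: nn_integral_cong)
  then have "(\<integral>\<^sup>+n. (\<integral>\<^sup>+\<alpha>. f (\<alpha> + of_int n) * indicator {0..<1} \<alpha> \<partial>lborel) \<partial>count_space (UNIV :: int set))
      = (\<integral>\<^sup>+n. (\<integral>\<^sup>+\<alpha>. f \<alpha> * indicator {of_int n..<of_int n + 1} \<alpha> \<partial>lborel) \<partial>count_space (UNIV :: int set))" by simp
  also have "\<dots> = (\<integral>\<^sup>+\<alpha>. (\<integral>\<^sup>+n. f \<alpha> * indicator {of_int n..<of_int n + 1} \<alpha> \<partial>count_space (UNIV :: int set)) \<partial>lborel)"
    by (rule nn_integral_count_space_nn_integral[symmetric]) auto
  also have "\<dots> = (\<integral>\<^sup>+\<alpha>. f \<alpha> \<partial>lborel)"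
  proof (rule nn_integral_cong)
    fix \<alpha> :: real
    have "(\<integral>\<^sup>+n. f \<alpha> * indicator {of_int n..<of_int n + 1} \<alpha> \<partial>count_space (UNIV :: int set)) = (\<Sum>n\<in>{\<lfloor>\<alpha>\<rfloor>}. f \<alpha> * indicator {of_int n..<of_int n + 1} \<alpha>)"
    proof (rule nn_integral_count_space')
      fix n assume "n \<notin> {\<lfloor>\<alpha>\<rfloor>}"
      then have "\<alpha> \<notin> {of_int n..<of_int n + 1}" by auto linarith
      then show "f \<alpha> * indicator {of_int n..<of_int n + 1} \<alpha> = 0" by simp
    qed auto
    also have "\<dots> = f \<alpha>" by (simp add: indicator_def)
    finally show "(\<integral>\<^sup>+n. f \<alpha> * indicator {of_int n..<of_int n + 1} \<alpha> \<partial>count_space (UNIV :: int set)) = f \<alpha>" .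
  qed
  finally show ?thesis .
qed

lemma nn_integral_count_space_Times_UNIV:
  fixes f :: "'a \<times> 'b \<Rightarrow> ennreal"
  shows "(\<integral>\<^sup>+i. f i \<partial>count_space (A \<times> UNIV)) = (\<integral>\<^sup>+a. (\<integral>\<^sup>+b. f (a, b) \<partial>count_space UNIV) \<partial>count_space A)"
proof -
  have "(\<integral>\<^sup>+i. f i \<partial>count_space (A \<times> UNIV)) = (\<integral>\<^sup>+i. f i * indicator (A \<times> UNIV) i \<partial>count_space UNIV)"
    by (rule nn_integral_count_space_indicator) simp
  also have "\<dots> = (\<integral>\<^sup>+a. (\<integral>\<^sup>+b. f (a, b) * indicator (A \<times> UNIV) (a, b) \<partial>count_space UNIV) \<partial>count_space UNIV)"
    by (rule nn_integral_fst_count_space[symmetric])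
  also have "\<dots> = (\<integral>\<^sup>+a. (\<integral>\<^sup>+b. f (a, b) \<partial>count_space UNIV) * indicator A a \<partial>count_space UNIV)"
    by (intro nn_integral_cong) (auto simp: indicator_def)
  also have "\<dots> = (\<integral>\<^sup>+a. (\<integral>\<^sup>+b. f (a, b) \<partial>count_space UNIV) \<partial>count_space A)"
    by (rule nn_integral_count_space_indicator[symmetric]) simp
  finally show ?thesis .
qed

text \<open>For a fixed bottom row w, the sum over n and the integral over alpha in [0, 1) merge
  into one integral over the whole line. The substitution t = N^2 (s +
  \<open>bezout_shift w\<close>) then produces the weight 1/N^2.\<close>

lemma horo_mass_unfold:
  assumes S: "S \<in> sets borel" and N: "N \<ge> 1"
  shows "(\<integral>\<^sup>+\<alpha>. (\<integral>\<^sup>+i. indicator S (horo_point N \<alpha> i) * indicator {0..<1} \<alpha> \<partial>count_space horo_index) \<partial>lborel) = horo_mass N S"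
proof -
  \<comment> \<open>The first component of \<open>horo_point\<close> does not depend on alpha, so it
    is written with alpha = 0 to expose the slice of S.\<close>
  have hp: "indicator S (horo_point N \<alpha> i) = (indicator {t. (fst (horo_point N 0 i), t) \<in> S} ((real N)\<^sup>2 * (\<alpha> + of_int (snd i) + bezout_shift (fst i))) :: ennreal)" for \<alpha> i
    by (simp add: horo_point_def indicator_def)
  have ind: "(\<lambda>s. indicator {t. (y, t) \<in> S} (a * (s + b)) :: ennreal) \<in> borel_measurable borel" for y and a b :: real
  proof -
    define T where "T = {t. (y, t) \<in> S}"
    have [measurable]: "T \<in> sets borel" using S unfolding T_def by (rule sets_slice)
    have "(\<lambda>s. indicator T (a * (s + b)) :: ennreal) \<in> borel_measurable borel" by measurable
    then show ?thesis unfolding T_def .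
  qed
  have slice: "{t. (y, t) \<in> S} \<in> sets borel" for y using S by (rule sets_slice)
  have "(\<integral>\<^sup>+\<alpha>. (\<integral>\<^sup>+i. indicator S (horo_point N \<alpha> i) * indicator {0..<1} \<alpha> \<partial>count_space horo_index) \<partial>lborel)
      = (\<integral>\<^sup>+i. (\<integral>\<^sup>+\<alpha>. indicator S (horo_point N \<alpha> i) * indicator {0..<1} \<alpha> \<partial>lborel) \<partial>count_space horo_index)"
  proof (rule nn_integral_count_space_nn_integral)
    show "countable horo_index" by simp
    fix i
    have "(\<lambda>\<alpha>. indicator {t. (fst (horo_point N 0 i), t) \<in> S} ((real N)\<^sup>2 * (\<alpha> + (of_int (snd i) + bezout_shift (fst i)))) * indicator {0..<1} \<alpha> :: ennreal) \<in> borel_measurable borel"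
      by (intro borel_measurable_times_ennreal ind) simp
    then show "(\<lambda>\<alpha>. indicator S (horo_point N \<alpha> i) * indicator {0..<1} \<alpha> :: ennreal) \<in> borel_measurable lborel"
      unfolding hp by (simp add: add.assoc)
  qed
  also have "\<dots> = (\<integral>\<^sup>+w. (\<integral>\<^sup>+n. (\<integral>\<^sup>+\<alpha>. indicator S (horo_point N \<alpha> (w, n)) * indicator {0..<1} \<alpha> \<partial>lborel) \<partial>count_space UNIV) \<partial>count_space coprime_pairs)"
    unfolding horo_index_def by (rule nn_integral_count_space_Times_UNIV)
  also have "\<dots> = horo_mass N S" unfolding horo_mass_def
  proof (rule nn_integral_cong)
    fix w :: "int \<times> int"
    let ?T = "{t. ((of_int (fst w) / real N, of_int (snd w) / real N), t) \<in> S}"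
    let ?g = "\<lambda>s. indicator ?T ((real N)\<^sup>2 * (s + bezout_shift w)) :: ennreal"
    have "(\<integral>\<^sup>+n. (\<integral>\<^sup>+\<alpha>. indicator S (horo_point N \<alpha> (w, n)) * indicator {0..<1} \<alpha> \<partial>lborel) \<partial>count_space UNIV)
       = (\<integral>\<^sup>+n. (\<integral>\<^sup>+\<alpha>. ?g (\<alpha> + of_int n) * indicator {0..<1} \<alpha> \<partial>lborel) \<partial>count_space UNIV)"
      unfolding hp by (simp add: horo_point_def)
    also have "\<dots> = (\<integral>\<^sup>+s. ?g s \<partial>lborel)" by (rule nn_integral_int_translates[OF ind])
    also have "\<dots> = ennreal (1 / (real N)\<^sup>2) * emeasure lborel ?T"
    proof -
      have "emeasure lborel ?T = (\<integral>\<^sup>+t. indicator ?T t \<partial>lborel)"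
        using slice by (intro nn_integral_indicator[symmetric]) simp
      also have "\<dots> = ennreal \<bar>(real N)\<^sup>2\<bar> * (\<integral>\<^sup>+s. indicator ?T ((real N)\<^sup>2 * bezout_shift w + (real N)\<^sup>2 * s) \<partial>lborel)"
        using N slice by (intro nn_integral_real_affine borel_measurable_indicator) auto
      finally have "emeasure lborel ?T = ennreal ((real N)\<^sup>2) * (\<integral>\<^sup>+s. ?g s \<partial>lborel)"
        by (simp add: algebra_simps)
      then have "ennreal (1 / (real N)\<^sup>2) * emeasure lborel ?T = (ennreal (1 / (real N)\<^sup>2) * ennreal ((real N)\<^sup>2)) * (\<integral>\<^sup>+s. ?g s \<partial>lborel)"
        by (simp only: mult.assoc)
      moreover have "ennreal (1 / (real N)\<^sup>2) * ennreal ((real N)\<^sup>2) = 1"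
        using N by (subst ennreal_mult[symmetric]) auto
      ultimately show ?thesis by simp
    qed
    finally show "(\<integral>\<^sup>+n. (\<integral>\<^sup>+\<alpha>. indicator S (horo_point N \<alpha> (w, n)) * indicator {0..<1} \<alpha> \<partial>lborel) \<partial>count_space UNIV)
       = ennreal (1 / (real N)\<^sup>2) * emeasure lborel ?T" .
  qed
  finally show ?thesis .
qed

section \<open>No escape of mass, null boundaries\<close>

text \<open>The vector is (N (u + alpha v), v/N). If it is short, v is not 0 and up to sign 1 <= v
  <= epsilon N. Also |u + alpha v| < epsilon/N < 1, which leaves the v + 1 values -v, ..., 0 for u,
  and each confines alpha to an interval of length 2 epsilon/(N v). As v + 1 <= 2 v, every v costs
  at most 4 epsilon/N, and there are at most epsilon N of them.\<close>

lemma short_vectors_cover: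
  fixes \<epsilon> :: real and N :: nat
  assumes N: "N \<ge> 1" and eps: "0 < \<epsilon>" "\<epsilon> < 1"
  obtains T where "T \<in> sets borel" "emeasure lborel T \<le> ennreal (4 * \<epsilon>\<^sup>2)"
    "\<And>(\<alpha>::real) u v. \<alpha> \<in> {0..<1} \<Longrightarrow> u \<noteq> 0 \<or> v \<noteq> 0 \<Longrightarrow> qform N (N * \<alpha>) 0 (1 / N) u v < \<epsilon>\<^sup>2 \<Longrightarrow> \<alpha> \<in> T"
proof -
  define L where "L = \<lfloor>\<epsilon> * N\<rfloor>"
  define J where "J v u = {(- of_int u - \<epsilon> / N) / of_int v .. (- of_int u + \<epsilon> / N) / of_int v}" for v u :: int
  define T where "T = (\<Union>v\<in>{1..L}. \<Union>u\<in>{-v..0}. J v u)"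
  have N0: "real N > 0" using N by simp
  have eJ: "emeasure lborel (J v u) = ennreal (2 * \<epsilon> / (N * of_int v))" if "v \<ge> 1" for v u
  proof -
    have "(- of_int u - \<epsilon> / N) / of_int v \<le> (- of_int u + \<epsilon> / N) / real_of_int v"
      using that eps N0 by (intro divide_right_mono) auto
    moreover have "(- of_int u + \<epsilon> / N) / of_int v - (- of_int u - \<epsilon> / N) / of_int v = 2 * \<epsilon> / (N * real_of_int v)"
      using that N0 by (simp add: field_simps)
    ultimately show ?thesis unfolding J_def by (subst emeasure_lborel_Icc) auto
  qed
  have pos: "\<alpha> \<in> T" if \<alpha>: "\<alpha> \<in> {0..<1}" and v: "v \<ge> 1" and q: "qform N (N * \<alpha>) 0 (1 / N) u v < \<epsilon>\<^sup>2" for \<alpha> :: real and u v :: int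
  proof -
    define X where "X = u + \<alpha> * v"
    have q': "(N * X)\<^sup>2 + (v / N)\<^sup>2 < \<epsilon>\<^sup>2" using q by (simp add: qform_def X_def algebra_simps)
    have "(N * X)\<^sup>2 < \<epsilon>\<^sup>2" "(v / N)\<^sup>2 < \<epsilon>\<^sup>2"
      using q' zero_le_power2[of "N * X"] zero_le_power2[of "v / N"] by linarith+
    then have "\<bar>N * X\<bar> < \<epsilon>" "\<bar>v / N\<bar> < \<epsilon>" using eps by (auto intro: power2_less_imp_less simp: abs_less_iff
       dest!: real_sqrt_less_mono[of _ "\<epsilon>\<^sup>2"])
    then have X: "\<bar>X\<bar> < \<epsilon> / N" and vN: "of_int v < \<epsilon> * N"
      using N0 v by (auto simp: abs_mult field_simps)
    have "\<epsilon> / N < 1" using N eps N0 by (simp add: field_simps)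
    then have X1: "\<bar>X\<bar> < 1" using X by linarith
    have av: "0 \<le> \<alpha> * v" "\<alpha> * v < v" using \<alpha> v by auto
    have "real_of_int u < 1" "real_of_int u > - v - 1" using X1 av by (auto simp: X_def)
    then have u: "u \<in> {-v..0}" by auto
    have "v \<le> L" using vN unfolding L_def by (simp add: le_floor_iff)
    moreover have "\<alpha> \<in> J v u" using X v by (auto simp: J_def X_def field_simps abs_less_iff)
    moreover have "v \<in> {1..L}" using v \<open>v \<le> L\<close> by simp
    ultimately show ?thesis using u unfolding T_def by blast
  qed
  show ?thesis
  proof (rule that)
    show "T \<in> sets borel" unfolding T_def J_def by auto
    have "emeasure lborel T \<le> (\<Sum>v\<in>{1..L}. emeasure lborel (\<Union>u\<in>{-v..0}. J v u))"
      unfolding T_def by (rule emeasure_subadditive_finite) (auto simp: J_def)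
    also have "\<dots> \<le> (\<Sum>v\<in>{1..L}. \<Sum>u\<in>{-v..0}. emeasure lborel (J v u))"
      by (intro sum_mono emeasure_subadditive_finite) (auto simp: J_def)
    also have "\<dots> = (\<Sum>v\<in>{1..L}. ennreal ((of_int v + 1) * (2 * \<epsilon> / (N * of_int v))))"
    proof (rule sum.cong[OF refl])
      fix v assume v: "v \<in> {1..L}"
      then have "(\<Sum>u\<in>{-v..0}. emeasure lborel (J v u)) = (\<Sum>u\<in>{-v..0}. ennreal (2 * \<epsilon> / (N * of_int v)))"
        by (intro sum.cong) (auto simp: eJ)
      also have "\<dots> = ennreal (\<Sum>u\<in>{-v..0}. 2 * \<epsilon> / (N * of_int v))"
        using v eps by (subst sum_ennreal) auto
      also have "(\<Sum>u\<in>{-v..0}. 2 * \<epsilon> / (N * of_int v)) = (of_int v + 1) * (2 * \<epsilon> / (N * of_int v))"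
        using v by (simp add: add.commute)
      finally show "(\<Sum>u\<in>{-v..0}. emeasure lborel (J v u)) = ennreal ((of_int v + 1) * (2 * \<epsilon> / (N * of_int v)))" .
    qed
    also have "\<dots> \<le> (\<Sum>v\<in>{1..L}. ennreal (4 * \<epsilon> / N))"
    proof (intro sum_mono ennreal_leI)
      fix v assume v: "v \<in> {1..L}"
      then have "(of_int v + 1) * (2 * \<epsilon> / (N * of_int v)) \<le> (2 * of_int v) * (2 * \<epsilon> / (N * of_int v))"
        using eps by (intro mult_right_mono) auto
      also have "\<dots> = 4 * \<epsilon> / N" using v by simp
      finally show "(of_int v + 1) * (2 * \<epsilon> / (N * of_int v)) \<le> 4 * \<epsilon> / N" .
    qed
    also have "\<dots> = ennreal (\<Sum>v\<in>{1..L}. 4 * \<epsilon> / N)"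
      using eps by (subst sum_ennreal) auto
    also have "(\<Sum>v\<in>{1..L}. 4 * \<epsilon> / N) = of_int L * (4 * \<epsilon> / N)"
      using eps N0 by (simp add: L_def)
    also have "\<dots> \<le> ennreal (4 * \<epsilon>\<^sup>2)"
    proof (rule ennreal_leI)
      have "of_int L * (4 * \<epsilon> / N) \<le> (\<epsilon> * N) * (4 * \<epsilon> / N)"
        using eps N0 by (intro mult_right_mono) (auto simp: L_def)
      then show "of_int L * (4 * \<epsilon> / N) \<le> 4 * \<epsilon>\<^sup>2" using N0 by (simp add: power2_eq_square)
    qed
    finally show "emeasure lborel T \<le> ennreal (4 * \<epsilon>\<^sup>2)" .
    fix \<alpha> :: real and u v :: int
    assume a: "\<alpha> \<in> {0..<1}" and uv: "u \<noteq> 0 \<or> v \<noteq> 0" and q: "qform N (N * \<alpha>) 0 (1 / N) u v < \<epsilon>\<^sup>2"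
    have "v \<noteq> 0"
    proof
      assume v: "v = 0"
      then have "(real N * of_int u)\<^sup>2 < \<epsilon>\<^sup>2" using q by (simp add: qform_def)
      moreover have "1 \<le> \<bar>real N * u\<bar>" using uv v N by (simp add: abs_mult mult_ge1_I)
      then have "1\<^sup>2 \<le> \<bar>real N * of_int u\<bar>\<^sup>2" by (intro power_mono) auto
      then have "1 \<le> (real N * of_int u)\<^sup>2" by (simp only: power2_abs power_one)
      moreover have "\<epsilon>\<^sup>2 < 1" using eps by (simp add: power_less_one_iff abs_square_less_1)
      ultimately show False by linarith
    qed
    then consider "v \<ge> 1" | "-v \<ge> 1" by linarith
    then show "\<alpha> \<in> T"
    proof cases
      case 1 then show ?thesis using pos a q by blast
    next
      case 2
      have "qform N (N * \<alpha>) 0 (1 / N) (-u) (-v) = qform N (N * \<alpha>) 0 (1 / N) u v"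
        by (simp add: qform_def power2_eq_square algebra_simps)
      then show ?thesis using pos[OF a 2, of "-u"] q by simp
    qed
  qed
qed

section \<open>Continuity of the coordinates and compactness away from the cusp\<close>

lemma horo_coords_continuous [continuous_intros]:
  "continuous_on S (\<lambda>p::(real \<times> real) \<times> real. fst (fst p))"
  "continuous_on S (\<lambda>p::(real \<times> real) \<times> real. snd (fst p))"
  by (intro continuous_intros)+

lemma rsq_pos: "fst p \<noteq> 0 \<Longrightarrow> (fst (fst p))\<^sup>2 + (snd (fst p))\<^sup>2 > (0::real)" for p :: "(real \<times> real) \<times> real"
  by (auto simp: sum_power2_gt_zero_iff zero_prod_def prod_eq_iff)

lemma top_continuous_on:
  assumes "\<And>p. p \<in> S \<Longrightarrow> fst p \<noteq> 0"
  shows "continuous_on S top1" "continuous_on S top2"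
proof -
  have "(fst (fst p))\<^sup>2 + (snd (fst p))\<^sup>2 \<noteq> 0" if "p \<in> S" for p
    using rsq_pos[OF assms[OF that]] by linarith
  then have nz: "\<forall>p\<in>S. (fst (fst p))\<^sup>2 + (snd (fst p))\<^sup>2 \<noteq> 0" by blast
  show "continuous_on S top1" "continuous_on S top2"
    unfolding top1_def[abs_def] top2_def[abs_def] by (intro continuous_intros nz)+
qed

lemma top_det:
  assumes "fst p \<noteq> 0"
  shows "top1 p * snd (fst p) - top2 p * fst (fst p) = 1"
proof -
  define r where "r = (fst (fst p))\<^sup>2 + (snd (fst p))\<^sup>2"
  have "r > 0" using rsq_pos[OF assms] by (simp add: r_def)
  have "top1 p * snd (fst p) - top2 p * fst (fst p) = (fst (fst p) * fst (fst p) + snd (fst p) * snd (fst p)) / r"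
    unfolding top1_def top2_def r_def[symmetric] by (simp add: algebra_simps add_divide_distrib)
  also have "\<dots> = r / r" by (simp only: r_def power2_eq_square)
  also have "\<dots> = 1" using \<open>r > 0\<close> by simp
  finally show ?thesis .
qed

lemma top_inner:
  assumes "fst p \<noteq> 0"
  shows "top1 p * fst (fst p) + top2 p * snd (fst p) = snd p * ((fst (fst p))\<^sup>2 + (snd (fst p))\<^sup>2)"
  using rsq_pos[OF assms] by (simp add: top1_def top2_def field_simps power2_eq_square)

lemma open_fst_nonzero: "open {p :: (real \<times> real) \<times> real. fst p \<noteq> 0}"
  by (intro open_Collect_neq continuous_intros)

lemma open_strictly_reduced: "open strictly_reduced"
proof -
  let ?D = "{p :: (real \<times> real) \<times> real. fst p \<noteq> 0}"
  have c: "continuous_on ?D top1" "continuous_on ?D top2" by (rule top_continuous_on; simp)+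
  have *: "open {p \<in> ?D. f p < g p}" if "continuous_on ?D f" "continuous_on ?D g" for f g :: "_ \<Rightarrow> real"
  proof -
    have "open (?D \<inter> (\<lambda>p. g p - f p) -` {0<..})"
      using that by (intro continuous_open_preimage continuous_intros open_fst_nonzero) auto
    moreover have "?D \<inter> (\<lambda>p. g p - f p) -` {0<..} = {p \<in> ?D. f p < g p}" by auto
    ultimately show ?thesis by simp
  qed
  have "strictly_reduced = {p \<in> ?D. (top1 p)\<^sup>2 + (fst (fst p))\<^sup>2 < (top2 p)\<^sup>2 + (snd (fst p))\<^sup>2} \<inter>
     {p \<in> ?D. 2 * \<bar>top1 p * top2 p + fst (fst p) * snd (fst p)\<bar> < (top1 p)\<^sup>2 + (fst (fst p))\<^sup>2}"
    by (auto simp: strictly_reduced_def)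
  also have "open \<dots>" by (intro open_Int * continuous_intros c)
  finally show ?thesis .
qed

text \<open>Reduction bounds the product a b of the squared column lengths, so a lower bound for a
  bounds the second column. The delicate point is to keep y away from 0, where \<open>top1\<close>
  and \<open>top2\<close> are not continuous; this also bounds t.\<close>

lemma compact_weakly_reduced_thick:
  assumes "\<epsilon> > 0"
  shows "compact {p \<in> weakly_reduced. \<epsilon>\<^sup>2 \<le> (top1 p)\<^sup>2 + (fst (fst p))\<^sup>2}" (is "compact ?K")
proof -
  \<comment> \<open>a b = 1 + e^2 with 4 e^2 <= a^2 <= a b gives a b <= 2, hence b <= 2/epsilon^2.
    In the next line, \<open>\<delta>\<close> comes from 1 <= |x|^2 |y|^2 and |x|^2 <= a + b <= 2 M,
    where x and y are the rows.\<close>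
  define M where "M = 2 / \<epsilon>\<^sup>2"
  define \<delta> where "\<delta> = 1 / (2 * M)"
  define D where "D = {p :: (real \<times> real) \<times> real. \<delta> \<le> (fst (fst p))\<^sup>2 + (snd (fst p))\<^sup>2}"
  have M: "M > 0" using assms by (simp add: M_def)
  have \<delta>: "\<delta> > 0" using M by (simp add: \<delta>_def)
  define R where "R = M + 1 + M / \<delta>"
  have bounds: "p \<in> D \<and> p \<in> ({-R..R} \<times> {-R..R}) \<times> {-R..R}" if p: "p \<in> ?K" for p
  proof -
    define x1 x2 y1 y2 where xy: "x1 = top1 p" "x2 = top2 p" "y1 = fst (fst p)" "y2 = snd (fst p)"
    define a b e r where abe: "a = x1\<^sup>2 + y1\<^sup>2" "b = x2\<^sup>2 + y2\<^sup>2" "e = x1 * x2 + y1 * y2" "r = y1\<^sup>2 + y2\<^sup>2"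
    have nz: "fst p \<noteq> 0" and red: "a \<le> b" "2 * \<bar>e\<bar> \<le> a" "\<epsilon>\<^sup>2 \<le> a"
      using p by (auto simp: weakly_reduced_def xy abe)
    have det: "x1 * y2 - x2 * y1 = 1" using top_det[OF nz] by (simp add: xy)
    have a0: "a > 0" using red(3) assms by (meson less_le_trans zero_less_power)
    have "a * b - e\<^sup>2 = (x1 * y2 - x2 * y1)\<^sup>2" by (simp add: abe power2_eq_square algebra_simps)
    then have "a * b = 1 + e\<^sup>2" using det by simp
    moreover have "4 * e\<^sup>2 \<le> a\<^sup>2"
      using power_mono[OF red(2), of 2] by (simp add: power_mult_distrib)
    moreover have "a\<^sup>2 \<le> a * b" using red(1) a0 by (simp add: power2_eq_square)
    ultimately have "a * b \<le> 2" by linarith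
    moreover have "\<epsilon>\<^sup>2 * b \<le> a * b" using red a0 by (intro mult_right_mono) auto
    ultimately have bM: "b \<le> M" using assms by (simp add: M_def field_simps)
    \<comment> \<open>Lagrange's identity for the rows; the determinant part equals 1.\<close>
    have "(x1 * y2 - x2 * y1)\<^sup>2 + (x1 * y1 + x2 * y2)\<^sup>2 = (x1\<^sup>2 + x2\<^sup>2) * r"
      by (simp add: abe power2_eq_square algebra_simps)
    then have "1 \<le> (x1\<^sup>2 + x2\<^sup>2) * r" using zero_le_power2[of "x1 * y1 + x2 * y2"] unfolding det by (simp only: power_one)
    also have "\<dots> \<le> (2 * M) * r"
    proof (rule mult_right_mono)
      show "x1\<^sup>2 + x2\<^sup>2 \<le> 2 * M" using red(1) bM zero_le_power2[of y1] zero_le_power2[of y2] unfolding abe by linarith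
    qed (simp add: abe)
    finally have r: "\<delta> \<le> r" using M by (simp add: \<delta>_def field_simps)
    have "p \<in> D" using r by (simp add: D_def abe xy)
    have sq: "\<bar>z\<bar> \<le> M + 1" if "z\<^sup>2 \<le> M" for z :: real
    proof (rule ccontr)
      assume "\<not> ?thesis"
      then have "\<bar>z\<bar> * \<bar>z\<bar> > (M + 1) * 1" using M by (intro mult_strict_mono) auto
      then show False using that by (simp add: power2_eq_square flip: abs_mult)
    qed
    have "y1\<^sup>2 \<le> M" "y2\<^sup>2 \<le> M" using red(1) bM zero_le_power2[of x1] zero_le_power2[of x2] unfolding abe by linarith+
    then have y: "\<bar>y1\<bar> \<le> M + 1" "\<bar>y2\<bar> \<le> M + 1" using sq by auto
    have "\<bar>snd p\<bar> * r = \<bar>x1 * y1 + x2 * y2\<bar>" using top_inner[OF nz] r \<delta> by (simp add: xy abe abs_mult)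
    also have "\<dots> \<le> M"
    proof -
      have s: "2 * \<bar>x * y\<bar> \<le> x\<^sup>2 + y\<^sup>2" for x y :: real
        using sum_squares_bound[of "\<bar>x\<bar>" "\<bar>y\<bar>"] by (simp add: abs_mult)
      have "2 * \<bar>x1 * y1 + x2 * y2\<bar> \<le> 2 * (\<bar>x1 * y1\<bar> + \<bar>x2 * y2\<bar>)"
        by (rule mult_left_mono[OF abs_triangle_ineq]) simp
      also have "\<dots> \<le> a + b"
        using add_mono[OF s[of x1 y1] s[of x2 y2]] unfolding abe by (simp only: distrib_left)
      finally have "2 * \<bar>x1 * y1 + x2 * y2\<bar> \<le> a + b" .
      moreover have "z \<le> M" if "2 * z \<le> a + b" for z using that red(1) bM by linarith
      ultimately show ?thesis by blast
    qed
    finally have "\<bar>snd p\<bar> * \<delta> \<le> M" using mult_left_mono[OF r, of "\<bar>snd p\<bar>"] by linarith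
    then have t: "\<bar>snd p\<bar> \<le> M / \<delta>" using \<delta> by (simp add: field_simps)
    have MR: "M + 1 \<le> R" "M / \<delta> \<le> R" using M \<delta> by (auto simp: R_def)
    have "\<bar>y1\<bar> \<le> R" "\<bar>y2\<bar> \<le> R" "\<bar>snd p\<bar> \<le> R" using y t MR by linarith+
    then have "p \<in> ({-R..R} \<times> {-R..R}) \<times> {-R..R}" by (cases p) (auto simp: xy abs_le_iff)
    with \<open>p \<in> D\<close> show ?thesis by simp
  qed
  have Dnz: "fst p \<noteq> 0" if "p \<in> D" for p using that \<delta> by (auto simp: D_def)
  have c: "continuous_on D top1" "continuous_on D top2" by (rule top_continuous_on, erule Dnz)+
  have clD: "closed D" unfolding D_def by (intro closed_Collect_le continuous_intros)
  have "?K = {p \<in> D. (top1 p)\<^sup>2 + (fst (fst p))\<^sup>2 \<le> (top2 p)\<^sup>2 + (snd (fst p))\<^sup>2} \<inter>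
     {p \<in> D. 2 * \<bar>top1 p * top2 p + fst (fst p) * snd (fst p)\<bar> \<le> (top1 p)\<^sup>2 + (fst (fst p))\<^sup>2} \<inter>
     {p \<in> D. \<epsilon>\<^sup>2 \<le> (top1 p)\<^sup>2 + (fst (fst p))\<^sup>2}"
    using bounds Dnz by (auto simp: weakly_reduced_def)
  also have "closed \<dots>" by (intro closed_Int continuous_on_closed_Collect_le continuous_intros c clD)
  finally have "closed ?K" .
  moreover have "compact (({-R..R} \<times> {-R..R}) \<times> {-R..R})" by (intro compact_Times compact_Icc)
  ultimately have "compact ((({-R..R} \<times> {-R..R}) \<times> {-R..R}) \<inter> ?K)" by (rule compact_Int_closed[rotated])
  moreover have "(({-R..R} \<times> {-R..R}) \<times> {-R..R}) \<inter> ?K = ?K" using bounds by blast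
  ultimately show ?thesis by simp
qed

text \<open>Fubini in the direction t, in which all boundaries that occur have countable slices once
  finitely many lines of y are discarded.\<close>

lemma null_set_of_countable_slices:
  fixes S :: "((real \<times> real) \<times> real) set"
  assumes S: "S \<in> sets borel" and Z: "Z \<in> null_sets lborel"
    and cnt: "\<And>y. y \<notin> Z \<Longrightarrow> countable {t. (y, t) \<in> S}"
  shows "S \<in> null_sets lborel"
proof (rule null_setsI)
  have "emeasure lborel S = emeasure (lborel \<Otimes>\<^sub>M lborel) S" by (simp add: lborel_prod)
  also have "\<dots> = (\<integral>\<^sup>+y. emeasure lborel (Pair y -` S) \<partial>lborel)"
    using S by (intro lborel.emeasure_pair_measure_alt) (subst lborel_prod, simp)
  also have "\<dots> = (\<integral>\<^sup>+y. 0 \<partial>(lborel :: (real \<times> real) measure))"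
  proof (rule nn_integral_cong_AE)
    show "AE y in lborel. emeasure lborel (Pair y -` S) = 0"
      using AE_not_in[OF Z]
    proof eventually_elim
      case (elim y)
      then show ?case using emeasure_lborel_countable[OF cnt[of y]] by (simp add: vimage_def)
    qed
  qed
  finally show "emeasure lborel S = 0" by simp
qed (use S in simp)

lemma line_null_set:
  fixes a b c :: real
  assumes "a \<noteq> 0 \<or> b \<noteq> 0"
  shows "{y. a * fst y + b * snd y = c} \<in> null_sets lborel"
proof -
  have "closed {y :: real \<times> real. a * fst y + b * snd y = c}" by (intro closed_Collect_eq continuous_intros)
  moreover have "negligible {y. (a, b) \<bullet> y = c}" using assms by (intro negligible_hyperplane) (auto simp: zero_prod_def)
  then have "negligible {y. a * fst y + b * snd y = c}" by (simp add: inner_prod_def)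
  ultimately show ?thesis by (simp add: negligible_iff_null_sets null_sets_completion_iff borel_closed)
qed

section \<open>Measurability and boundary of the reduction domain\<close>

lemma top_measurable [measurable]:
  "top1 \<in> borel_measurable borel" "top2 \<in> borel_measurable borel"
  "(\<lambda>p :: (real \<times> real) \<times> real. fst (fst p)) \<in> borel_measurable borel"
  "(\<lambda>p :: (real \<times> real) \<times> real. snd (fst p)) \<in> borel_measurable borel"
proof -
  show [measurable]: "(\<lambda>p :: (real \<times> real) \<times> real. fst (fst p)) \<in> borel_measurable borel"
    "(\<lambda>p :: (real \<times> real) \<times> real. snd (fst p)) \<in> borel_measurable borel"
    by (intro borel_measurable_continuous_onI continuous_intros)+
  have [measurable]: "(\<lambda>p :: (real \<times> real) \<times> real. snd p) \<in> borel_measurable borel"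
    by (intro borel_measurable_continuous_onI continuous_intros)
  show "top1 \<in> borel_measurable borel" "top2 \<in> borel_measurable borel"
    unfolding top1_def[abs_def] top2_def[abs_def] by measurable
qed

lemma weakly_reduced_borel [measurable]: "weakly_reduced \<in> sets borel"
proof -
  have [measurable]: "{p :: (real \<times> real) \<times> real. fst p \<noteq> 0} \<in> sets borel" using open_fst_nonzero by simp
  have "{p \<in> space borel. (top1 p)\<^sup>2 + (fst (fst p))\<^sup>2 \<le> (top2 p)\<^sup>2 + (snd (fst p))\<^sup>2 \<and>
     2 * \<bar>top1 p * top2 p + fst (fst p) * snd (fst p)\<bar> \<le> (top1 p)\<^sup>2 + (fst (fst p))\<^sup>2} \<in> sets borel"
    by measurable
  then have "{p :: (real \<times> real) \<times> real. fst p \<noteq> 0} \<inter> {p \<in> space borel. (top1 p)\<^sup>2 + (fst (fst p))\<^sup>2 \<le> (top2 p)\<^sup>2 + (snd (fst p))\<^sup>2 \<and>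
     2 * \<bar>top1 p * top2 p + fst (fst p) * snd (fst p)\<bar> \<le> (top1 p)\<^sup>2 + (fst (fst p))\<^sup>2} \<in> sets borel" by simp
  then show ?thesis by (simp add: weakly_reduced_def Collect_conj_eq)
qed

lemma strictly_reduced_subset: "strictly_reduced \<subseteq> weakly_reduced"
  by (auto simp: strictly_reduced_def weakly_reduced_def)

lemma countable_quadratic_roots:
  fixes a b c :: real
  assumes "a \<noteq> 0"
  shows "countable {t. a * t\<^sup>2 + b * t + c = 0}"
proof -
  have "finite {t. poly [:c, b, a:] t = 0}" using assms by (intro poly_roots_finite) auto
  moreover have "{t. poly [:c, b, a:] t = 0} = {t. a * t\<^sup>2 + b * t + c = 0}"
    by (auto simp: power2_eq_square algebra_simps)
  ultimately show ?thesis by (simp add: countable_finite)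
qed

text \<open>For fixed y the entries of the matrix are affine in t, so each of the three possible
  equalities on the boundary is a quadratic equation in t.\<close>

lemma reduced_boundary_null: "weakly_reduced - strictly_reduced \<in> null_sets lborel"
proof (rule null_set_of_countable_slices)
  show "weakly_reduced - strictly_reduced \<in> sets borel" using open_strictly_reduced by simp
  let ?l = "\<lambda>a b. {y :: real \<times> real. a * fst y + b * snd y = 0}"
  \<comment> \<open>The lines on which a leading coefficient vanishes: y1^2 - y2^2 for equal
    lengths, and 2 y1 y2 - y1^2 or -2 y1 y2 - y1^2 for the inner product.\<close>
  define Z where "Z = ?l 1 1 \<union> ?l 1 (-1) \<union> ?l 1 0 \<union> ?l 1 2 \<union> ?l 1 (-2)"
  show "Z \<in> null_sets lborel" unfolding Z_def by (intro null_sets.Un line_null_set) auto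
  fix y :: "real \<times> real" assume y: "y \<notin> Z"
  obtain y1 y2 where yy: "y = (y1, y2)" by fastforce
  define u where "u = y2 / (y1\<^sup>2 + y2\<^sup>2)"
  define w where "w = y1 / (y1\<^sup>2 + y2\<^sup>2)"
  have nz: "y1 + y2 \<noteq> 0" "y1 - y2 \<noteq> 0" "y1 \<noteq> 0" "y1 + 2 * y2 \<noteq> 0" "y1 - 2 * y2 \<noteq> 0"
    using y by (auto simp: Z_def yy)
  have t: "top1 (y, t) = u + t * y1" "top2 (y, t) = t * y2 - w" for t
    by (simp_all add: top1_def top2_def yy u_def w_def)
  let ?A = "{t. (y1\<^sup>2 - y2\<^sup>2) * t\<^sup>2 + (2 * u * y1 + 2 * w * y2) * t + (u\<^sup>2 + y1\<^sup>2 - w\<^sup>2 - y2\<^sup>2) = 0}"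
  let ?B = "\<lambda>s. {t. (s * 2 * y1 * y2 - y1\<^sup>2) * t\<^sup>2 + (s * 2 * (u * y2 - y1 * w) - 2 * u * y1) * t
        + (s * 2 * (y1 * y2 - u * w) - u\<^sup>2 - y1\<^sup>2) = 0}"
  have "y1\<^sup>2 - y2\<^sup>2 \<noteq> 0" using nz by (simp add: power2_eq_square square_diff_square_factored)
  then have cA: "countable ?A" by (rule countable_quadratic_roots)
  have nzs: "s * 2 * y1 * y2 - y1\<^sup>2 \<noteq> 0" if "s = 1 \<or> s = -1" for s
  proof -
    have "s * 2 * y1 * y2 - y1\<^sup>2 = y1 * (s * 2 * y2 - y1)" by (simp add: power2_eq_square algebra_simps)
    then show ?thesis using nz that by auto
  qed
  have cB: "countable (?B 1)" "countable (?B (-1))" by (rule countable_quadratic_roots[OF nzs]; simp)+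
  have sub: "{t. (y, t) \<in> weakly_reduced - strictly_reduced} \<subseteq> ?A \<union> ?B 1 \<union> ?B (-1)"
  proof
    fix t assume "t \<in> {t. (y, t) \<in> weakly_reduced - strictly_reduced}"
    then have "(top1 (y, t))\<^sup>2 + y1\<^sup>2 = (top2 (y, t))\<^sup>2 + y2\<^sup>2 \<or> 2 * (top1 (y, t) * top2 (y, t) + y1 * y2) = (top1 (y, t))\<^sup>2 + y1\<^sup>2
      \<or> - 2 * (top1 (y, t) * top2 (y, t) + y1 * y2) = (top1 (y, t))\<^sup>2 + y1\<^sup>2"
      by (auto simp: weakly_reduced_def strictly_reduced_def yy abs_if split: if_splits)
    moreover have eqA: "(y1\<^sup>2 - y2\<^sup>2) * t\<^sup>2 + (2 * u * y1 + 2 * w * y2) * t + (u\<^sup>2 + y1\<^sup>2 - w\<^sup>2 - y2\<^sup>2) =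
       (top1 (y, t))\<^sup>2 + y1\<^sup>2 - ((top2 (y, t))\<^sup>2 + y2\<^sup>2)"
      unfolding t by (simp add: power2_eq_square algebra_simps)
    moreover have eqB: "(s * 2 * y1 * y2 - y1\<^sup>2) * t\<^sup>2 + (s * 2 * (u * y2 - y1 * w) - 2 * u * y1) * t
        + (s * 2 * (y1 * y2 - u * w) - u\<^sup>2 - y1\<^sup>2) =
         s * 2 * (top1 (y, t) * top2 (y, t) + y1 * y2) - ((top1 (y, t))\<^sup>2 + y1\<^sup>2)" for s
      unfolding t by (simp add: power2_eq_square algebra_simps)
    ultimately have "t \<in> ?A \<or> t \<in> ?B 1 \<or> t \<in> ?B (-1)"
      unfolding mem_Collect_eq eqA eqB by linarith
    then show "t \<in> ?A \<union> ?B 1 \<union> ?B (-1)" by blast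
  qed
  show "countable {t. (y, t) \<in> weakly_reduced - strictly_reduced}"
    by (rule countable_subset[OF sub]) (use cA cB in auto)
qed

section \<open>Total mass of the reduced bases\<close>

text \<open>The unfolded integrand counts bases in U: at most two for alpha in X, none
  otherwise.\<close>

lemma horo_mass_le_prob:
  assumes U: "U \<subseteq> strictly_reduced" "U \<in> sets borel" and N: "N \<ge> 1"
    and X: "X \<in> sets borel" "X \<subseteq> {0..<1}"
    and PX: "\<And>\<alpha> i. \<alpha> \<in> {0..<1} \<Longrightarrow> i \<in> horo_index \<Longrightarrow> horo_point N \<alpha> i \<in> U \<Longrightarrow> \<alpha> \<in> X"
  shows "horo_mass N U \<le> ennreal (2 * measure lborel X)"
proof -
  have "horo_mass N U = (\<integral>\<^sup>+\<alpha>. (\<integral>\<^sup>+i. indicator U (horo_point N \<alpha> i) * indicator {0..<1} \<alpha> \<partial>count_space horo_index) \<partial>lborel)"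
    by (rule horo_mass_unfold[OF U(2) N, symmetric])
  also have "\<dots> \<le> (\<integral>\<^sup>+\<alpha>. 2 * indicator X \<alpha> \<partial>lborel)"
  proof (rule nn_integral_mono)
    fix \<alpha> :: real
    let ?J = "{i \<in> horo_index. horo_point N \<alpha> i \<in> strictly_reduced}"
    show "(\<integral>\<^sup>+i. indicator U (horo_point N \<alpha> i) * indicator {0..<1} \<alpha> \<partial>count_space horo_index) \<le> 2 * (indicator X \<alpha> :: ennreal)"
    proof (cases "\<alpha> \<in> X")
      case True
      have "(\<integral>\<^sup>+i. indicator U (horo_point N \<alpha> i) * indicator {0..<1} \<alpha> \<partial>count_space horo_index) \<le>
         (\<integral>\<^sup>+i. indicator ?J i \<partial>count_space horo_index)"
        using U(1) by (intro nn_integral_mono) (auto simp: indicator_def)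
      also have "\<dots> = emeasure (count_space horo_index) ?J" by (rule nn_integral_indicator) auto
      also have "\<dots> = of_nat (card ?J)"
        using card_strictly_reduced_horo_points[OF N] by (intro emeasure_count_space_finite) auto
      also have "\<dots> \<le> of_nat 2"
        using card_strictly_reduced_horo_points[OF N, of \<alpha>] by (intro of_nat_mono) auto
      finally show ?thesis using True by simp
    next
      case False
      have "(\<integral>\<^sup>+i. indicator U (horo_point N \<alpha> i) * indicator {0..<1} \<alpha> \<partial>count_space horo_index) =
        (\<integral>\<^sup>+i. 0 \<partial>count_space horo_index)"
        using False PX by (intro nn_integral_cong) (auto simp: indicator_def)
      then show ?thesis by simp
    qed
  qed
  also have "\<dots> = 2 * emeasure lborel X" using X by (simp add: nn_integral_cmult_indicator)
  also have "\<dots> = ennreal (2 * measure lborel X)"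
  proof -
    have "emeasure lborel X \<le> emeasure lborel {0..<1::real}" using X by (intro emeasure_mono) auto
    then have "emeasure lborel X \<noteq> \<infinity>" by (auto simp: top_unique)
    then have "emeasure lborel X = ennreal (measure lborel X)" by (simp add: emeasure_eq_ennreal_measure)
    then show ?thesis by (simp add: ennreal_mult)
  qed
  finally show ?thesis .
qed

text \<open>Outside the exceptional set T there is no vector shorter than epsilon, so both weakly
  reduced bases survive the cutoff on the first column.\<close>

lemma horo_mass_weakly_reduced_ge:
  fixes \<epsilon> :: real
  assumes N: "N \<ge> 1" and eps: "0 < \<epsilon>" "\<epsilon> < 1"
  shows "ennreal (2 * (1 - 4 * \<epsilon>\<^sup>2)) \<le> horo_mass N {p \<in> weakly_reduced. \<epsilon>\<^sup>2 \<le> (top1 p)\<^sup>2 + (fst (fst p))\<^sup>2}"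
proof -
  let ?K = "{p \<in> weakly_reduced. \<epsilon>\<^sup>2 \<le> (top1 p)\<^sup>2 + (fst (fst p))\<^sup>2}"
  obtain T where T: "T \<in> sets borel" "emeasure lborel T \<le> ennreal (4 * \<epsilon>\<^sup>2)"
    "\<And>(\<alpha>::real) u v. \<alpha> \<in> {0..<1} \<Longrightarrow> u \<noteq> 0 \<or> v \<noteq> 0 \<Longrightarrow> qform N (N * \<alpha>) 0 (1 / N) u v < \<epsilon>\<^sup>2 \<Longrightarrow> \<alpha> \<in> T"
    using short_vectors_cover[OF N eps] by metis
  have K: "?K \<in> sets borel" using compact_weakly_reduced_thick[OF eps(1)] by (rule borel_compact)
  have "ennreal (2 * (1 - 4 * \<epsilon>\<^sup>2)) \<le> 2 * emeasure lborel ({0..<1} - T)"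
  proof -
    have "emeasure lborel {0..<1::real} \<le> emeasure lborel (({0..<1} - T) \<union> T)"
      using T(1) by (intro emeasure_mono) auto
    also have "\<dots> \<le> emeasure lborel ({0..<1} - T) + emeasure lborel T"
      using T(1) by (intro emeasure_subadditive) auto
    also have "\<dots> \<le> emeasure lborel ({0..<1} - T) + ennreal (4 * \<epsilon>\<^sup>2)" using T(2) by (rule add_left_mono)
    finally have 1: "1 \<le> emeasure lborel ({0..<1} - T) + ennreal (4 * \<epsilon>\<^sup>2)" by simp
    show ?thesis
    proof (cases "emeasure lborel ({0..<1} - T)")
      case (real x)
      then have "ennreal 1 \<le> ennreal (x + 4 * \<epsilon>\<^sup>2)" using 1 by (simp add: ennreal_plus)
      then have "1 \<le> x + 4 * \<epsilon>\<^sup>2" using real by (subst (asm) ennreal_le_iff) auto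
      then have "ennreal (2 * (1 - 4 * \<epsilon>\<^sup>2)) \<le> ennreal (2 * x)" by (intro ennreal_leI) auto
      then show ?thesis using real by (simp add: ennreal_mult)
    qed (simp add: ennreal_mult_top)
  qed
  also have "\<dots> = (\<integral>\<^sup>+\<alpha>. 2 * indicator ({0..<1} - T) \<alpha> \<partial>lborel)"
    using T(1) by (simp add: nn_integral_cmult_indicator)
  also have "\<dots> \<le> (\<integral>\<^sup>+\<alpha>. (\<integral>\<^sup>+i. indicator ?K (horo_point N \<alpha> i) * indicator {0..<1} \<alpha> \<partial>count_space horo_index) \<partial>lborel)"
  proof (rule nn_integral_mono)
    fix \<alpha> :: real
    show "2 * indicator ({0..<1} - T) \<alpha> \<le> (\<integral>\<^sup>+i. indicator ?K (horo_point N \<alpha> i) * indicator {0..<1} \<alpha> \<partial>count_space horo_index)"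
    proof (cases "\<alpha> \<in> {0..<1} - T")
      case True
      obtain i j where ij: "i \<in> horo_index" "j \<in> horo_index" "i \<noteq> j"
        "horo_point N \<alpha> i \<in> weakly_reduced" "horo_point N \<alpha> j \<in> weakly_reduced"
        using weakly_reduced_horo_points[OF N] by metis
      have inK: "horo_point N \<alpha> k \<in> ?K" if k: "k \<in> horo_index" "horo_point N \<alpha> k \<in> weakly_reduced" for k
      proof -
        have "fst (top_row k) \<noteq> 0 \<or> fst (fst k) \<noteq> 0" using top_row_det[OF k(1)] by auto
        then have "\<not> qform N (N * \<alpha>) 0 (1 / N) (fst (top_row k)) (fst (fst k)) < \<epsilon>\<^sup>2"
          using T(3)[of \<alpha>] True by blast
        then show ?thesis using k by (simp add: horo_point_forms[OF k(1) N])
      qed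
      have "2 = (\<Sum>k\<in>{i, j}. 1 :: ennreal)" using ij(3) by simp
      also have "\<dots> = (\<integral>\<^sup>+k. indicator {i, j} k \<partial>count_space horo_index)"
        using ij by (subst nn_integral_indicator) auto
      also have "\<dots> \<le> (\<integral>\<^sup>+k. indicator ?K (horo_point N \<alpha> k) * indicator {0..<1} \<alpha> \<partial>count_space horo_index)"
      proof (rule nn_integral_mono)
        fix k
        show "indicator {i, j} k \<le> (indicator ?K (horo_point N \<alpha> k) * indicator {0..<1} \<alpha> :: ennreal)"
          using inK[of i] inK[of j] ij True by (auto simp: indicator_def)
      qed
      finally show ?thesis using True by simp
    qed simp
  qed
  also have "\<dots> = horo_mass N ?K" by (rule horo_mass_unfold[OF K N])
  finally show ?thesis .
qed

text \<open>At one sufficiently large N the mass of U is almost the density times its volume, but it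
  never exceeds 2.\<close>

lemma measure_strictly_reduced_bounded:
  assumes U: "U \<subseteq> strictly_reduced" "open U" "bounded U"
  shows "coprime_density * measure lborel U \<le> 2"
proof (rule field_le_epsilon)
  fix e :: real assume e: "e > 0"
  have "\<forall>\<^sub>F N in sequentially. ennreal (coprime_density * measure lborel U - e) \<le> horo_mass N U \<and> N \<ge> 1"
    using U e by (intro eventually_conj horo_mass_open_ge eventually_ge_at_top) auto
  then obtain N where N: "ennreal (coprime_density * measure lborel U - e) \<le> horo_mass N U" "N \<ge> 1"
    by (auto dest: eventually_happens'[rotated])
  have "horo_mass N U \<le> ennreal (2 * measure lborel {0..<1::real})"
    using U N by (intro horo_mass_le_prob) auto
  with N(1) have "ennreal (coprime_density * measure lborel U - e) \<le> ennreal 2" by simp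
  then have "coprime_density * measure lborel U - e \<le> 2" by (subst (asm) ennreal_le_iff) auto
  then show "coprime_density * measure lborel U \<le> 2 + e" by simp
qed

lemma weakly_reduced_thick_measure:
  assumes eps: "0 < \<epsilon>" "\<epsilon> < 1"
  shows "2 * (1 - 4 * \<epsilon>\<^sup>2) \<le> coprime_density * measure lborel {p \<in> weakly_reduced. \<epsilon>\<^sup>2 \<le> (top1 p)\<^sup>2 + (fst (fst p))\<^sup>2}"
    (is "_ \<le> _ * measure lborel ?K")
proof (rule field_le_epsilon)
  fix e :: real assume e: "e > 0"
  have "\<forall>\<^sub>F N in sequentially. horo_mass N ?K \<le> ennreal (coprime_density * measure lborel ?K + e) \<and> N \<ge> 1"
    using e eps by (intro eventually_conj horo_mass_compact_le compact_weakly_reduced_thick eventually_ge_at_top)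
  then obtain N where N: "horo_mass N ?K \<le> ennreal (coprime_density * measure lborel ?K + e)" "N \<ge> 1"
    by (auto dest: eventually_happens'[rotated])
  have "ennreal (2 * (1 - 4 * \<epsilon>\<^sup>2)) \<le> ennreal (coprime_density * measure lborel ?K + e)"
    using horo_mass_weakly_reduced_ge[OF N(2) eps] N(1) by (rule order_trans)
  moreover have "0 \<le> coprime_density * measure lborel ?K + e" using e coprime_density_nonneg by simp
  ultimately show "2 * (1 - 4 * \<epsilon>\<^sup>2) \<le> coprime_density * measure lborel ?K + e"
    by (simp add: ennreal_le_iff)
qed

text \<open>Positivity is read off from the absence of escape of mass: at epsilon = 1/4 the lower
  bound is 3/2.\<close>

lemma coprime_density_pos: "coprime_density > 0"
proof (rule ccontr)
  assume "\<not> ?thesis"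
  then have "coprime_density = 0" using coprime_density_nonneg by simp
  then show False using weakly_reduced_thick_measure[of "1/4"] by (simp add: power2_eq_square)
qed

lemma measure_ball_exhaust:
  fixes S :: "'a::euclidean_space set"
  assumes "S \<in> sets borel" "emeasure lborel S < \<infinity>"
  shows "(\<lambda>n. measure lborel (S \<inter> ball 0 (real n))) \<longlonglongrightarrow> measure lborel S"
proof -
  have "(\<Union>n. S \<inter> ball 0 (real n)) = S" using reals_Archimedean2 by (auto simp: dist_norm)
  moreover have "(\<lambda>n. measure lborel (S \<inter> ball 0 (real n))) \<longlonglongrightarrow> measure lborel (\<Union>n. S \<inter> ball 0 (real n))"
  proof (rule Lim_measure_incseq)
    show "range (\<lambda>n. S \<inter> ball 0 (real n)) \<subseteq> sets lborel" using assms by auto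
    show "incseq (\<lambda>n. S \<inter> ball 0 (real n))" by (auto simp: incseq_def)
    show "emeasure lborel (\<Union>n. S \<inter> ball 0 (real n)) \<noteq> \<infinity>" using assms calculation by auto
  qed
  ultimately show ?thesis by simp
qed

text \<open>The bound on bounded pieces is uniform, hence passes to the increasing union. It is
  stated for \<open>emeasure\<close> because \<open>measure\<close> would be 0 on a set of infinite
  measure.\<close>

lemma strictly_reduced_finite: "emeasure lborel strictly_reduced < \<infinity>"
proof -
  let ?S = "\<lambda>n. strictly_reduced \<inter> ball 0 (real n)"
  have b: "emeasure lborel (?S n) \<le> ennreal (2 / coprime_density)" for n
  proof -
    have "coprime_density * measure lborel (?S n) \<le> 2"
      using open_strictly_reduced by (intro measure_strictly_reduced_bounded) auto
    then have "measure lborel (?S n) \<le> 2 / coprime_density" using coprime_density_pos by (simp add: field_simps)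
    moreover have "emeasure lborel (?S n) < \<infinity>" by (rule emeasure_bounded_finite) auto
    ultimately show ?thesis by (simp add: emeasure_eq_ennreal_measure less_top ennreal_leI)
  qed
  have "(SUP n. emeasure lborel (?S n)) = emeasure lborel (\<Union>n. ?S n)"
    using open_strictly_reduced by (intro SUP_emeasure_incseq) (auto simp: incseq_def)
  also have "(\<Union>n. ?S n) = strictly_reduced" using reals_Archimedean2 by (auto simp: dist_norm)
  finally have "emeasure lborel strictly_reduced \<le> ennreal (2 / coprime_density)"
    using b by (metis (mono_tags, lifting) SUP_least)
  then show ?thesis by (simp add: le_less_trans)
qed

lemma emeasure_weakly_strictly: "emeasure lborel weakly_reduced = emeasure lborel strictly_reduced"
proof -
  have "weakly_reduced = strictly_reduced \<union> (weakly_reduced - strictly_reduced)"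
    using strictly_reduced_subset by blast
  then show ?thesis
    using emeasure_Un_null_set[OF _ reduced_boundary_null, of strictly_reduced] open_strictly_reduced by simp
qed

lemma strictly_reduced_total_ge: "2 \<le> coprime_density * measure lborel strictly_reduced"
proof (rule field_le_epsilon)
  fix e :: real assume e: "e > 0"
  \<comment> \<open>Chosen so that 8 epsilon^2 <= 8 epsilon <= e.\<close>
  define \<epsilon> where "\<epsilon> = min (1/2) (e / 8)"
  have eps: "0 < \<epsilon>" "\<epsilon> < 1" "8 * \<epsilon> \<le> e" using e by (auto simp: \<epsilon>_def)
  let ?K = "{p \<in> weakly_reduced. \<epsilon>\<^sup>2 \<le> (top1 p)\<^sup>2 + (fst (fst p))\<^sup>2}"
  have "\<epsilon>\<^sup>2 \<le> \<epsilon>" using eps by (simp add: power2_eq_square mult_left_le)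
  then have "8 * \<epsilon>\<^sup>2 \<le> e" using eps(3) by (meson mult_left_mono order_trans zero_le_numeral)
  then have "2 \<le> 2 * (1 - 4 * \<epsilon>\<^sup>2) + e" by (simp add: algebra_simps)
  also have "2 * (1 - 4 * \<epsilon>\<^sup>2) \<le> coprime_density * measure lborel ?K"
    using eps by (intro weakly_reduced_thick_measure)
  also have "measure lborel ?K \<le> measure lborel weakly_reduced"
    using strictly_reduced_finite emeasure_weakly_strictly borel_compact[OF compact_weakly_reduced_thick[OF eps(1)]]
    by (intro measure_mono_fmeasurable fmeasurableI) auto
  also have "measure lborel weakly_reduced = measure lborel strictly_reduced"
    by (simp add: measure_def emeasure_weakly_strictly)
  finally show "2 \<le> coprime_density * measure lborel strictly_reduced + e"
    using coprime_density_nonneg by (simp add: mult_left_mono)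
qed

section \<open>The primitive vector count as a function of the coordinates\<close>

definition coord_image :: "(real \<times> real) \<times> real \<Rightarrow> int \<times> int \<Rightarrow> real \<times> real" where
  "coord_image p w = (top1 p * of_int (fst w) + top2 p * of_int (snd w),
                      fst (fst p) * of_int (fst w) + snd (fst p) * of_int (snd w))"

definition coord_count :: "(real \<times> real) set \<Rightarrow> (real \<times> real) \<times> real \<Rightarrow> nat" where
  "coord_count H p = prim_count H (top1 p) (top2 p) (fst (fst p)) (snd (fst p))"

lemma coord_count_altdef: "coord_count H p = card {w \<in> coprime_pairs. coord_image p w \<in> H}"
  by (simp add: coord_count_def prim_count_def coord_image_def)

lemma tendsto_nhds_of_continuous_on_open:
  fixes f :: "'a::t2_space \<Rightarrow> 'b::topological_space"
  assumes "continuous_on S f" "open S" "x \<in> S"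
  shows "(f \<longlongrightarrow> f x) (nhds x)"
proof -
  have "isCont f x" using assms continuous_on_eq_continuous_at by blast
  then show ?thesis unfolding isCont_def tendsto_at_iff_tendsto_nhds .
qed

text \<open>Near p0 the matrix entries stay below M, and so do those of the inverse, the determinant
  being 1. Hence only the finitely many w in \<open>J\<close> can reach the bounded set H, and for
  each of them membership is stable because its image is off the frontier.\<close>

lemma coord_count_locally_constant:
  assumes H: "compact H" and p0: "fst p0 \<noteq> 0"
    and fr: "\<And>w. w \<in> coprime_pairs \<Longrightarrow> coord_image p0 w \<notin> frontier H"
  shows "\<forall>\<^sub>F p in nhds p0. coord_count H p = coord_count H p0"
proof -
  let ?D = "{p :: (real \<times> real) \<times> real. fst p \<noteq> 0}"
  have c: "continuous_on ?D top1" "continuous_on ?D top2" by (rule top_continuous_on; simp)+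
  have l1: "(top1 \<longlongrightarrow> top1 p0) (nhds p0)" and l2: "(top2 \<longlongrightarrow> top2 p0) (nhds p0)"
    using c p0 by (auto intro!: tendsto_nhds_of_continuous_on_open[OF _ open_fst_nonzero])
  have l3: "((\<lambda>p. fst (fst p)) \<longlongrightarrow> fst (fst p0)) (nhds p0)" "((\<lambda>p. snd (fst p)) \<longlongrightarrow> snd (fst p0)) (nhds p0)"
    by (rule tendsto_nhds_of_continuous_on_open[OF _ open_UNIV], intro continuous_intros, simp)+
  obtain R where R: "\<And>v. v \<in> H \<Longrightarrow> norm v \<le> R" "R > 0"
    using compact_imp_bounded[OF H] bounded_pos by metis
  \<comment> \<open>The 1 makes the bound strict at p0, so it persists nearby. The bound 2 M R in
    \<open>J\<close> then comes from inverting the matrix on vectors of norm at most R.\<close>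
  define M where "M = \<bar>top1 p0\<bar> + \<bar>top2 p0\<bar> + \<bar>fst (fst p0)\<bar> + \<bar>snd (fst p0)\<bar> + 1"
  have M: "M > 0" by (simp add: M_def)
  have bd: "\<forall>\<^sub>F p in nhds p0. \<bar>f p\<bar> < M" if "(f \<longlongrightarrow> f p0) (nhds p0)" "\<bar>f p0\<bar> < M" for f
    using order_tendstoD(2)[OF tendsto_rabs[OF that(1)] that(2)] .
  define J where "J = {w \<in> coprime_pairs. \<bar>of_int (fst w)\<bar> \<le> 2 * M * R \<and> \<bar>of_int (snd w)\<bar> \<le> 2 * M * R}"
  have finJ: "finite J"
  proof (rule finite_subset)
    show "J \<subseteq> {-\<lfloor>2 * M * R\<rfloor>..\<lfloor>2 * M * R\<rfloor>} \<times> {-\<lfloor>2 * M * R\<rfloor>..\<lfloor>2 * M * R\<rfloor>}"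
      by (auto simp: J_def le_floor_iff abs_le_iff minus_le_iff)
  qed simp
  have lim: "((\<lambda>p. coord_image p w) \<longlongrightarrow> coord_image p0 w) (nhds p0)" for w
    unfolding coord_image_def by (intro tendsto_intros l1 l2 l3)
  have stable: "\<forall>\<^sub>F p in nhds p0. coord_image p w \<in> H \<longleftrightarrow> coord_image p0 w \<in> H" if "w \<in> coprime_pairs" for w
  proof (cases "coord_image p0 w \<in> H")
    case True
    then have "coord_image p0 w \<in> interior H"
      using fr[OF that] closure_subset[of H] by (auto simp: frontier_def)
    then have "\<forall>\<^sub>F p in nhds p0. coord_image p w \<in> interior H"
      using topological_tendstoD[OF lim open_interior] by blast
    then show ?thesis by eventually_elim (use True interior_subset in blast)
  next
    case False
    have "open (- H)" using H compact_imp_closed by blast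
    then have "\<forall>\<^sub>F p in nhds p0. coord_image p w \<in> - H"
      using topological_tendstoD[OF lim] False by blast
    then show ?thesis by eventually_elim (use False in blast)
  qed
  have "\<forall>\<^sub>F p in nhds p0. \<forall>w\<in>J. coord_image p w \<in> H \<longleftrightarrow> coord_image p0 w \<in> H"
    using finJ stable by (intro eventually_ball_finite) (auto simp: J_def)
  moreover have "\<forall>\<^sub>F p in nhds p0. \<bar>top1 p\<bar> < M \<and> \<bar>top2 p\<bar> < M \<and> \<bar>fst (fst p)\<bar> < M \<and> \<bar>snd (fst p)\<bar> < M"
    by (intro eventually_conj bd l1 l2 l3) (auto simp: M_def)
  moreover have "\<forall>\<^sub>F p in nhds p0. p \<in> ?D" using open_fst_nonzero p0 by (auto simp: eventually_nhds)
  ultimately show ?thesis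
  proof eventually_elim
    case (elim p)
    have inJ: "w \<in> J" if w: "w \<in> coprime_pairs" "coord_image q w \<in> H"
      and q: "\<bar>top1 q\<bar> < M \<and> \<bar>top2 q\<bar> < M \<and> \<bar>fst (fst q)\<bar> < M \<and> \<bar>snd (fst q)\<bar> < M" "fst q \<noteq> 0" for q w
    proof -
      define X where "X = top1 q * of_int (fst w) + top2 q * of_int (snd w)"
      define Y where "Y = fst (fst q) * of_int (fst w) + snd (fst q) * of_int (snd w)"
      have "norm (X, Y) \<le> R" using R(1)[OF w(2)] by (simp add: coord_image_def X_def Y_def)
      then have XY: "\<bar>X\<bar> \<le> R" "\<bar>Y\<bar> \<le> R" using norm_fst_le[of X Y] norm_snd_le[of Y X] by auto
      have "snd (fst q) * X - top2 q * Y = (top1 q * snd (fst q) - top2 q * fst (fst q)) * of_int (fst w)"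
        "top1 q * Y - fst (fst q) * X = (top1 q * snd (fst q) - top2 q * fst (fst q)) * of_int (snd w)"
        by (auto simp: X_def Y_def algebra_simps)
      then have W: "of_int (fst w) = snd (fst q) * X - top2 q * Y" "of_int (snd w) = top1 q * Y - fst (fst q) * X"
        using top_det[OF q(2)] by auto
      have e: "\<bar>s * x - t * y\<bar> \<le> 2 * M * R" if "\<bar>s\<bar> < M" "\<bar>t\<bar> < M" "\<bar>x\<bar> \<le> R" "\<bar>y\<bar> \<le> R" for s t x y :: real
      proof -
        have "\<bar>s * x - t * y\<bar> \<le> \<bar>s\<bar> * \<bar>x\<bar> + \<bar>t\<bar> * \<bar>y\<bar>"
          using abs_triangle_ineq4[of "s * x" "t * y"] by (simp add: abs_mult)
        also have "\<dots> \<le> M * R + M * R" using that M R(2) by (intro add_mono mult_mono) auto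
        finally show ?thesis by simp
      qed
      show ?thesis unfolding J_def W using w(1) q XY by (auto intro!: e simp: W)
    qed
    have p0M: "\<bar>top1 p0\<bar> < M \<and> \<bar>top2 p0\<bar> < M \<and> \<bar>fst (fst p0)\<bar> < M \<and> \<bar>snd (fst p0)\<bar> < M" by (auto simp: M_def)
    have "{w \<in> coprime_pairs. coord_image p w \<in> H} = {w \<in> coprime_pairs. coord_image p0 w \<in> H}"
      using elim inJ[of _ p] inJ[of _ p0] p0M p0 by blast
    then show ?case by (simp add: coord_count_altdef)
  qed
qed

text \<open>The frontier is tested on horizontal lines because varying t moves the image of a fixed
  w horizontally. \<open>F\<close> makes room for horizontal edges.\<close>

definition admissible_region :: "(real \<times> real) set \<Rightarrow> bool" where
  "admissible_region H \<longleftrightarrow> compact H \<and> (\<exists>F. finite F \<and> (\<forall>h. h \<notin> F \<longrightarrow> countable {s. (s, h) \<in> frontier H}))"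

lemma coord_image_measurable: "(\<lambda>p. coord_image p w) \<in> borel_measurable borel"
  unfolding coord_image_def by (intro borel_measurable_Pair) measurable

text \<open>For fixed w and y the image has constant height h, the inner product of y and w, and its
  first coordinate is affine in t with slope h. Discarding h = 0 and h in \<open>F\<close>, the
  frontier is hit for countably many t only.\<close>

lemma frontier_hits_null:
  assumes H: "admissible_region H"
  shows "(\<Union>w\<in>coprime_pairs. {p. coord_image p w \<in> frontier H}) \<in> null_sets lborel"
proof (rule null_sets_UN')
  show "countable coprime_pairs" by simp
  fix w assume w: "w \<in> coprime_pairs"
  obtain F where F: "finite F" "\<And>h. h \<notin> F \<Longrightarrow> countable {s. (s, h) \<in> frontier H}"
    using H by (auto simp: admissible_region_def)
  define u v where uv: "u = real_of_int (fst w)" "v = real_of_int (snd w)"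
  have nz: "u \<noteq> 0 \<or> v \<noteq> 0" using w by (auto simp: coprime_pairs_def uv)
  define Z where "Z = (\<Union>h\<in>insert 0 F. {y. u * fst y + v * snd y = h})"
  show "{p. coord_image p w \<in> frontier H} \<in> null_sets lborel"
  proof (rule null_set_of_countable_slices)
    have "(\<lambda>p. coord_image p w) -` frontier H \<inter> space borel \<in> sets borel"
      by (rule measurable_sets[OF coord_image_measurable]) (simp add: borel_closed)
    then show "{p. coord_image p w \<in> frontier H} \<in> sets borel" by (simp add: vimage_def)
    show "Z \<in> null_sets lborel" unfolding Z_def
      using F(1) line_null_set[OF nz] by (intro null_sets_UN') (auto intro: countable_finite)
    fix y assume y: "y \<notin> Z"
    define h where "h = fst y * u + snd y * v"
    have h: "h \<noteq> 0" "h \<notin> F" using y by (auto simp: Z_def h_def algebra_simps)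
    define k where "k = (snd y * u - fst y * v) / ((fst y)\<^sup>2 + (snd y)\<^sup>2)"
    have img: "coord_image (y, t) w = (k + t * h, h)" for t
      by (simp add: coord_image_def top1_def top2_def h_def k_def uv algebra_simps diff_divide_distrib)
    have "countable ((\<lambda>t. k + t * h) ` {t. (k + t * h, h) \<in> frontier H})"
      by (rule countable_subset[OF _ F(2)[OF h(2)]]) auto
    then have "countable {t. (k + t * h, h) \<in> frontier H}"
      by (rule countable_image_inj_on) (use h(1) in \<open>auto simp: inj_on_def\<close>)
    then show "countable {t. (y, t) \<in> {p. coord_image p w \<in> frontier H}}"
      by (simp add: img)
  qed
qed

text \<open>Reduction to sets of naturals: \<open>to_nat\<close> is injective and so preserves
  \<open>card\<close>, including its value 0 on infinite sets.\<close>

lemma measurable_card_countable: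
  fixes S :: "'a \<Rightarrow> 'b::countable set"
  assumes "\<And>i. {x \<in> space M. i \<in> S x} \<in> sets M"
  shows "(\<lambda>x. card (S x)) \<in> measurable M (count_space UNIV)"
proof -
  have eq: "card (S x) = card (to_nat ` S x)" for x by (rule card_image[symmetric]) (auto intro: inj_on_subset[OF inj_to_nat])
  have "{x \<in> space M. n \<in> to_nat ` S x} \<in> sets M" for n
  proof (cases "n \<in> range (to_nat :: 'b \<Rightarrow> nat)")
    case True
    then obtain i :: 'b where "n = to_nat i" by blast
    then have "{x \<in> space M. n \<in> to_nat ` S x} = {x \<in> space M. i \<in> S x}" by auto
    then show ?thesis using assms by simp
  next
    case False
    then have "{x \<in> space M. n \<in> to_nat ` S x} = {}" by auto
    then show ?thesis by (metis sets.empty_sets)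
  qed
  then show ?thesis unfolding eq by (rule measurable_card)
qed

lemma coord_count_borel:
  assumes "closed H"
  shows "{p. coord_count H p = k} \<in> sets borel"
proof -
  have "(\<lambda>p. card {w \<in> coprime_pairs. coord_image p w \<in> H}) \<in> measurable borel (count_space UNIV)"
  proof (rule measurable_card_countable)
    fix w :: "int \<times> int"
    have "(\<lambda>p. coord_image p w) -` H \<inter> space borel \<in> sets borel"
      by (rule measurable_sets[OF coord_image_measurable]) (use assms in \<open>simp add: borel_closed\<close>)
    then show "{p \<in> space borel. w \<in> {w \<in> coprime_pairs. coord_image p w \<in> H}} \<in> sets borel"
      by (cases "w \<in> coprime_pairs") (auto simp: vimage_def)
  qed
  from measurable_sets[OF this, of "{k}"] show ?thesis
    by (simp add: vimage_def coord_count_altdef)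
qed

section \<open>Haar measure in coordinates\<close>

text \<open>The bottom row comes first, matching the coordinates (y, t) and letting Fubini integrate
  over the top row for fixed y.\<close>

definition matrix_of_rows :: "(real \<times> real) \<times> (real \<times> real) \<Rightarrow> real^2^2" where
  "matrix_of_rows z = (\<chi> i j. if i = 1 then (if j = 1 then fst (snd z) else snd (snd z))
                               else (if j = 1 then fst (fst z) else snd (fst z)))"

definition rows_of_matrix :: "real^2^2 \<Rightarrow> (real \<times> real) \<times> (real \<times> real)" where
  "rows_of_matrix g = ((g $ 2 $ 1, g $ 2 $ 2), (g $ 1 $ 1, g $ 1 $ 2))"

lemma rows_of_matrix_of_rows [simp]: "rows_of_matrix (matrix_of_rows z) = z"
  by (simp add: rows_of_matrix_def matrix_of_rows_def)

lemma matrix_of_rows_of_matrix [simp]: "matrix_of_rows (rows_of_matrix g) = g"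
  by (simp add: rows_of_matrix_def matrix_of_rows_def vec_eq_iff forall_2)

lemma continuous_rows_of_matrix: "continuous_on UNIV rows_of_matrix"
  unfolding rows_of_matrix_def[abs_def] by (intro continuous_intros)

lemma continuous_matrix_of_rows: "continuous_on UNIV matrix_of_rows"
  unfolding matrix_of_rows_def[abs_def]
proof (intro continuous_on_vec_lambda)
  fix i j :: 2
  show "continuous_on UNIV (\<lambda>z. if i = 1 then if j = 1 then fst (snd z) else snd (snd z)
          else if j = 1 then fst (fst z) else snd (fst z) :: real)"
    by (cases "i = 1"; cases "j = 1") (simp_all add: continuous_on_fst continuous_on_snd continuous_on_id)
qed

lemma Basis_matrix2:
  "(Basis :: (real^2^2) set) = {axis 1 (axis 1 1), axis 1 (axis 2 1), axis 2 (axis 1 1), axis 2 (axis 2 1)}"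
  by (auto simp: Basis_vec_def UNIV_2)

lemma lborel_matrix_of_rows: "lborel = distr lborel borel matrix_of_rows"
proof (rule lborel_eqI)
  fix l u :: "real^2^2" assume le: "\<And>b. b \<in> Basis \<Longrightarrow> l \<bullet> b \<le> u \<bullet> b"
  have m: "matrix_of_rows \<in> borel_measurable lborel"
    using borel_measurable_continuous_onI[OF continuous_matrix_of_rows] by simp
  have le': "l $ 1 $ 1 \<le> u $ 1 $ 1" "l $ 1 $ 2 \<le> u $ 1 $ 2" "l $ 2 $ 1 \<le> u $ 2 $ 1" "l $ 2 $ 2 \<le> u $ 2 $ 2"
    using le[of "axis 1 (axis 1 1)"] le[of "axis 1 (axis 2 1)"] le[of "axis 2 (axis 1 1)"] le[of "axis 2 (axis 2 1)"]
    by (simp_all add: Basis_matrix2 inner_axis)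
  have v: "matrix_of_rows -` box l u = ({l$2$1<..<u$2$1} \<times> {l$2$2<..<u$2$2}) \<times> ({l$1$1<..<u$1$1} \<times> {l$1$2<..<u$1$2})"
    by (auto simp: box_def Basis_matrix2 inner_axis matrix_of_rows_def)
  have "emeasure (distr lborel borel matrix_of_rows) (box l u) = emeasure lborel (matrix_of_rows -` box l u)"
    using m by (subst emeasure_distr) auto
  also have "\<dots> = ennreal ((u$2$1 - l$2$1) * (u$2$2 - l$2$2) * ((u$1$1 - l$1$1) * (u$1$2 - l$1$2)))"
    unfolding v using le' by (simp add: emeasure_lborel_Times borel_Times ennreal_mult)
  also have "(u$2$1 - l$2$1) * (u$2$2 - l$2$2) * ((u$1$1 - l$1$1) * (u$1$2 - l$1$2)) = (\<Prod>b\<in>Basis. (u - l) \<bullet> b)"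
    by (simp add: Basis_matrix2 axis_eq_axis inner_axis)
  finally show "emeasure (distr lborel borel matrix_of_rows) (box l u) = (\<Prod>b\<in>Basis. (u - l) \<bullet> b)" .
qed simp

definition coord_matrix :: "(real \<times> real) \<times> real \<Rightarrow> real^2^2" where
  "coord_matrix p = matrix_of_rows (fst p, (top1 p, top2 p))"

text \<open>The cone over S with the scaling solved for: s g has determinant s^2, so s is the square
  root of the determinant, division by s restores y, and t is a quotient unaffected by s. In this
  form the set is visibly Borel.\<close>

definition cone_rows :: "((real \<times> real) \<times> real) set \<Rightarrow> ((real \<times> real) \<times> (real \<times> real)) set" where
  "cone_rows S = {z. fst (snd z) * snd (fst z) - snd (snd z) * fst (fst z) \<in> {0<..1} \<and>
     ((fst (fst z) / sqrt (fst (snd z) * snd (fst z) - snd (snd z) * fst (fst z)),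
       snd (fst z) / sqrt (fst (snd z) * snd (fst z) - snd (snd z) * fst (fst z))),
      (fst (snd z) * fst (fst z) + snd (snd z) * snd (fst z)) / ((fst (fst z))\<^sup>2 + (snd (fst z))\<^sup>2)) \<in> S}"

lemma scale_matrix_of_rows:
  "s *\<^sub>R matrix_of_rows ((y1, y2), (x1, x2)) = matrix_of_rows ((s * y1, s * y2), (s * x1, s * x2))"
  by (simp add: matrix_of_rows_def vec_eq_iff)

lemma matrix_of_rows_inject: "matrix_of_rows z = matrix_of_rows z' \<longleftrightarrow> z = z'"
  by (metis rows_of_matrix_of_rows)

lemma vimage_cone:
  assumes S: "\<And>p. p \<in> S \<Longrightarrow> fst p \<noteq> 0"
  shows "matrix_of_rows -` cone (coord_matrix ` S) = cone_rows S"
proof (intro set_eqI iffI)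
  fix z assume "z \<in> matrix_of_rows -` cone (coord_matrix ` S)"
  then obtain s p where s: "0 < s" "s \<le> 1" and p: "p \<in> S" and eq: "matrix_of_rows z = s *\<^sub>R coord_matrix p"
    by (auto simp: cone_def)
  obtain y1 y2 t where pp: "p = ((y1, y2), t)" by (metis prod.exhaust)
  define x1 x2 where x: "x1 = top1 p" "x2 = top2 p"
  have nz: "fst p \<noteq> 0" using S p by blast
  have z: "z = ((s * y1, s * y2), (s * x1, s * x2))"
    using eq by (simp add: coord_matrix_def pp x scale_matrix_of_rows matrix_of_rows_inject)
  have det: "x1 * y2 - x2 * y1 = 1" using top_det[OF nz] by (simp add: x pp)
  define R where "R = y1\<^sup>2 + y2\<^sup>2"
  have inn: "x1 * y1 + x2 * y2 = t * R" using top_inner[OF nz] by (simp add: x pp R_def)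
  have r: "R > 0" using rsq_pos[OF nz] by (simp add: pp R_def)
  have "(s * x1) * (s * y2) - (s * x2) * (s * y1) = s\<^sup>2 * (x1 * y2 - x2 * y1)"
    by (simp add: power2_eq_square algebra_simps)
  then have D: "(s * x1) * (s * y2) - (s * x2) * (s * y1) = s\<^sup>2" using det by simp
  have "(s * x1) * (s * y1) + (s * x2) * (s * y2) = s\<^sup>2 * (x1 * y1 + x2 * y2)"
    "(s * y1)\<^sup>2 + (s * y2)\<^sup>2 = s\<^sup>2 * R"
    by (simp_all add: R_def power2_eq_square algebra_simps)
  then have I: "((s * x1) * (s * y1) + (s * x2) * (s * y2)) / ((s * y1)\<^sup>2 + (s * y2)\<^sup>2) = t"
    using s r by (simp add: inn)
  have "s\<^sup>2 \<le> 1" "s\<^sup>2 > 0" using s by (auto simp: power_le_one)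
  then show "z \<in> cone_rows S" unfolding cone_rows_def z mem_Collect_eq fst_conv snd_conv D I
    using s p by (simp add: pp)
next
  fix z assume z: "z \<in> cone_rows S"
  obtain y1 y2 x1 x2 where zz: "z = ((y1, y2), (x1, x2))" by (metis prod.exhaust)
  define D where "D = x1 * y2 - x2 * y1"
  define s where "s = sqrt D"
  define r where "r = y1\<^sup>2 + y2\<^sup>2"
  define p where "p = ((y1 / s, y2 / s), (x1 * y1 + x2 * y2) / r)"
  have D: "0 < D" "D \<le> 1" and p: "p \<in> S" using z by (auto simp: cone_rows_def zz D_def p_def s_def r_def)
  have s: "0 < s" "s \<le> 1" "s\<^sup>2 = D" using D by (auto simp: s_def)
  have r: "r > 0"
  proof -
    have "y1 \<noteq> 0 \<or> y2 \<noteq> 0" using D(1) by (auto simp: D_def)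
    then show ?thesis by (simp add: r_def sum_power2_gt_zero_iff)
  qed
  have rs: "(y1 / s)\<^sup>2 + (y2 / s)\<^sup>2 = r / D" by (simp add: r_def power_divide s(3) add_divide_distrib)
  have "s * top1 p = s * (y2 / s / (r / D) + (x1 * y1 + x2 * y2) / r * (y1 / s))"
    by (simp add: top1_def p_def rs)
  also have "\<dots> = (y2 * D + (x1 * y1 + x2 * y2) * y1) / r" using s r D by (simp add: field_simps)
  also have "y2 * D + (x1 * y1 + x2 * y2) * y1 = x1 * r" by (simp add: D_def r_def power2_eq_square algebra_simps)
  finally have t1: "s * top1 p = x1" using r by simp
  have "s * top2 p = s * ((x1 * y1 + x2 * y2) / r * (y2 / s) - y1 / s / (r / D))"
    by (simp add: top2_def p_def rs)
  also have "\<dots> = ((x1 * y1 + x2 * y2) * y2 - y1 * D) / r" using s r D by (simp add: field_simps)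
  also have "(x1 * y1 + x2 * y2) * y2 - y1 * D = x2 * r" by (simp add: D_def r_def power2_eq_square algebra_simps)
  finally have t2: "s * top2 p = x2" using r by simp
  have "matrix_of_rows z = s *\<^sub>R coord_matrix p"
    using s t1 t2 by (simp add: zz coord_matrix_def p_def scale_matrix_of_rows)
  then show "z \<in> matrix_of_rows -` cone (coord_matrix ` S)" using s p by (auto simp: cone_def)
qed

section \<open>Volume of the cone by Fubini\<close>

lemma fst_snd_borel_measurable:
  "fst \<in> borel_measurable (borel :: ('a::euclidean_space \<times> 'b::euclidean_space) measure)"
  "snd \<in> borel_measurable (borel :: ('a::euclidean_space \<times> 'b::euclidean_space) measure)"
  by (intro borel_measurable_continuous_onI continuous_intros)+

lemma cone_rows_borel:
  assumes S: "S \<in> sets borel"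
  shows "cone_rows S \<in> sets borel"
proof -
  note [measurable] = fst_snd_borel_measurable S
  have [measurable]: "(\<lambda>z. fst (snd z) * snd (fst z) - snd (snd z) * fst (fst z)) \<in> borel_measurable (borel :: ((real \<times> real) \<times> (real \<times> real)) measure)"
    by (intro borel_measurable_continuous_onI continuous_intros)
  have "{z \<in> space borel. fst (snd z) * snd (fst z) - snd (snd z) * fst (fst z) \<in> {0<..1::real} \<and>
     ((fst (fst z) / sqrt (fst (snd z) * snd (fst z) - snd (snd z) * fst (fst z)),
       snd (fst z) / sqrt (fst (snd z) * snd (fst z) - snd (snd z) * fst (fst z))),
      (fst (snd z) * fst (fst z) + snd (snd z) * snd (fst z)) / ((fst (fst z))\<^sup>2 + (snd (fst z))\<^sup>2)) \<in> S} \<in> sets borel"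
    by measurable
  then show ?thesis by (simp add: cone_rows_def)
qed

text \<open>For a fixed bottom row y, the determinant a and the coordinate b of the top row along y
  are related to the top row by a linear map of determinant 1 or -1.\<close>

lemma nn_integral_rotate_rows:
  fixes g :: "real \<Rightarrow> real \<Rightarrow> ennreal" and y1 y2 :: real
  assumes g: "(\<lambda>(a, b). g a b) \<in> borel_measurable (borel \<Otimes>\<^sub>M borel)" and y2: "y2 \<noteq> 0"
  defines "r \<equiv> y1\<^sup>2 + y2\<^sup>2"
  shows "(\<integral>\<^sup>+x1. (\<integral>\<^sup>+x2. g (x1 * y2 - x2 * y1) ((x1 * y1 + x2 * y2) / r) \<partial>lborel) \<partial>lborel)
       = (\<integral>\<^sup>+b. (\<integral>\<^sup>+a. g a b \<partial>lborel) \<partial>lborel)"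
proof -
  note [measurable] = g
  have g': "(\<lambda>x. g (f x) (h x)) \<in> borel_measurable M" if [measurable]: "f \<in> borel_measurable M" "h \<in> borel_measurable M" for f h and M :: "'z measure"
  proof -
    have "(\<lambda>x. case (f x, h x) of (a, b) \<Rightarrow> g a b) \<in> borel_measurable M" by measurable
    then show ?thesis by simp
  qed
  have r: "r > 0" using y2 by (simp add: r_def sum_power2_gt_zero_iff)
  have "(\<integral>\<^sup>+x2. g (x1 * y2 - x2 * y1) ((x1 * y1 + x2 * y2) / r) \<partial>lborel)
      = ennreal \<bar>r / y2\<bar> * (\<integral>\<^sup>+b. g (r / y2 * (x1 - b * y1)) b \<partial>lborel)" for x1
  proof -
    \<comment> \<open>Substitution in x2, obtained by solving b = (x1 y1 + x2 y2)/r for x2.\<close>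
    have "(\<integral>\<^sup>+x2. g (x1 * y2 - x2 * y1) ((x1 * y1 + x2 * y2) / r) \<partial>lborel) =
      ennreal \<bar>r / y2\<bar> * (\<integral>\<^sup>+b. g (x1 * y2 - (- x1 * y1 / y2 + r / y2 * b) * y1) ((x1 * y1 + (- x1 * y1 / y2 + r / y2 * b) * y2) / r) \<partial>lborel)"
      using r y2 by (intro nn_integral_real_affine g') auto
    also have "(\<lambda>b. g (x1 * y2 - (- x1 * y1 / y2 + r / y2 * b) * y1) ((x1 * y1 + (- x1 * y1 / y2 + r / y2 * b) * y2) / r))
       = (\<lambda>b. g (r / y2 * (x1 - b * y1)) b)"
    proof
      fix b
      have "x1 * y2 - (- x1 * y1 / y2 + r / y2 * b) * y1 = r / y2 * (x1 - b * y1)"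
        using y2 by (simp add: r_def field_simps power2_eq_square)
      moreover have "(x1 * y1 + (- x1 * y1 / y2 + r / y2 * b) * y2) / r = b"
        using y2 r by (simp add: field_simps)
      ultimately show "g (x1 * y2 - (- x1 * y1 / y2 + r / y2 * b) * y1) ((x1 * y1 + (- x1 * y1 / y2 + r / y2 * b) * y2) / r)
         = g (r / y2 * (x1 - b * y1)) b" by simp
    qed
    finally show ?thesis .
  qed
  then have "(\<integral>\<^sup>+x1. (\<integral>\<^sup>+x2. g (x1 * y2 - x2 * y1) ((x1 * y1 + x2 * y2) / r) \<partial>lborel) \<partial>lborel)
     = (\<integral>\<^sup>+x1. ennreal \<bar>r / y2\<bar> * (\<integral>\<^sup>+b. g (r / y2 * (x1 - b * y1)) b \<partial>lborel) \<partial>lborel)" by simp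
  also have "\<dots> = (\<integral>\<^sup>+x1. (\<integral>\<^sup>+b. ennreal \<bar>r / y2\<bar> * g (r / y2 * (x1 - b * y1)) b \<partial>lborel) \<partial>lborel)"
    by (intro nn_integral_cong nn_integral_cmult[symmetric] g') auto
  also have "\<dots> = (\<integral>\<^sup>+b. (\<integral>\<^sup>+x1. ennreal \<bar>r / y2\<bar> * g (r / y2 * (x1 - b * y1)) b \<partial>lborel) \<partial>lborel)"
  proof (rule lborel_pair.Fubini')
    have "(\<lambda>z. ennreal \<bar>r / y2\<bar> * g (r / y2 * (snd z - fst z * y1)) (fst z)) \<in> borel_measurable (lborel \<Otimes>\<^sub>M lborel)"
      by (intro borel_measurable_times_ennreal g') auto
    then show "(\<lambda>(b, x1). ennreal \<bar>r / y2\<bar> * g (r / y2 * (x1 - b * y1)) b) \<in> borel_measurable (lborel \<Otimes>\<^sub>M lborel)"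
      by (simp add: case_prod_unfold)
  qed
  also have "\<dots> = (\<integral>\<^sup>+b. (\<integral>\<^sup>+a. g a b \<partial>lborel) \<partial>lborel)"
  proof (rule nn_integral_cong)
    fix b :: real
    have "(\<integral>\<^sup>+x1. ennreal \<bar>r / y2\<bar> * g (r / y2 * (x1 - b * y1)) b \<partial>lborel)
       = ennreal \<bar>y2 / r\<bar> * (\<integral>\<^sup>+a. ennreal \<bar>r / y2\<bar> * g (r / y2 * ((b * y1 + y2 / r * a) - b * y1)) b \<partial>lborel)"
      using r y2 by (intro nn_integral_real_affine borel_measurable_times_ennreal g') auto
    also have "\<dots> = ennreal \<bar>y2 / r\<bar> * (\<integral>\<^sup>+a. ennreal \<bar>r / y2\<bar> * g a b \<partial>lborel)"
      using r y2 by simp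
    also have "\<dots> = ennreal \<bar>y2 / r\<bar> * (ennreal \<bar>r / y2\<bar> * (\<integral>\<^sup>+a. g a b \<partial>lborel))"
      by (intro arg_cong[where f = "\<lambda>x. _ * x"] nn_integral_cmult g') auto
    also have "\<dots> = (ennreal \<bar>y2 / r\<bar> * ennreal \<bar>r / y2\<bar>) * (\<integral>\<^sup>+a. g a b \<partial>lborel)" by (simp only: mult.assoc)
    also have "ennreal \<bar>y2 / r\<bar> * ennreal \<bar>r / y2\<bar> = 1"
      using r y2 by (subst ennreal_mult[symmetric]) (auto simp flip: abs_mult)
    finally show "(\<integral>\<^sup>+x1. ennreal \<bar>r / y2\<bar> * g (r / y2 * (x1 - b * y1)) b \<partial>lborel) = (\<integral>\<^sup>+a. g a b \<partial>lborel)" by simp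
  qed
  finally show ?thesis .
qed

text \<open>For fixed y the top row is replaced by its determinant a and its coordinate b without
  change of area. Rescaling y by sqrt a multiplies area by a, since y is two-dimensional, and the
  integral of a over (0, 1] is 1/2.\<close>

lemma emeasure_cone_rows:
  assumes S: "S \<in> sets borel"
  shows "emeasure lborel (cone_rows S) = ennreal (1 / 2) * emeasure lborel S"
proof -
  note [measurable] = fst_snd_borel_measurable S
  define g where "g y a b = indicator {0<..1} a * (indicator S ((fst y / sqrt a, snd y / sqrt a), b) :: ennreal)"
    for y :: "real \<times> real" and a b :: real
  have gm: "(\<lambda>x. g (e x) (f x) (h x)) \<in> borel_measurable M"
    if [measurable]: "e \<in> borel_measurable M" "f \<in> borel_measurable M" "h \<in> borel_measurable M" for e f h and M :: "'z measure"
    unfolding g_def by measurable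
  have W: "cone_rows S \<in> sets borel" using S by (rule cone_rows_borel)
  have "emeasure lborel (cone_rows S) = emeasure (lborel \<Otimes>\<^sub>M lborel) (cone_rows S)" by (simp add: lborel_prod)
  also have "\<dots> = (\<integral>\<^sup>+y. emeasure lborel (Pair y -` cone_rows S) \<partial>lborel)"
    using W by (intro lborel.emeasure_pair_measure_alt) (subst lborel_prod, simp)
  also have "\<dots> = (\<integral>\<^sup>+y. (\<integral>\<^sup>+b. (\<integral>\<^sup>+a. g y a b \<partial>lborel) \<partial>lborel) \<partial>lborel)"
  proof (rule nn_integral_cong_AE)
    \<comment> \<open>The change of variables divides by y2, so this line is discarded.\<close>
    have "{y :: real \<times> real. 0 * fst y + 1 * snd y = 0} \<in> null_sets lborel" by (rule line_null_set) simp
    from AE_not_in[OF this]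
    show "AE y in lborel. emeasure lborel (Pair y -` cone_rows S) = (\<integral>\<^sup>+b. (\<integral>\<^sup>+a. g y a b \<partial>lborel) \<partial>lborel)"
    proof eventually_elim
      case (elim y)
      obtain y1 y2 where y: "y = (y1, y2)" by fastforce
      have y2: "y2 \<noteq> 0" using elim by (simp add: y)
      have sl: "Pair y -` cone_rows S \<in> sets borel" using sets_slice[OF W, of y] by (simp add: vimage_def)
      have "emeasure lborel (Pair y -` cone_rows S) = (\<integral>\<^sup>+x. indicator (Pair y -` cone_rows S) x \<partial>(lborel \<Otimes>\<^sub>M lborel))"
        using sl by (subst lborel_prod) (simp add: nn_integral_indicator)
      also have "\<dots> = (\<integral>\<^sup>+x1. (\<integral>\<^sup>+x2. indicator (Pair y -` cone_rows S) (x1, x2) \<partial>lborel) \<partial>lborel)"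
      proof (rule lborel.nn_integral_fst[symmetric])
        show "indicator (Pair y -` cone_rows S) \<in> borel_measurable (lborel \<Otimes>\<^sub>M lborel)"
          using sl by (subst lborel_prod) simp
      qed
      also have "\<dots> = (\<integral>\<^sup>+x1. (\<integral>\<^sup>+x2. g y (x1 * y2 - x2 * y1) ((x1 * y1 + x2 * y2) / (y1\<^sup>2 + y2\<^sup>2)) \<partial>lborel) \<partial>lborel)"
        by (intro nn_integral_cong) (auto simp: g_def y cone_rows_def indicator_def)
      also have "\<dots> = (\<integral>\<^sup>+b. (\<integral>\<^sup>+a. g y a b \<partial>lborel) \<partial>lborel)"
        by (rule nn_integral_rotate_rows[OF _ y2]) (auto simp: case_prod_unfold intro!: gm)
      finally show ?case .
    qed
  qed
  also have "\<dots> = (\<integral>\<^sup>+b. (\<integral>\<^sup>+y. (\<integral>\<^sup>+a. g y a b \<partial>lborel) \<partial>lborel) \<partial>lborel)"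
  proof (rule lborel_pair.Fubini')
    have "(\<lambda>z. \<integral>\<^sup>+a. (\<lambda>(z, a). g (snd z) a (fst z)) (z, a) \<partial>lborel) \<in> borel_measurable (lborel \<Otimes>\<^sub>M lborel)"
      by (rule lborel.borel_measurable_nn_integral_fst) (auto simp: case_prod_unfold intro!: gm)
    then show "(\<lambda>(b, y). \<integral>\<^sup>+a. g y a b \<partial>lborel) \<in> borel_measurable (lborel \<Otimes>\<^sub>M lborel)"
      by (simp add: case_prod_unfold)
  qed
  also have "\<dots> = (\<integral>\<^sup>+b. ennreal (1 / 2) * (\<integral>\<^sup>+y. indicator S (y, b) \<partial>lborel) \<partial>lborel)"
  proof (rule nn_integral_cong)
    fix b :: real
    have "(\<integral>\<^sup>+y. (\<integral>\<^sup>+a. g y a b \<partial>lborel) \<partial>lborel) = (\<integral>\<^sup>+a. (\<integral>\<^sup>+y. g y a b \<partial>lborel) \<partial>lborel)"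
      by (rule lborel_pair.Fubini') (auto simp: case_prod_unfold intro!: gm)
    \<comment> \<open>At a = 0 both sides vanish, so the closed interval is harmless; it suits the
      fundamental theorem of calculus used below.\<close>
    also have "\<dots> = (\<integral>\<^sup>+a. ennreal (a * indicator {0..1} a) * (\<integral>\<^sup>+y. indicator S (y, b) \<partial>lborel) \<partial>lborel)"
    proof (rule nn_integral_cong)
      fix a :: real
      show "(\<integral>\<^sup>+y. g y a b \<partial>lborel) = ennreal (a * indicator {0..1} a) * (\<integral>\<^sup>+y. indicator S (y, b) \<partial>lborel)"
      proof (cases "a \<in> {0<..1}")
        case True
        then have sa: "sqrt a > 0" by simp
        have m: "(\<lambda>y. indicator S (y, b) :: ennreal) \<in> borel_measurable borel" by measurable
        have "(\<integral>\<^sup>+y. g y a b \<partial>lborel) = (\<integral>\<^sup>+y. indicator S ((fst y / sqrt a, snd y / sqrt a), b) \<partial>lborel)"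
          using True by (simp add: g_def)
        also have "\<dots> = (\<integral>\<^sup>+y. ennreal a * indicator S ((fst (sqrt a *\<^sub>R y) / sqrt a, snd (sqrt a *\<^sub>R y) / sqrt a), b) \<partial>lborel)"
          using sa True
          by (subst lborel_affine[of "sqrt a" "0 :: real \<times> real"]) (auto simp: nn_integral_density nn_integral_distr)
        also have "\<dots> = (\<integral>\<^sup>+y. ennreal a * indicator S (y, b) \<partial>lborel)" using sa by simp
        also have "\<dots> = ennreal a * (\<integral>\<^sup>+y. indicator S (y, b) \<partial>lborel)"
          using m by (intro nn_integral_cmult) simp
        finally show ?thesis using True by simp
      next
        case False
        then show ?thesis by (auto simp: g_def indicator_def)
      qed
    qed
    also have "\<dots> = (\<integral>\<^sup>+a. ennreal (a * indicator {0..1} a) \<partial>lborel) * (\<integral>\<^sup>+y. indicator S (y, b) \<partial>lborel)"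
      by (rule nn_integral_multc) auto
    also have "(\<integral>\<^sup>+a. ennreal (a * indicator {0..1} a) \<partial>lborel) = ennreal (1 / 2)"
    proof -
      have "(\<integral>\<^sup>+a. ennreal (a * indicator {0..1} a) \<partial>lborel) = (\<integral>\<^sup>+a. ennreal a * indicator {0..1} a \<partial>lborel)"
        by (intro nn_integral_cong) (auto simp: indicator_def)
      also have "\<dots> = ennreal (1\<^sup>2 / 2 - 0\<^sup>2 / 2)"
        by (rule nn_integral_FTC_Icc) (auto intro!: derivative_eq_intros)
      finally show ?thesis by simp
    qed
    finally show "(\<integral>\<^sup>+y. (\<integral>\<^sup>+a. g y a b \<partial>lborel) \<partial>lborel) = ennreal (1 / 2) * (\<integral>\<^sup>+y. indicator S (y, b) \<partial>lborel)" .
  qed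
  also have "\<dots> = ennreal (1 / 2) * (\<integral>\<^sup>+b. (\<integral>\<^sup>+y. indicator S (y, b) \<partial>lborel) \<partial>lborel)"
  proof (rule nn_integral_cmult)
    have "(\<lambda>b. \<integral>\<^sup>+y. (\<lambda>(b, y). indicator S (y, b) :: ennreal) (b, y) \<partial>lborel) \<in> borel_measurable lborel"
      by (rule lborel.borel_measurable_nn_integral_fst) (auto simp: case_prod_unfold)
    then show "(\<lambda>b. \<integral>\<^sup>+y. indicator S (y, b) \<partial>lborel) \<in> borel_measurable lborel" by simp
  qed
  also have "(\<integral>\<^sup>+b. (\<integral>\<^sup>+y. indicator S (y, b) \<partial>lborel) \<partial>lborel) = (\<integral>\<^sup>+z. indicator S z \<partial>(lborel \<Otimes>\<^sub>M lborel))"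
  proof (rule lborel_pair.nn_integral_snd)
    show "(indicator S :: _ \<Rightarrow> ennreal) \<in> borel_measurable (lborel \<Otimes>\<^sub>M lborel)" by (subst lborel_prod) simp
  qed
  also have "\<dots> = emeasure lborel S" by (subst lborel_prod) (simp add: nn_integral_indicator S)
  finally show ?thesis .
qed

text \<open>The factor 1/2 will cancel in the quotient that defines \<open>mu2\<close>. The cone is
  Borel, as the preimage of \<open>cone_rows S\<close> under a continuous map, so
  \<open>lebesgue\<close> may be replaced by \<open>lborel\<close>.\<close>

lemma measure_cone_coord_matrix:
  assumes S: "S \<in> sets borel" "\<And>p. p \<in> S \<Longrightarrow> fst p \<noteq> 0"
  shows "measure lebesgue (cone (coord_matrix ` S)) = measure lborel S / 2"
proof -
  let ?T = "cone (coord_matrix ` S)"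
  have m: "matrix_of_rows \<in> borel_measurable lborel"
    using borel_measurable_continuous_onI[OF continuous_matrix_of_rows] by simp
  have "?T = rows_of_matrix -` (matrix_of_rows -` ?T)" by (simp add: vimage_def)
  also have "\<dots> = rows_of_matrix -` cone_rows S" using vimage_cone[OF S(2)] by simp
  also have "\<dots> \<in> sets borel"
    using measurable_sets[OF borel_measurable_continuous_onI[OF continuous_rows_of_matrix] cone_rows_borel[OF S(1)]] by simp
  finally have T: "?T \<in> sets borel" .
  have "emeasure lebesgue ?T = emeasure lborel ?T" using T by simp
  also have "\<dots> = emeasure (distr lborel borel matrix_of_rows) ?T" using lborel_matrix_of_rows by simp
  also have "\<dots> = emeasure lborel (matrix_of_rows -` ?T)" using m T by (subst emeasure_distr) auto
  also have "\<dots> = ennreal (1 / 2) * emeasure lborel S"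
    using vimage_cone[OF S(2)] emeasure_cone_rows[OF S(1)] by simp
  finally have "emeasure lebesgue ?T = ennreal (1 / 2) * emeasure lborel S" .
  then have "measure lebesgue ?T = enn2real (ennreal (1 / 2)) * measure lborel S"
    by (simp only: measure_def enn2real_mult)
  then show ?thesis by (subst (asm) enn2real_ennreal) auto
qed

section \<open>Equidistribution of horocycles\<close>

text \<open>The upper bound passes from bounded pieces to the whole set by exhaustion with balls,
  now that the volume is known to be finite.\<close>

lemma strictly_reduced_total: "coprime_density * measure lborel strictly_reduced = 2"
proof (rule antisym[OF _ strictly_reduced_total_ge])
  have "(\<lambda>n. coprime_density * measure lborel (strictly_reduced \<inter> ball 0 (real n))) \<longlonglongrightarrow> coprime_density * measure lborel strictly_reduced"
    using open_strictly_reduced strictly_reduced_finite by (intro tendsto_mult_left measure_ball_exhaust) auto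
  then show "coprime_density * measure lborel strictly_reduced \<le> 2"
    by (rule LIMSEQ_le_const2) (auto intro!: exI[of _ 0] measure_strictly_reduced_bounded simp: open_strictly_reduced)
qed

text \<open>V may be unbounded, so it is first cut down to a ball that loses little volume. The
  factor 2 of \<open>horo_mass_le_prob\<close> is the total mass 2 of
  \<open>strictly_reduced_total\<close>, which is how the quotient of volumes arises.\<close>

lemma horocycle_prob_lower_bound:
  assumes V: "open V" "V \<subseteq> strictly_reduced" and e: "e > 0"
    and X: "\<And>N. X N \<in> sets borel" "\<And>N. X N \<subseteq> {0..<1}"
    and PX: "\<And>N \<alpha> i. N \<ge> 1 \<Longrightarrow> \<alpha> \<in> {0..<1} \<Longrightarrow> i \<in> horo_index \<Longrightarrow> horo_point N \<alpha> i \<in> V \<Longrightarrow> \<alpha> \<in> X N"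
  shows "\<forall>\<^sub>F N in sequentially. measure lborel V / measure lborel strictly_reduced - e \<le> measure lborel (X N)"
proof -
  let ?C = coprime_density
  define m where "m = measure lborel strictly_reduced"
  have C: "?C > 0" by (rule coprime_density_pos)
  have Cm: "?C * m = 2" unfolding m_def by (rule strictly_reduced_total)
  have "m \<noteq> 0" using Cm by auto
  then have m: "m > 0" by (simp add: m_def less_le)
  have "emeasure lborel V \<le> emeasure lborel strictly_reduced" using V open_strictly_reduced by (intro emeasure_mono) auto
  then have "emeasure lborel V < \<infinity>" using strictly_reduced_finite by (rule le_less_trans)
  then have "(\<lambda>n. ?C * measure lborel (V \<inter> ball 0 (real n))) \<longlonglongrightarrow> ?C * measure lborel V"
    using V by (intro tendsto_mult_left measure_ball_exhaust) auto
  then have "\<forall>\<^sub>F n in sequentially. ?C * measure lborel V - e < ?C * measure lborel (V \<inter> ball 0 (real n))"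
    using e by (intro order_tendstoD) auto
  then obtain n where n: "?C * measure lborel V - e < ?C * measure lborel (V \<inter> ball 0 (real n))"
    by (auto dest: eventually_happens'[rotated])
  let ?U = "V \<inter> ball 0 (real n)"
  have "\<forall>\<^sub>F N in sequentially. ennreal (?C * measure lborel ?U - e) \<le> horo_mass N ?U"
    using V e by (intro horo_mass_open_ge) auto
  with eventually_ge_at_top[of 1] show ?thesis
  proof eventually_elim
    case (elim N)
    have "horo_mass N ?U \<le> ennreal (2 * measure lborel (X N))"
      using V X elim(1) by (intro horo_mass_le_prob) (auto intro: PX)
    with elim(2) have "ennreal (?C * measure lborel ?U - e) \<le> ennreal (2 * measure lborel (X N))" by (rule order_trans)
    then have "?C * measure lborel ?U - e \<le> 2 * measure lborel (X N)" by (subst (asm) ennreal_le_iff) auto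
    \<comment> \<open>One error e comes from the cut to a ball, the other from the limit in N;
      halving leaves e.\<close>
    then have "?C * measure lborel V \<le> 2 * measure lborel (X N) + 2 * e" using n by linarith
    moreover have "2 * (measure lborel V / m) = (?C * m) * (measure lborel V / m)" using Cm by simp
    then have "?C * measure lborel V = 2 * (measure lborel V / m)" using m by simp
    ultimately have "measure lborel V / m - e \<le> measure lborel (X N)" by linarith
    then show ?case by (simp add: m_def)
  qed
qed

text \<open>An upper bound for an event is a lower bound for its complement, so the bound for open
  sets suffices. The open sets \<open>V1\<close> and \<open>V2\<close> fill
  \<open>strictly_reduced\<close> up to the null set \<open>Bad\<close>, since the count is locally
  constant off \<open>Bad\<close>; their shares therefore add up to 1.\<close>

theorem horocycle_equidistribution:
  assumes H: "admissible_region H"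
  shows "(\<lambda>N. measure lborel {\<alpha> \<in> {0..1}. prim_count H N (N * \<alpha>) 0 (1 / N) = k})
    \<longlonglongrightarrow> measure lborel {p \<in> strictly_reduced. coord_count H p = k} / measure lborel strictly_reduced"
proof -
  define E where "E = {p. coord_count H p = k}"
  define m where "m = measure lborel strictly_reduced"
  define V1 where "V1 = strictly_reduced \<inter> interior E"
  define V2 where "V2 = strictly_reduced \<inter> interior (- E)"
  define Bad where "Bad = (\<Union>w\<in>coprime_pairs. {p. coord_image p w \<in> frontier H})"
  have cH: "compact H" using H by (simp add: admissible_region_def)
  have Bad: "Bad \<in> null_sets lborel" unfolding Bad_def by (rule frontier_hits_null[OF H])
  have Eb: "E \<in> sets borel" unfolding E_def by (rule coord_count_borel) (use cH compact_imp_closed in blast)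
  have Sb: "strictly_reduced \<in> sets borel" using open_strictly_reduced by simp
  have oV: "open V1" "open V2" using open_strictly_reduced by (auto simp: V1_def V2_def)
  have sV: "V1 \<subseteq> strictly_reduced" "V2 \<subseteq> strictly_reduced" by (auto simp: V1_def V2_def)
  have VE: "V1 \<subseteq> E" "V2 \<subseteq> - E" using interior_subset by (auto simp: V1_def V2_def)
  have cover: "p \<in> V1 \<union> V2 \<union> Bad" if p: "p \<in> strictly_reduced" for p
  proof (cases "p \<in> Bad")
    case False
    have "fst p \<noteq> 0" using p by (simp add: strictly_reduced_def)
    then have "\<forall>\<^sub>F q in nhds p. coord_count H q = coord_count H p"
      using False by (intro coord_count_locally_constant cH) (auto simp: Bad_def)
    then obtain O' where O: "open O'" "p \<in> O'" "\<And>q. q \<in> O' \<Longrightarrow> coord_count H q = coord_count H p"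
      by (auto simp: eventually_nhds)
    show ?thesis
    proof (cases "p \<in> E")
      case True
      then have "O' \<subseteq> E" using O(3) by (auto simp: E_def)
      then show ?thesis using O p by (auto simp: V1_def interior_def)
    next
      case False
      then have "O' \<subseteq> - E" using O(3) by (auto simp: E_def)
      then show ?thesis using O p by (auto simp: V2_def interior_def)
    qed
  qed auto
  have fin: "emeasure lborel T \<noteq> \<infinity>" if "T \<subseteq> strictly_reduced" for T
  proof -
    have "emeasure lborel T \<le> emeasure lborel strictly_reduced" using that Sb by (intro emeasure_mono) auto
    then show ?thesis using strictly_reduced_finite by auto
  qed
  have null: "measure lborel T = measure lborel V" if "V \<subseteq> T" "T \<subseteq> V \<union> Bad" "V \<in> sets borel" "T \<in> sets borel" for T V
  proof -
    have "T - V \<subseteq> Bad" "T - V \<in> sets lborel" using that by auto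
    then have "T - V \<in> null_sets lborel" using Bad null_sets_subset by blast
    moreover have "T = V \<union> (T - V)" using that by auto
    ultimately show ?thesis using measure_Un_null_set[of V lborel "T - V"] that(3) by simp
  qed
  have mE: "measure lborel {p \<in> strictly_reduced. coord_count H p = k} = measure lborel V1"
  proof -
    have "{p \<in> strictly_reduced. coord_count H p = k} = strictly_reduced \<inter> E" by (auto simp: E_def)
    also have "measure lborel \<dots> = measure lborel V1"
    proof (rule null)
      show "V1 \<subseteq> strictly_reduced \<inter> E" using sV VE by blast
      show "strictly_reduced \<inter> E \<subseteq> V1 \<union> Bad" using cover VE by blast
    qed (use Sb Eb oV in auto)
    finally show ?thesis .
  qed
  have "measure lborel strictly_reduced = measure lborel (V1 \<union> V2)"
  proof (rule null)
    show "strictly_reduced \<subseteq> V1 \<union> V2 \<union> Bad" using cover by blast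
  qed (use sV oV Sb in auto)
  also have "\<dots> = measure lborel V1 + measure lborel V2"
    using fin[OF sV(1)] fin[OF sV(2)] oV VE by (intro measure_Union) auto
  finally have mm: "m = measure lborel V1 + measure lborel V2" by (simp add: m_def)
  have m0: "m > 0"
  proof -
    have "m \<noteq> 0" using strictly_reduced_total by (auto simp: m_def)
    then show ?thesis by (simp add: m_def less_le)
  qed
  define P where "P N \<alpha> \<longleftrightarrow> prim_count H N (N * \<alpha>) 0 (1 / N) = k" for N :: nat and \<alpha> :: real
  have Pb: "{\<alpha>. P N \<alpha>} \<in> sets borel" for N
  proof -
    have "(\<lambda>\<alpha>::real. card {w \<in> coprime_pairs. (real N * of_int (fst w) + real N * \<alpha> * of_int (snd w), 0 * of_int (fst w) + 1 / N * of_int (snd w)) \<in> H})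
       \<in> measurable borel (count_space UNIV)"
    proof (rule measurable_card_countable)
      fix w :: "int \<times> int"
      have "closed ((\<lambda>\<alpha>::real. (real N * of_int (fst w) + real N * \<alpha> * of_int (snd w), 0 * of_int (fst w) + 1 / N * of_int (snd w))) -` H)"
        using cH compact_imp_closed by (intro closed_vimage continuous_intros) auto
      then have "{\<alpha>::real. (real N * of_int (fst w) + real N * \<alpha> * of_int (snd w), 0 * of_int (fst w) + 1 / N * of_int (snd w)) \<in> H} \<in> sets borel"
        by (simp add: vimage_def borel_closed)
      then show "{\<alpha> \<in> space (borel :: real measure). w \<in> {w \<in> coprime_pairs. (real N * of_int (fst w) + real N * \<alpha> * of_int (snd w), 0 * of_int (fst w) + 1 / N * of_int (snd w)) \<in> H}} \<in> sets borel"
        by (cases "w \<in> coprime_pairs") auto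
    qed
    from measurable_sets[OF this, of "{k}"] show ?thesis by (simp add: vimage_def P_def prim_count_def)
  qed
  \<comment> \<open>Unfolding works on [0, 1), the probability lives on [0, 1]. \<open>X1\<close>
    lies inside the event \<open>Y\<close> and \<open>X2\<close> inside its complement, which
    absorbs the endpoint.\<close>
  define X1 where "X1 N = {0..<1} \<inter> {\<alpha>. P N \<alpha>}" for N
  define X2 where "X2 N = {0..<1} - {\<alpha>. P N \<alpha>}" for N
  define Y where "Y N = {\<alpha> \<in> {0..1}. P N \<alpha>}" for N
  have PV: "P N \<alpha> \<longleftrightarrow> horo_point N \<alpha> i \<in> E" if "N \<ge> 1" "i \<in> horo_index" for N \<alpha> i
    using horo_point_prim_count[OF that(2,1), of H \<alpha>] by (simp add: P_def E_def coord_count_def)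
  have Yb: "Y N \<in> sets borel" for N
  proof -
    have "Y N = {0..1} \<inter> {\<alpha>. P N \<alpha>}" by (auto simp: Y_def)
    then show ?thesis using Pb[of N] by simp
  qed
  have Yfin: "emeasure lborel T \<noteq> \<infinity>" if "T \<subseteq> {0..1::real}" for T
  proof -
    have "emeasure lborel T \<le> emeasure lborel {0..1::real}" using that by (intro emeasure_mono) auto
    then show ?thesis by (auto simp: top_unique)
  qed
  have YI: "Y N \<subseteq> {0..1}" for N by (auto simp: Y_def)
  have low: "measure lborel (X1 N) \<le> measure lborel (Y N)" for N
  proof (rule measure_mono_fmeasurable)
    show "X1 N \<subseteq> Y N" by (auto simp: X1_def Y_def)
    show "X1 N \<in> sets lborel" using Pb[of N] by (simp add: X1_def)
    show "Y N \<in> fmeasurable lborel" using Yb[of N] Yfin[OF YI[of N]] by (intro fmeasurableI) (auto simp: less_top)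
  qed
  have up: "measure lborel (Y N) \<le> 1 - measure lborel (X2 N)" for N
  proof -
    have "measure lborel (X2 N) \<le> measure lborel ({0..1} - Y N)"
    proof (rule measure_mono_fmeasurable)
      show "X2 N \<subseteq> {0..1} - Y N" by (auto simp: X2_def Y_def)
      show "X2 N \<in> sets lborel" using Pb[of N] by (simp add: X2_def)
      show "{0..1} - Y N \<in> fmeasurable lborel"
        using Yb[of N] Yfin[of "{0..1} - Y N"] by (intro fmeasurableI) (auto simp: less_top)
    qed
    also have "\<dots> = measure lborel {0..1::real} - measure lborel (Y N)"
      using Yb[of N] by (intro measure_Diff) (auto simp: Y_def)
    finally show ?thesis by simp
  qed
  have "(\<lambda>N. measure lborel (Y N)) \<longlonglongrightarrow> measure lborel V1 / m"
  proof (rule LIMSEQ_I)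
    fix e :: real assume e: "e > 0"
    have "\<forall>\<^sub>F N in sequentially. measure lborel V1 / m - e / 2 \<le> measure lborel (X1 N)"
      unfolding m_def using e oV sV VE Pb PV
      by (intro horocycle_prob_lower_bound) (auto simp: X1_def)
    moreover have "\<forall>\<^sub>F N in sequentially. measure lborel V2 / m - e / 2 \<le> measure lborel (X2 N)"
      unfolding m_def using e oV sV VE Pb PV
      by (intro horocycle_prob_lower_bound) (auto simp: X2_def)
    ultimately have "\<forall>\<^sub>F N in sequentially. norm (measure lborel (Y N) - measure lborel V1 / m) < e"
    proof eventually_elim
      case (elim N)
      have "measure lborel V1 / m + measure lborel V2 / m = 1"
        using m0 mm by (simp flip: add_divide_distrib)
      then show ?case using elim low[of N] up[of N] e unfolding real_norm_def by linarith
    qed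
    then show "\<exists>no. \<forall>n\<ge>no. norm (measure lborel (Y n) - measure lborel V1 / m) < e"
      by (simp add: eventually_sequentially)
  qed
  then show ?thesis unfolding mE m_def[symmetric] by (simp add: Y_def P_def)
qed

section \<open>Translation to lattices\<close>

lemma int_vec_nth [simp]: "int_vec a b $ 1 = of_int a" "int_vec a b $ 2 = of_int b"
  by (simp_all add: int_vec_def)

lemma int_vec_inject: "int_vec a b = int_vec c d \<longleftrightarrow> a = c \<and> b = d"
  by (auto simp: vec_eq_iff forall_2)

lemma matrix_vector_mult_2:
  fixes g :: "real^2^2"
  shows "(g *v v) $ 1 = g $ 1 $ 1 * v $ 1 + g $ 1 $ 2 * v $ 2" "(g *v v) $ 2 = g $ 2 $ 1 * v $ 1 + g $ 2 $ 2 * v $ 2"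
  by (simp_all add: matrix_vector_mult_def sum_2)

lemma SL2R_inj: "g \<in> SL2R \<Longrightarrow> g *v v = g *v w \<Longrightarrow> v = w"
  using inj_matrix_vector_mult[of g] by (auto simp: SL2R_def invertible_det_nz inj_def)

lemma coprime_pairs_iff_gcd: "w \<in> coprime_pairs \<longleftrightarrow> gcd (fst w) (snd w) = 1"
  by (simp only: coprime_pairs_def mem_Collect_eq coprime_iff_gcd_eq_1)

lemma scale_int_vec: "of_int n *\<^sub>R int_vec a b = int_vec (n * a) (n * b)"
  by (simp add: vec_eq_iff forall_2)

lemma prim_ofI: "gcd a b = 1 \<Longrightarrow> g *v int_vec a b \<in> prim_of g"
  unfolding prim_of_def by (intro CollectI exI conjI) (rule refl)

lemma prim_ofE:
  assumes "v \<in> prim_of g"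
  obtains a b where "v = g *v int_vec a b" "gcd a b = 1"
  using assms unfolding prim_of_def by (elim CollectE exE conjE) (rule that)

text \<open>Primitivity is expressed by the lattice alone, as indivisibility by every n >= 2 within
  it. This makes the choice of g in \<open>lattice_prim\<close> irrelevant.\<close>

lemma prim_of_altdef:
  assumes "g \<in> SL2R"
  shows "prim_of g = {v \<in> lattice_of g. \<forall>n::int. \<forall>u\<in>lattice_of g. n \<ge> 2 \<longrightarrow> v \<noteq> of_int n *\<^sub>R u}"
proof (intro set_eqI iffI)
  fix v assume "v \<in> prim_of g"
  then obtain a b where v: "v = g *v int_vec a b" "gcd a b = 1" by (rule prim_ofE)
  have "v \<noteq> of_int n *\<^sub>R u" if n: "n \<ge> 2" and u: "u \<in> lattice_of g" for n :: int and u
  proof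
    assume eq: "v = of_int n *\<^sub>R u"
    obtain c d where "u = g *v int_vec c d" using u by (auto simp: lattice_of_def)
    then have "g *v int_vec a b = g *v int_vec (n * c) (n * d)"
      using eq v(1) by (simp only: scale_int_vec[symmetric] matrix_vector_mult_scaleR)
    then have "a = n * c" "b = n * d" using SL2R_inj[OF assms] int_vec_inject by blast+
    then have "n dvd gcd a b" by simp
    then show False using v(2) n by simp
  qed
  then show "v \<in> {v \<in> lattice_of g. \<forall>n::int. \<forall>u\<in>lattice_of g. n \<ge> 2 \<longrightarrow> v \<noteq> of_int n *\<^sub>R u}"
    using v by (auto simp: lattice_of_def)
next
  fix v assume v: "v \<in> {v \<in> lattice_of g. \<forall>n::int. \<forall>u\<in>lattice_of g. n \<ge> 2 \<longrightarrow> v \<noteq> of_int n *\<^sub>R u}"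
  then obtain a b where ab: "v = g *v int_vec a b" by (auto simp: lattice_of_def)
  have multiple: "\<not> (a = n * c \<and> b = n * d)" if "n \<ge> 2" for n c d :: int
  proof
    assume "a = n * c \<and> b = n * d"
    then have "v = of_int n *\<^sub>R (g *v int_vec c d)"
      unfolding ab by (simp only: scale_int_vec[symmetric] matrix_vector_mult_scaleR)
    moreover have "g *v int_vec c d \<in> lattice_of g" by (auto simp: lattice_of_def)
    ultimately show False using v that by blast
  qed
  \<comment> \<open>The zero vector is twice itself.\<close>
  have "gcd a b \<noteq> 0" using multiple[of 2 0 0] by auto
  moreover have "\<not> gcd a b \<ge> 2"
  proof
    assume "gcd a b \<ge> 2"
    moreover obtain c d where "a = gcd a b * c" "b = gcd a b * d" by (meson dvdE gcd_dvd1 gcd_dvd2)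
    ultimately show False using multiple by blast
  qed
  ultimately have "gcd a b = 1" using gcd_ge_0_int[of a b] by linarith
  then show "v \<in> prim_of g" unfolding ab by (rule prim_ofI)
qed

lemma lattice_prim_eq:
  assumes "g \<in> SL2R"
  shows "lattice_prim (lattice_of g) = prim_of g"
proof -
  define h where "h = (SOME h. h \<in> SL2R \<and> lattice_of h = lattice_of g)"
  have "h \<in> SL2R \<and> lattice_of h = lattice_of g"
    unfolding h_def by (rule someI[of _ g]) (use assms in simp)
  then show ?thesis using assms by (simp add: lattice_prim_def prim_of_altdef flip: h_def)
qed

lemma card_prim_of:
  assumes "g \<in> SL2R"
  shows "card (prim_of g \<inter> {v. (v $ 1, v $ 2) \<in> H}) = prim_count H (g $ 1 $ 1) (g $ 1 $ 2) (g $ 2 $ 1) (g $ 2 $ 2)"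
proof -
  let ?f = "\<lambda>w. g *v int_vec (fst w) (snd w)"
  let ?W = "{w \<in> coprime_pairs. (g $ 1 $ 1 * of_int (fst w) + g $ 1 $ 2 * of_int (snd w), g $ 2 $ 1 * of_int (fst w) + g $ 2 $ 2 * of_int (snd w)) \<in> H}"
  have inj: "inj_on ?f ?W"
  proof (rule inj_onI)
    fix w w' assume "?f w = ?f w'"
    then have "int_vec (fst w) (snd w) = int_vec (fst w') (snd w')" by (rule SL2R_inj[OF assms])
    then show "w = w'" by (simp add: int_vec_inject prod_eq_iff)
  qed
  have img: "?f ` ?W = prim_of g \<inter> {v. (v $ 1, v $ 2) \<in> H}"
  proof (intro set_eqI iffI)
    fix v assume "v \<in> ?f ` ?W"
    then obtain w where w: "w \<in> ?W" "v = ?f w" by blast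
    then have "gcd (fst w) (snd w) = 1" using coprime_pairs_iff_gcd by blast
    then have "v \<in> prim_of g" unfolding w(2) by (rule prim_ofI)
    moreover have "(v $ 1, v $ 2) \<in> H" using w by (simp add: matrix_vector_mult_2)
    ultimately show "v \<in> prim_of g \<inter> {v. (v $ 1, v $ 2) \<in> H}" by blast
  next
    fix v assume v: "v \<in> prim_of g \<inter> {v. (v $ 1, v $ 2) \<in> H}"
    then have "v \<in> prim_of g" by blast
    then obtain a b where ab: "v = g *v int_vec a b" "gcd a b = 1" by (rule prim_ofE)
    have "(a, b) \<in> coprime_pairs" using ab(2) unfolding coprime_pairs_iff_gcd by simp
    then have "(a, b) \<in> ?W" using v by (simp add: ab(1) matrix_vector_mult_2)
    then show "v \<in> ?f ` ?W" using ab(1) by (intro image_eqI[of _ _ "(a, b)"]) auto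
  qed
  show ?thesis unfolding prim_count_def img[symmetric] using inj by (rule card_image)
qed

section \<open>The coordinates as a parametrisation of SL(2,R)\<close>

lemma coord_matrix_nth:
  "coord_matrix p $ 1 $ 1 = top1 p" "coord_matrix p $ 1 $ 2 = top2 p"
  "coord_matrix p $ 2 $ 1 = fst (fst p)" "coord_matrix p $ 2 $ 2 = snd (fst p)"
  by (simp_all add: coord_matrix_def matrix_of_rows_def)

lemma coord_matrix_SL2R: "fst p \<noteq> 0 \<Longrightarrow> coord_matrix p \<in> SL2R"
  using top_det[of p] by (simp add: SL2R_def det_2 coord_matrix_nth)

text \<open>In the orthogonal decomposition of the top row along (y2, -y1) and y, determinant 1
  fixes the first coefficient as 1/|y|^2, so the second one, t, is the only freedom left.\<close>

lemma SL2R_coord_matrix: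
  assumes "g \<in> SL2R"
  obtains p where "fst p \<noteq> 0" "g = coord_matrix p"
proof -
  define x1 x2 y1 y2 where xy: "x1 = g $ 1 $ 1" "x2 = g $ 1 $ 2" "y1 = g $ 2 $ 1" "y2 = g $ 2 $ 2"
  define r where "r = y1\<^sup>2 + y2\<^sup>2"
  define P where "P = x1 * y1 + x2 * y2"
  define p where "p = ((y1, y2), P / r)"
  have det: "x1 * y2 - x2 * y1 = 1" using assms by (simp add: SL2R_def det_2 xy)
  have nz: "fst p \<noteq> 0" using det by (auto simp: p_def zero_prod_def)
  have r: "r > 0" using rsq_pos[OF nz] by (simp add: p_def r_def)
  have "y2 + P * y1 = y2 * (x1 * y2 - x2 * y1) + P * y1" using det by simp
  also have "\<dots> = x1 * r" by (simp add: P_def r_def power2_eq_square algebra_simps)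
  finally have "x1 = (y2 + P * y1) / r" using r by simp
  also have "\<dots> = top1 p" by (simp add: top1_def p_def add_divide_distrib flip: r_def)
  finally have t1: "top1 p = x1" by simp
  have "P * y2 - y1 = P * y2 - y1 * (x1 * y2 - x2 * y1)" using det by simp
  also have "\<dots> = x2 * r" by (simp add: P_def r_def power2_eq_square algebra_simps)
  finally have "x2 = (P * y2 - y1) / r" using r by simp
  also have "\<dots> = top2 p" by (simp add: top2_def p_def diff_divide_distrib flip: r_def)
  finally have t2: "top2 p = x2" by simp
  have "g = coord_matrix p" by (simp add: vec_eq_iff forall_2 coord_matrix_nth t1 t2) (simp add: p_def xy)
  with nz show ?thesis using that by blast
qed

lemma column_norm_inner:
  fixes g :: "real^2^2"
  shows "(norm (column j g))\<^sup>2 = (g $ 1 $ j)\<^sup>2 + (g $ 2 $ j)\<^sup>2"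
    and "column 1 g \<bullet> column 2 g = g $ 1 $ 1 * g $ 1 $ 2 + g $ 2 $ 1 * g $ 2 $ 2"
  unfolding power2_norm_eq_inner by (simp_all add: inner_vec_def column_def sum_2 power2_eq_square)

lemma coord_matrix_FD:
  assumes "fst p \<noteq> 0"
  shows "coord_matrix p \<in> FD \<longleftrightarrow> p \<in> weakly_reduced"
proof -
  have sq: "norm v \<le> norm w \<longleftrightarrow> (norm v)\<^sup>2 \<le> (norm w)\<^sup>2" for v w :: "real^2"
    by (simp add: abs_le_square_iff[symmetric])
  show ?thesis
    unfolding FD_def weakly_reduced_def mem_Collect_eq sq column_norm_inner coord_matrix_nth
    using assms coord_matrix_SL2R[OF assms] by simp
qed

text \<open>\<open>FD\<close> corresponds to the weakly reduced points and the limit theorem to the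
  strictly reduced ones; their difference is null, and the factor 1/2 cancels in the
  quotient.\<close>

lemma mu2_region:
  assumes H: "closed H" and Hv: "Hv = {v. (v $ 1, v $ 2) \<in> H}"
  shows "mu2 {L \<in> X2. card (lattice_prim L \<inter> Hv) = k}
       = measure lborel {p \<in> strictly_reduced. coord_count H p = k} / measure lborel strictly_reduced"
proof -
  have nzW: "fst p \<noteq> 0" if "p \<in> weakly_reduced" for p using that by (simp add: weakly_reduced_def)
  have cnt: "card (lattice_prim (lattice_of (coord_matrix p)) \<inter> Hv) = coord_count H p" if "fst p \<noteq> 0" for p
    using coord_matrix_SL2R[OF that] by (simp add: lattice_prim_eq Hv card_prim_of coord_count_def coord_matrix_nth)
  have FD: "FD = coord_matrix ` weakly_reduced"
  proof (intro set_eqI iffI)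
    fix g assume g: "g \<in> FD"
    then have "g \<in> SL2R" by (simp add: FD_def)
    then obtain p where "fst p \<noteq> 0" "g = coord_matrix p" by (rule SL2R_coord_matrix)
    then show "g \<in> coord_matrix ` weakly_reduced" using g coord_matrix_FD by blast
  qed (use nzW coord_matrix_FD in blast)
  have X2: "lattice_of (coord_matrix p) \<in> X2" if "fst p \<noteq> 0" for p
    using coord_matrix_SL2R[OF that] by (simp add: X2_def)
  have S: "{g \<in> FD. lattice_of g \<in> {L \<in> X2. card (lattice_prim L \<inter> Hv) = k}}
     = coord_matrix ` {p \<in> weakly_reduced. coord_count H p = k}"
  proof -
    have "lattice_of (coord_matrix p) \<in> {L \<in> X2. card (lattice_prim L \<inter> Hv) = k} \<longleftrightarrow> coord_count H p = k"
      if "p \<in> weakly_reduced" for p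
      using X2[OF nzW[OF that]] cnt[OF nzW[OF that]] by simp
    then show ?thesis unfolding FD by blast
  qed
  have haar: "haar_SL2 (coord_matrix ` T) = measure lborel T / 2" if "T \<in> sets borel" "T \<subseteq> weakly_reduced" for T
    unfolding haar_SL2_def using that nzW by (intro measure_cone_coord_matrix) auto
  have E: "{p. coord_count H p = k} \<in> sets borel" using H by (rule coord_count_borel)
  have WE: "{p \<in> weakly_reduced. coord_count H p = k} = weakly_reduced \<inter> {p. coord_count H p = k}" by auto
  have SE: "{p \<in> strictly_reduced. coord_count H p = k} = strictly_reduced \<inter> {p. coord_count H p = k}" by auto
  have null: "measure lborel (weakly_reduced \<inter> T) = measure lborel (strictly_reduced \<inter> T)" if "T \<in> sets borel" for T
  proof -
    have "(weakly_reduced - strictly_reduced) \<inter> T \<in> null_sets lborel"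
      by (rule null_sets_subset[OF reduced_boundary_null]) (use that open_strictly_reduced in auto)
    moreover have "weakly_reduced \<inter> T = (strictly_reduced \<inter> T) \<union> ((weakly_reduced - strictly_reduced) \<inter> T)"
      using strictly_reduced_subset by auto
    ultimately show ?thesis
      using measure_Un_null_set[of "strictly_reduced \<inter> T" lborel] that open_strictly_reduced by simp
  qed
  have h1: "haar_SL2 (coord_matrix ` {p \<in> weakly_reduced. coord_count H p = k}) = measure lborel {p \<in> weakly_reduced. coord_count H p = k} / 2"
    using E by (intro haar) (auto simp: WE)
  have h2: "haar_SL2 (coord_matrix ` weakly_reduced) = measure lborel weakly_reduced / 2"
    by (rule haar) auto
  have "mu2 {L \<in> X2. card (lattice_prim L \<inter> Hv) = k} =
    (measure lborel {p \<in> weakly_reduced. coord_count H p = k} / 2) / (measure lborel weakly_reduced / 2)"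
    unfolding mu2_def S unfolding FD h1 h2 ..
  also have "\<dots> = measure lborel {p \<in> strictly_reduced. coord_count H p = k} / measure lborel strictly_reduced"
    using null[OF E] null[of UNIV] by (simp add: WE SE)
  finally show ?thesis .
qed

text \<open>Boundedness follows from snd v >= 1. The exceptional heights 1 and c are the horizontal
  edges; at any other height the frontier has at most the two points A/h and -A/h of the
  hyperbolas.\<close>

lemma H_region_admissible:
  assumes "c > 1"
  shows "admissible_region {v :: real \<times> real. \<bar>fst v\<bar> * snd v \<le> A \<and> 1 \<le> snd v \<and> snd v \<le> c}" (is "admissible_region ?H")
proof -
  have cl: "closed ?H" by (intro closed_Collect_conj closed_Collect_le continuous_intros)
  have "?H \<subseteq> {-A..A} \<times> {1..c}"
  proof
    fix v assume v: "v \<in> ?H"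
    then have "\<bar>fst v\<bar> * 1 \<le> \<bar>fst v\<bar> * snd v" by (intro mult_left_mono) auto
    then have "\<bar>fst v\<bar> \<le> A" using v by auto
    then show "v \<in> {-A..A} \<times> {1..c}" using v by (cases v) (auto simp: abs_le_iff)
  qed
  moreover have "compact ({-A..A} \<times> {1..c})" by (intro compact_Times compact_Icc)
  ultimately have "bounded ?H" using bounded_subset compact_imp_bounded by blast
  with cl have "compact ?H" by (simp add: compact_eq_bounded_closed)
  moreover have "countable {s. (s, h) \<in> frontier ?H}" if h: "h \<notin> {1, c}" for h
  proof (rule countable_subset[of _ "{A / h, - (A / h)}"])
    let ?O = "{v :: real \<times> real. \<bar>fst v\<bar> * snd v < A \<and> 1 < snd v \<and> snd v < c}"
    have "open ?O" by (intro open_Collect_conj open_Collect_less continuous_intros)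
    then have "?O \<subseteq> interior ?H" by (intro interior_maximal) auto
    then have fr: "frontier ?H \<subseteq> ?H - ?O" using cl by (auto simp: frontier_def)
    show "{s. (s, h) \<in> frontier ?H} \<subseteq> {A / h, - (A / h)}"
    proof
      fix s assume "s \<in> {s. (s, h) \<in> frontier ?H}"
      then have "(s, h) \<in> ?H - ?O" using fr by blast
      then have "\<bar>s\<bar> * h = A" "h > 0" using h by auto
      then have "\<bar>s\<bar> = A / h" by (simp add: field_simps)
      then show "s \<in> {A / h, - (A / h)}" by (auto simp: abs_if split: if_splits)
    qed
  qed simp
  ultimately show ?thesis unfolding admissible_region_def by (intro conjI exI[of _ "{1, c}"]) auto
qed

lemma R_region_admissible:
  "admissible_region {v :: real \<times> real. \<bar>fst v\<bar> \<le> A \<and> 0 \<le> snd v \<and> snd v \<le> 1}" (is "admissible_region ?H")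
proof -
  have cl: "closed ?H" by (intro closed_Collect_conj closed_Collect_le continuous_intros)
  have "?H \<subseteq> {-A..A} \<times> {0..1}" by (auto simp: abs_le_iff)
  moreover have "compact ({-A..A} \<times> {0..1::real})" by (intro compact_Times compact_Icc)
  ultimately have "bounded ?H" using bounded_subset compact_imp_bounded by blast
  with cl have "compact ?H" by (simp add: compact_eq_bounded_closed)
  moreover have "countable {s. (s, h) \<in> frontier ?H}" if h: "h \<notin> {0, 1}" for h
  proof (rule countable_subset[of _ "{A, - A}"])
    let ?O = "{v :: real \<times> real. \<bar>fst v\<bar> < A \<and> 0 < snd v \<and> snd v < 1}"
    have "open ?O" by (intro open_Collect_conj open_Collect_less continuous_intros)
    then have "?O \<subseteq> interior ?H" by (intro interior_maximal) auto
    then have fr: "frontier ?H \<subseteq> ?H - ?O" using cl by (auto simp: frontier_def)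
    show "{s. (s, h) \<in> frontier ?H} \<subseteq> {A, - A}"
    proof
      fix s assume "s \<in> {s. (s, h) \<in> frontier ?H}"
      then have "(s, h) \<in> ?H - ?O" using fr by blast
      then show "s \<in> {A, - A}" using h by auto
    qed
  qed simp
  ultimately show ?thesis unfolding admissible_region_def by (intro conjI exI[of _ "{0, 1}"]) auto
qed

text \<open>The counts use alpha q - p, the lattice coordinates u + alpha v, so p corresponds to
  -u.\<close>

lemma card_negate_fst:
  fixes A B :: "(int \<times> int) set"
  assumes "\<And>p q. (p, q) \<in> A \<longleftrightarrow> (- p, q) \<in> B"
  shows "card A = card B"
proof (rule bij_betw_same_card)
  show "bij_betw (\<lambda>w. (- fst w, snd w)) A B"
  proof (rule bij_betw_byWitness[where f' = "\<lambda>w. (- fst w, snd w)"])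
    show "(\<lambda>w. (- fst w, snd w)) ` A \<subseteq> B" using assms by auto
    have "(- p, q) \<in> A" if "(p, q) \<in> B" for p q using that assms[of "- p" q] by simp
    then show "(\<lambda>w. (- fst w, snd w)) ` B \<subseteq> A" by auto
  qed auto
qed

text \<open>The coefficients (-p, q) give the vector (N (alpha q - p), q/N), and N cancels from the
  product |x| y.\<close>

lemma EST_eq_prim_count:
  assumes N: "N \<ge> 1"
  shows "EST A c N \<alpha> = prim_count {v. \<bar>fst v\<bar> * snd v \<le> A \<and> 1 \<le> snd v \<and> snd v \<le> c} N (N * \<alpha>) 0 (1 / N)"
  unfolding EST_def prim_count_def
proof (rule card_negate_fst)
  fix p q :: int
  have N0: "real N > 0" using N by simp
  show "(p, q) \<in> {(p, q). 1 \<le> q \<and> gcd p q = 1 \<and> real N \<le> of_int q \<and> of_int q \<le> c * real N \<and>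
            \<bar>\<alpha> - of_int p / of_int q\<bar> \<le> A / (of_int q)\<^sup>2} \<longleftrightarrow>
        (- p, q) \<in> {w \<in> coprime_pairs. (real N * of_int (fst w) + real N * \<alpha> * of_int (snd w), 0 * of_int (fst w) + 1 / real N * of_int (snd w))
            \<in> {v. \<bar>fst v\<bar> * snd v \<le> A \<and> 1 \<le> snd v \<and> snd v \<le> c}}" (is "?L \<longleftrightarrow> ?R")
  \<comment> \<open>If q >= N then q is positive and dividing by q is legitimate; otherwise both
    sides are false.\<close>
  proof (cases "real N \<le> of_int q")
    case True
    then have q: "real_of_int q > 0" "q \<ge> 1" using N0 by (auto simp: int_one_le_iff_zero_less)
    have "\<bar>\<alpha> - of_int p / of_int q\<bar> = \<bar>\<alpha> * q - p\<bar> / q"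
    proof -
      have "\<alpha> - of_int p / of_int q = (\<alpha> * q - p) / q" using q by (simp add: field_simps)
      then show ?thesis using q by (simp add: abs_divide)
    qed
    then have "\<bar>\<alpha> - of_int p / of_int q\<bar> \<le> A / (of_int q)\<^sup>2 \<longleftrightarrow> \<bar>\<alpha> * q - p\<bar> * q \<le> A"
      using q by (simp add: field_simps power2_eq_square)
    moreover have "\<bar>real N * of_int (- p) + real N * \<alpha> * of_int q\<bar> = N * \<bar>\<alpha> * q - p\<bar>"
    proof -
      have "real N * of_int (- p) + real N * \<alpha> * of_int q = N * (\<alpha> * q - p)" by (simp add: algebra_simps)
      then show ?thesis by (simp add: abs_mult)
    qed
    ultimately show ?thesis using True q N0
      by (auto simp: coprime_pairs_def coprime_iff_gcd_eq_1 field_simps)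
  next
    case False
    then have "\<not> ?L" by simp
    moreover have "\<not> ?R" using False N0 by (simp add: field_simps)
    ultimately show ?thesis by blast
  qed
qed

text \<open>The region contains a piece of the axis y = 0, while the count demands q >= 1. The only
  primitive vectors with q = 0 are (N, 0) and (-N, 0), and N > A pushes them out of the
  region.\<close>

lemma Kcount_eq_prim_count:
  assumes N: "N \<ge> 1" "real N > A"
  shows "Kcount A N \<alpha> = prim_count {v. \<bar>fst v\<bar> \<le> A \<and> 0 \<le> snd v \<and> snd v \<le> 1} N (N * \<alpha>) 0 (1 / N)"
  unfolding Kcount_def prim_count_def
proof (rule card_negate_fst)
  fix p q :: int
  have N0: "real N > 0" using N by simp
  have eq: "\<bar>real N * of_int (- p) + real N * \<alpha> * of_int q\<bar> = N * \<bar>\<alpha> * q - p\<bar>"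
  proof -
    have "real N * of_int (- p) + real N * \<alpha> * of_int q = N * (\<alpha> * q - p)" by (simp add: algebra_simps)
    then show ?thesis by (simp add: abs_mult)
  qed
  show "(p, q) \<in> {(p, q). gcd p q = 1 \<and> 1 \<le> q \<and> of_int q \<le> real N \<and> \<bar>\<alpha> * of_int q - of_int p\<bar> \<le> A / real N} \<longleftrightarrow>
        (- p, q) \<in> {w \<in> coprime_pairs. (real N * of_int (fst w) + real N * \<alpha> * of_int (snd w), 0 * of_int (fst w) + 1 / real N * of_int (snd w))
            \<in> {v. \<bar>fst v\<bar> \<le> A \<and> 0 \<le> snd v \<and> snd v \<le> 1}}" (is "?L \<longleftrightarrow> ?R")
  proof (cases "q = 0")
    case True
    have "\<not> ?R"
    proof
      assume R: ?R
      then have "\<bar>p\<bar> = 1" using True by (simp add: coprime_pairs_def coprime_iff_gcd_eq_1)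
      then have "\<bar>real_of_int p\<bar> = 1" by linarith
      moreover have "N * \<bar>\<alpha> * q - p\<bar> \<le> A" using R unfolding eq[symmetric] by simp
      ultimately show False using True N by simp
    qed
    then show ?thesis using True by simp
  next
    case False
    then have "0 \<le> real_of_int q \<longleftrightarrow> 1 \<le> q" by linarith
    then show ?thesis using N0 eq
      by (auto simp: coprime_pairs_def coprime_iff_gcd_eq_1 field_simps)
  qed
qed

theorem theorem1:
  fixes A c :: real and k :: nat
  assumes "A > 0" and "c > 1"
  shows "((\<lambda>N. unif_prob (\<lambda>\<alpha>. EST A c N \<alpha> = k)) \<longlongrightarrow>
            mu2 {L \<in> X2. card (lattice_prim L \<inter> H_set A c) = k}) sequentially
       \<and> ((\<lambda>N. unif_prob (\<lambda>\<alpha>. Kcount A N \<alpha> = k)) \<longlongrightarrow>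
            mu2 {L \<in> X2. card (lattice_prim L \<inter> R_set A) = k}) sequentially"
proof
  let ?H = "{v :: real \<times> real. \<bar>fst v\<bar> * snd v \<le> A \<and> 1 \<le> snd v \<and> snd v \<le> c}"
  let ?R = "{v :: real \<times> real. \<bar>fst v\<bar> \<le> A \<and> 0 \<le> snd v \<and> snd v \<le> 1}"
  have H: "admissible_region ?H" using assms(2) by (rule H_region_admissible)
  have R: "admissible_region ?R" by (rule R_region_admissible)
  have "mu2 {L \<in> X2. card (lattice_prim L \<inter> H_set A c) = k}
     = measure lborel {p \<in> strictly_reduced. coord_count ?H p = k} / measure lborel strictly_reduced"
    using H by (intro mu2_region) (auto simp: admissible_region_def H_set_def intro: compact_imp_closed)
  moreover have "\<forall>\<^sub>F N in sequentially. measure lborel {\<alpha> \<in> {0..1}. prim_count ?H N (N * \<alpha>) 0 (1 / N) = k}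
     = unif_prob (\<lambda>\<alpha>. EST A c N \<alpha> = k)"
    using eventually_ge_at_top[of 1] by eventually_elim (simp add: unif_prob_def EST_eq_prim_count)
  ultimately show "((\<lambda>N. unif_prob (\<lambda>\<alpha>. EST A c N \<alpha> = k)) \<longlongrightarrow>
            mu2 {L \<in> X2. card (lattice_prim L \<inter> H_set A c) = k}) sequentially"
    using Lim_transform_eventually[OF horocycle_equidistribution[OF H]] by simp
  have "mu2 {L \<in> X2. card (lattice_prim L \<inter> R_set A) = k}
     = measure lborel {p \<in> strictly_reduced. coord_count ?R p = k} / measure lborel strictly_reduced"
    using R by (intro mu2_region) (auto simp: admissible_region_def R_set_def intro: compact_imp_closed)
  moreover have "\<forall>\<^sub>F N in sequentially. measure lborel {\<alpha> \<in> {0..1}. prim_count ?R N (N * \<alpha>) 0 (1 / N) = k}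
     = unif_prob (\<lambda>\<alpha>. Kcount A N \<alpha> = k)"
    \<comment> \<open>The identity with \<open>prim_count\<close> is available only once N exceeds
      A, so finitely many N are skipped.\<close>
    using eventually_ge_at_top[of 1] eventually_gt_at_top[of "nat \<lceil>A\<rceil>"]
  proof eventually_elim
    case (elim N)
    have "A < real N" using elim(2) real_nat_ceiling_ge[of A] by linarith
    then show ?case using elim(1) by (simp add: unif_prob_def Kcount_eq_prim_count)
  qed
  ultimately show "((\<lambda>N. unif_prob (\<lambda>\<alpha>. Kcount A N \<alpha> = k)) \<longlongrightarrow>
            mu2 {L \<in> X2. card (lattice_prim L \<inter> R_set A) = k}) sequentially"
    using Lim_transform_eventually[OF horocycle_equidistribution[OF R]] by simp
qed

end
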